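(* Let $\Sigma$ be a finite non-empty alphabet, $\upsilon\notin\Sigma$ a variable, let $\mathcal G\subseteq W^{<\omega}(\Sigma)$ and $\mathcal F\subseteq W^{<\omega}(\Sigma ; \upsilon)$ be trees and let $\vec{w} \in W^\omega (\Sigma ; \upsilon)$ be an infinite sequence of variable words over $\Sigma$. Then: (1) Either there exists a variable reduction $\vec{u} \prec \vec{w}$ such that all the finite reductions of $\vec u$ over $\Sigma$ are contained in $\mathcal G$ (i.e. $RW^{<\omega}(\vec u)\subseteq\mathcal G$), or there exists a countable ordinal $\xi_1=\zeta_{\vec w}^{\mathcal G}$ (defined in the context) such that for every countable ordinal $\xi>\xi_1$ there exists a variable reduction $\vec{u}\prec\vec{w}$ such that all the finite reductions of $\vec u$ in the set $W^\xi(\Sigma)$ are contained in the complement of $\mathcal G$ (i.e. $W^{\xi}(\Sigma)\cap RW^{<\omega}(\vec u)\subseteq W^{<\omega}(\Sigma)\setminus\mathcal G$). (2) Either there exists a variable reduction $\vec{u} \prec \vec{w}$ such that all the finite variable reductions of $\vec u$ over $\Sigma$ are contained in $\mathcal F$ (i.e. $VRW^{<\omega}(\vec u)\subseteq\mathcal F$), or there exists a countable ordinal $\xi_2=\zeta_{\vec w}^{\mathcal F}$ (defined in the context) such that for every countable ordinal $\xi>\xi_2$ there exists a variable reduction $\vec{u}\prec\vec{w}$ such that all the finite variable reductions of $\vec u$ in the set $W^\xi(\Sigma;\upsilon)$ are contained in the complement of $\mathcal F$ (i.e. $W^{\xi}(\Sigma ; \upsilon)\cap VRW^{<\omega}(\vec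 u)\subseteq W^{<\omega}(\Sigma;\upsilon)\setminus\mathcal F$).
   Context: $\mathbb N=\{1,2,\ldots\}$. Words. $\Sigma$ is a finite non-empty alphabet and $\upsilon\notin\Sigma$ is the variable. $W(\Sigma)$ is the set of words over $\Sigma$, i.e. non-empty finite sequences of elements of $\Sigma$; $\ast$ is concatenation. $W(\Sigma;\upsilon)=W(\Sigma\cup\{\upsilon\})\setminus W(\Sigma)$ is the set of variable words. For $w\in W(\Sigma;\upsilon)$ and $\alpha\in\Sigma\cup\{\upsilon\}$, $w(\alpha)$ is $w$ with every occurrence of $\upsilon$ replaced by $\alpha$. $W^{<\omega}(\Sigma)$, $W^{<\omega}(\Sigma;\upsilon)$ are the sets of finite sequences (including $\emptyset$) of words, resp. of variable words; $W^{\omega}(\Sigma)$, $W^{\omega}(\Sigma;\upsilon)$ are the corresponding sets of infinite sequences. For words, $w_1\propto w_2$ means $w_1$ is a proper initial segment of $w_2$, and then $w_2-w_1$ is the word with $w_2=w_1\ast(w_2-w_1)$; for variable words $w_1\propto w_2$ requires in addition that $w_2-w_1$ be a variable word. For a family $\mathcal H$ of finite sequences of words, $\mathcal H^*$ consists of $\emptyset$ and all initial segments (including the sequence itself) of elements of $\mathcal H$; $\mathcal H$ is a tree if $\mathcal H^*=\mathcal H$. For a non-empty finite sequence $\mathbf w=(w_1,\ldots,w_l)$ of words over $\Sigma\cup\{\upsilon\}$ write $w_i=\alpha_{k_i}\alpha_{k_i+1}\cdots\alpha_{k_{i+1}-1}$ with $1=k_1<\cdots<k_{l+1}$ and put $d(\mathbf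 w)=\{k_2<\cdots<k_l\}$ ($=\emptyset$ if $l=1$). Reductions. Let $\vec w=(w_n)_{n\in\mathbb N}\in W^{\omega}(\Sigma;\upsilon)$ and let $\mathbf t$ be a finite or infinite sequence of words $t_i=\alpha_{k_i}\cdots\alpha_{k_{i+1}-1}$ over $\Sigma\cup\{\upsilon\}$ ($1=k_1<k_2<\cdots$). Then $\vec w[\mathbf t]$ is the sequence with $i$-th term $w_{k_i}(\alpha_{k_i})\ast\cdots\ast w_{k_{i+1}-1}(\alpha_{k_{i+1}-1})$; $\vec w[\emptyset]=\emptyset$. $RW^{<\omega}(\vec w)=\{\vec w[\mathbf t]:\mathbf t\in W^{<\omega}(\Sigma)\}$ (finite reductions), $VRW^{<\omega}(\vec w)=\{\vec w[\mathbf t]:\mathbf t\in W^{<\omega}(\Sigma;\upsilon)\}$ (finite variable reductions); $RW(\vec w)$, $VRW(\vec w)$ are the sets of words $u$ such that the one-term sequence $(u)$ is in $RW^{<\omega}(\vec w)$, resp. $VRW^{<\omega}(\vec w)$. $\vec u\prec\vec w$ ($\vec u$ is a variable reduction of $\vec w$) means $\vec u=\vec w[\vec t]$ for some $\vec t\in W^{\omega}(\Sigma;\upsilon)$. For a finite sequence $\mathbf w=(w_1,\ldots,w_n)$ of variable words, $VRW^{<\omega}(\mathbf w)$ is the set of sequences $(u_1,\ldots,u_l)$ with $u_i=w_{k_i}(\alpha_{k_i})\ast\cdots\ast w_{k_{i+1}-1}(\alpha_{k_{i+1}-1})$, where $1=k_1<\cdots<k_{l+1}=n+1$, $\alpha_j\in\Sigma\cup\{\upsilon\}$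 and each $u_i$ is a variable word. Hereditary families. For $\mathcal F\subseteq W^{<\omega}(\Sigma;\upsilon)$ let $\mathcal F_*$ consist of $\emptyset$ and all $\mathbf t\in VRW^{<\omega}(\mathbf s)$ with $\mathbf s\in\mathcal F^*\setminus\{\emptyset\}$; $\mathcal F$ is hereditary if $\mathcal F_*=\mathcal F$. For $\mathbf t=(t_1,\ldots,t_m)\in W^{<\omega}(\Sigma;\upsilon)$ put $\langle\mathbf t\rangle=\{(t_1(\alpha_1),\ldots,t_m(\alpha_m)):\alpha_1,\ldots,\alpha_m\in\Sigma\}$, and $\langle\emptyset\rangle=\{\emptyset\}$. For $\mathcal G\subseteq W^{<\omega}(\Sigma)$ let $\mathcal F_{\mathcal G}=\{\mathbf t\in W^{<\omega}(\Sigma;\upsilon):\langle\mathbf t\rangle\subseteq\mathcal G\}$ and $\mathcal G_*=\{\mathbf s\in W^{<\omega}(\Sigma):\mathbf s\in\langle\mathbf t\rangle\text{ for some }\mathbf t\in(\mathcal F_{\mathcal G})_*\}$; $\mathcal G$ is hereditary if $\mathcal G_*=\mathcal G$. Schreier system. For every non-zero countable limit ordinal $\lambda$ fix a strictly increasing sequence $(\lambda_n)_{n\in\mathbb N}$ of successor ordinals smaller than $\lambda$ with $\sup_n\lambda_n=\lambda$. For sets of naturals $s<t$ means every element of $s$ is smaller than every element of $t$. Families $\mathcal A_\xi$ ($\xi<\omega_1$): (1) $\mathcal A_0=\{\emptyset\}$, $\mathcal A_1=\{\{n\}:n\in\mathbb N\}$; (2) $\mathcal A_{\zeta+1}=\{\{n\}\cup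 s_1: n\in\mathbb N,\ \{n\}<s_1,\ s_1\in\mathcal A_\zeta\}$; (3i) $\mathcal A_{\omega^{\beta+1}}=\{\bigcup_{i=1}^n s_i: n=\min s_1,\ s_1<\cdots<s_n,\ s_1,\ldots,s_n\in\mathcal A_{\omega^\beta}\}$; (3ii) for a non-zero countable limit ordinal $\lambda$, $\mathcal A_{\omega^\lambda}=\{s\neq\emptyset: s\in\mathcal A_{\omega^{\lambda_n}}\text{ with }n=\min s\}$; (3iii) for a limit ordinal $\xi$ with $\omega^{\alpha}<\xi<\omega^{\alpha+1}$, $0<\alpha<\omega_1$, with Cantor normal form $\xi=\omega^\alpha p+\sum_{i=1}^m\omega^{a_i}p_i$ ($m\ge0$, $p,p_i\geq1$, $\alpha>a_1>\cdots>a_m>0$), $\mathcal A_\xi$ is the set of all $s=s_0\cup\bigcup_{i=1}^m s_i$ with $s_m<\cdots<s_1<s_0$, where $s_0$ is a union of $p$ sets $s^0_1<\cdots<s^0_p$ from $\mathcal A_{\omega^\alpha}$ and each $s_i$ is a union of $p_i$ sets $s^i_1<\cdots<s^i_{p_i}$ from $\mathcal A_{\omega^{a_i}}$. $W^0(\Sigma)$, $W^0(\Sigma;\upsilon)$ are the sets of one-term sequences of words, resp. variable words; for countable $\xi\ge1$, $W^\xi(\Sigma)$ (resp. $W^\xi(\Sigma;\upsilon)$) is the set of non-empty $\mathbf w$ in $W^{<\omega}(\Sigma)$ (resp. $W^{<\omega}(\Sigma;\upsilon)$) with $d(\mathbf w)\in\mathcal A_\xi$. Topology. Let $D=\mathbb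 N\times(\Sigma\cup\{\upsilon\})$ and $[D]^{<\omega}$ the set of finite subsets of $D$. A finite sequence of words with terms $w_i=\alpha_{k_i}\cdots\alpha_{k_{i+1}-1}$ ($1=k_1<k_2<\cdots$) is identified with the characteristic function in $\{0,1\}^{[D]^{<\omega}}$ of the set of all blocks $\{(j,\alpha_j):k_i\le j\le k_{i+1}-1\}$; $\emptyset$ is identified with $0$. A family is pointwise closed if the corresponding set of characteristic functions is closed in the product topology of $\{0,1\}^{[D]^{<\omega}}$. Strong Cantor–Bendixson index. For $\mathcal H\subseteq RW^{<\omega}(\vec w)$ and $\vec u\prec\vec w$, for $\mathbf s=(s_1,\ldots,s_k)\in\mathcal H\cap RW^{<\omega}(\vec u)$ let $A_{\mathbf s}=\{w\in RW(\vec u): s_1\ast\cdots\ast s_k\propto w,\ (s_1,\ldots,s_k,w-s_1\ast\cdots\ast s_k)\notin\mathcal H\}$ (and $A_\emptyset=\{w\in RW(\vec u):(w)\notin\mathcal H\}$). $(\mathcal H)^0_{\vec u}$ is the set of $\mathbf s\in\mathcal H\cap RW^{<\omega}(\vec u)$ such that $A_{\mathbf s}$ contains no infinite sequence $w_1\propto w_2\propto\cdots$; $(\mathcal H)^{\zeta+1}_{\vec u}=((\mathcal H)^{\zeta}_{\vec u})^0_{\vec u}$; $(\mathcal H)^{\xi}_{\vec u}=\bigcap_{\beta<\xi}(\mathcal H)^\beta_{\vec u}$ for limit $\xi$. $sO_{\vec u}(\mathcal H)$ is the smallest countable ordinal $\xi$ with $(\mathcal H)^\xi_{\vec u}=\emptyset$.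 For $\mathcal H\subseteq VRW^{<\omega}(\vec w)$ the same definitions are used with $VRW$ in place of $RW$ and $\propto$ for variable words. The ordinals. Let $\mathcal G_h$ be the largest hereditary subfamily of $\mathcal G\cup\{\emptyset\}$, explicitly: $\emptyset$ together with all $\mathbf s\in\mathcal G$ for which there is a non-empty $\mathbf t\in W^{<\omega}(\Sigma;\upsilon)$ with $\mathbf s\in\langle\mathbf t\rangle\subseteq\mathcal G$ and $\langle\mathbf u\rangle\subseteq\mathcal G$ for every $\mathbf u\in VRW^{<\omega}(\mathbf t_1)$ and every non-empty initial segment $\mathbf t_1$ of $\mathbf t$ (including $\mathbf t_1=\mathbf t$). Let $\mathcal F_h$ be the largest hereditary subfamily of $\mathcal F\cup\{\emptyset\}$, explicitly $\emptyset$ together with all non-empty $\mathbf t\in\mathcal F$ such that $VRW^{<\omega}(\mathbf t_1)\subseteq\mathcal F$ for every non-empty initial segment $\mathbf t_1$ of $\mathbf t$ (including $\mathbf t$). If $\mathcal G_h\cap RW^{<\omega}(\vec w)$ is pointwise closed, $\zeta^{\mathcal G}_{\vec w}=\sup\{sO_{\vec u}(\mathcal G_h\cap RW^{<\omega}(\vec w)):\vec u\prec\vec w\}$; if $\mathcal F_h\cap VRW^{<\omega}(\vec w)$ is pointwise closed, $\zeta^{\mathcal F}_{\vec w}=\sup\{sO_{\vec u}(\mathcal F_h\cap VRW^{<\omega}(\vec w)):\vec u\prec\vec w\}$. These ordinals are defined in these closed cases.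
   Formalization: In (1), ξ₁ equals ζ^G_w only when G_h∩RW^{<ω}(w) is pointwise closed, where ζ is defined; otherwise only some countable ξ₁ is claimed. For Σ={a,b}, w=(av,av,…), G=RW^{<ω}((vb,vb,…)) the first alternative fails and ζ is undefined. *)

theory Defs
  imports "HOL-Analysis.Function_Topology" "HOL-Library.Sublist"
begin

section \<open>Countable ordinals\<close>

text \<open>The countable ordinals are the elements of the cardinal successor of \<open>\<aleph>\<^sub>0\<close>, i.e. of
  \<open>\<omega>\<^sub>1\<close>, as a well-ordered type.\<close>

typedef cord = "Field (cardSuc natLeq)"
proof -
  have "(natLeq, cardSuc natLeq) \<in> ordLess"
    by (rule cardSuc_greater[OF natLeq_Card_order])
  then have "infinite (Field (cardSuc natLeq))"
    by (simp add: cardSuc_finite[OF natLeq_Card_order] Field_natLeq)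
  then have "Field (cardSuc natLeq) \<noteq> {}"
    by (metis finite.emptyI)
  then show ?thesis
    by (simp add: ex_in_conv)
qed

lemma Well_order_cardSuc_natLeq: "Well_order (cardSuc natLeq)"
  using cardSuc_Card_order[OF natLeq_Card_order] card_order_on_well_order_on by blast

instantiation cord :: ord
begin

definition less_eq_cord :: "cord \<Rightarrow> cord \<Rightarrow> bool" where
  "x \<le> (y :: cord) \<longleftrightarrow> (Rep_cord x, Rep_cord y) \<in> cardSuc natLeq"

definition less_cord :: "cord \<Rightarrow> cord \<Rightarrow> bool" where
  "x < y \<longleftrightarrow> x \<le> y \<and> x \<noteq> (y :: cord)"

instance ..

end

instance cord :: wellorder
proof
  note wo = Well_order_cardSuc_natLeq
  have lin: "Linear_order (cardSuc natLeq)" and wf: "wf (cardSuc natLeq - Id)"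
    using wo by (auto simp: well_order_on_def)
  have ref: "refl_on (Field (cardSuc natLeq)) (cardSuc natLeq)" and tr: "trans (cardSuc natLeq)"
    and asym: "antisym (cardSuc natLeq)" and tot: "total_on (Field (cardSuc natLeq)) (cardSuc natLeq)"
    using lin by (auto simp: order_on_defs)
  fix x y z :: cord
  show refl': "x \<le> x"
    using ref Rep_cord unfolding less_eq_cord_def refl_on_def by blast
  show "x \<le> z" if "x \<le> y" "y \<le> z"
    using that tr unfolding less_eq_cord_def trans_def by blast
  show anti: "x = y" if "x \<le> y" "y \<le> x"
    using that asym unfolding less_eq_cord_def antisym_def by (metis Rep_cord_inject)
  show "x < y \<longleftrightarrow> x \<le> y \<and> \<not> y \<le> x"
    using anti refl' unfolding less_cord_def by blast
  show "x \<le> y \<or> y \<le> x"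
    using tot ref Rep_cord unfolding less_eq_cord_def total_on_def refl_on_def by metis
  show "P a" if step: "\<And>x. (\<And>y. y < x \<Longrightarrow> P y) \<Longrightarrow> P x" for P and a :: cord
  proof -
    have "wf (inv_image (cardSuc natLeq - Id) Rep_cord)"
      using wf by (rule wf_inv_image)
    moreover have "inv_image (cardSuc natLeq - Id) Rep_cord = {(x, y). x < y}"
      by (auto simp: inv_image_def less_cord_def less_eq_cord_def Rep_cord_inject)
    ultimately have "wf {(x :: cord, y). x < y}" by simp
    then show ?thesis
      by (induction a rule: wf_induct_rule) (use step in auto)
  qed
qed

instantiation cord :: conditionally_complete_linorder
begin

definition inf_cord :: "cord \<Rightarrow> cord \<Rightarrow> cord" where "(inf :: cord \<Rightarrow> cord \<Rightarrow> cord) = min"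
definition sup_cord :: "cord \<Rightarrow> cord \<Rightarrow> cord" where "(sup :: cord \<Rightarrow> cord \<Rightarrow> cord) = max"
definition Inf_cord :: "cord set \<Rightarrow> cord" where "Inf (X :: cord set) = (LEAST x. x \<in> X)"
definition Sup_cord :: "cord set \<Rightarrow> cord" where "Sup (X :: cord set) = (LEAST y. \<forall>x\<in>X. x \<le> y)"

instance
proof
  fix x y z :: cord and X :: "cord set"
  show "inf x y \<le> x" "inf x y \<le> y" "x \<le> sup x y" "y \<le> sup x y"
    by (simp_all add: inf_cord_def sup_cord_def)
  show "z \<le> inf x y" if "z \<le> x" "z \<le> y" using that by (simp add: inf_cord_def)
  show "sup x y \<le> z" if "x \<le> z" "y \<le> z" using that by (simp add: sup_cord_def)
  show "Inf X \<le> x" if "x \<in> X"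
    unfolding Inf_cord_def using that by (rule Least_le)
  show "z \<le> Inf X" if "X \<noteq> {}" "\<And>x. x \<in> X \<Longrightarrow> z \<le> x"
    unfolding Inf_cord_def using that by (metis LeastI ex_in_conv)
  show "x \<le> Sup X" if "x \<in> X" "bdd_above X"
  proof -
    from that(2) obtain b where "\<forall>x\<in>X. x \<le> b" by (auto simp: bdd_above_def)
    then have "\<forall>x\<in>X. x \<le> Sup X" unfolding Sup_cord_def by (rule LeastI)
    with that show ?thesis by blast
  qed
  show "Sup X \<le> z" if "\<And>x. x \<in> X \<Longrightarrow> x \<le> z"
    unfolding Sup_cord_def using that by (intro Least_le) blast
qed

end

lemma countable_iff_card_of_le_nat:
  "countable A \<longleftrightarrow> (card_of A, card_of (UNIV :: nat set)) \<in> ordLeq"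
  by (simp add: countable_def card_of_ordLeq[symmetric])

lemma countable_lessThan_cord: "countable {..<a :: cord}"
proof -
  let ?r = "cardSuc natLeq"
  have "(card_of (underS ?r (Rep_cord a)), ?r) \<in> ordLess"
    by (rule card_of_underS[OF cardSuc_Card_order[OF natLeq_Card_order] Rep_cord])
  then have "(card_of (underS ?r (Rep_cord a)), natLeq) \<in> ordLeq"
    using cardSuc_ordLeq_ordLess[OF natLeq_Card_order card_of_Card_order] by blast
  then have "(card_of (underS ?r (Rep_cord a)), card_of (UNIV :: nat set)) \<in> ordLeq"
    using card_of_nat ordIso_symmetric ordLeq_ordIso_trans by blast
  then have "countable (underS ?r (Rep_cord a))"
    by (simp add: countable_iff_card_of_le_nat)
  moreover have "Rep_cord ` {..<a} \<subseteq> underS ?r (Rep_cord a)"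
    by (auto simp: underS_def less_cord_def less_eq_cord_def Rep_cord_inject)
  ultimately have "countable (Rep_cord ` {..<a})" by (rule countable_subset[rotated])
  then show ?thesis
    by (rule countable_image_inj_on) (simp add: inj_on_def Rep_cord_inject)
qed

lemma uncountable_UNIV_cord: "uncountable (UNIV :: cord set)"
proof
  assume "countable (UNIV :: cord set)"
  then have "countable (Field (cardSuc natLeq))"
    using type_definition.Rep_range[OF type_definition_cord] by (metis countable_image)
  then have "(card_of (Field (cardSuc natLeq)), card_of (UNIV :: nat set)) \<in> ordLeq"
    by (simp add: countable_iff_card_of_le_nat)
  then have "(cardSuc natLeq, natLeq) \<in> ordLeq"
    using card_of_Field_ordIso[OF cardSuc_Card_order[OF natLeq_Card_order]] card_of_nat
      ordIso_ordLeq_trans ordLeq_ordIso_trans ordIso_symmetric by blast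
  then show False
    using cardSuc_greater[OF natLeq_Card_order] not_ordLess_ordLeq by blast
qed

lemma countable_bounded_cord:
  assumes "countable (A :: cord set)"
  shows "\<exists>b. \<forall>a\<in>A. a < b"
proof (rule ccontr)
  assume "\<nexists>b. \<forall>a\<in>A. a < b"
  then have "\<forall>b. \<exists>a\<in>A. b \<le> a"
    by (simp add: not_less)
  then have "UNIV = (\<Union>a\<in>A. insert a {..<a})"
    unfolding le_less by blast
  then have "countable (UNIV :: cord set)"
    using assms countable_lessThan_cord by (metis countable_UN countable_insert)
  with uncountable_UNIV_cord show False by simp
qed

lemma countable_bdd_above_cord: "countable (A :: cord set) \<Longrightarrow> bdd_above A"
  using countable_bounded_cord[of A] by (meson bdd_aboveI less_imp_le)

definition osuc :: "cord \<Rightarrow> cord" where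
  "osuc a = (LEAST b. a < b)"

instantiation cord :: "{zero, one}"
begin
definition zero_cord :: cord where "0 = (LEAST x :: cord. True)"
definition one_cord :: cord where "1 = osuc 0"
instance ..
end

definition is_osuc :: "cord \<Rightarrow> bool" where
  "is_osuc a \<longleftrightarrow> (\<exists>b. a = osuc b)"

definition is_limit :: "cord \<Rightarrow> bool" where
  "is_limit a \<longleftrightarrow> a \<noteq> 0 \<and> \<not> is_osuc a"

definition opred :: "cord \<Rightarrow> cord" where
  "opred a = (THE b. a = osuc b)"

lemma zero_le_cord [simp]: "(0 :: cord) \<le> a"
  unfolding zero_cord_def by (rule Least_le) simp

lemma less_osuc [simp]: "a < osuc a"
proof -
  obtain b where "a < b" using countable_bounded_cord[of "{a}"] by auto
  then show ?thesis unfolding osuc_def by (rule LeastI)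
qed

lemma osuc_le_iff: "osuc a \<le> b \<longleftrightarrow> a < b"
  using less_osuc[of a] by (auto simp: osuc_def intro: Least_le less_le_trans)

lemma less_osuc_iff: "a < osuc b \<longleftrightarrow> a \<le> b"
  using osuc_le_iff[of b a] by (auto simp: not_le[symmetric])

lemma osuc_inject [simp]: "osuc a = osuc b \<longleftrightarrow> a = b"
  by (metis less_osuc less_osuc_iff order_antisym)

lemma osuc_nonzero [simp]: "osuc a \<noteq> 0"
  by (metis less_osuc not_le zero_le_cord)

lemma opred_osuc [simp]: "opred (osuc a) = a"
  by (simp add: opred_def)

function ord_rec :: "'b \<Rightarrow> ('b \<Rightarrow> 'b) \<Rightarrow> ('b set \<Rightarrow> 'b) \<Rightarrow> cord \<Rightarrow> 'b" where
  "ord_rec z s l a =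
     (if a = 0 then z
      else if is_osuc a then s (ord_rec z s l (opred a))
      else l (ord_rec z s l ` {..<a}))"
  by pat_completeness auto
termination
  by (relation "inv_image {(x, y). x < y} (\<lambda>(z, s, l, a). a)")
     (auto simp: wf_inv_image wf is_osuc_def)

declare ord_rec.simps [simp del]

lemma ord_rec_0 [simp]: "ord_rec z s l 0 = z"
  by (simp add: ord_rec.simps[of _ _ _ 0])

lemma ord_rec_osuc [simp]: "ord_rec z s l (osuc a) = s (ord_rec z s l a)"
  by (subst ord_rec.simps) (auto simp: is_osuc_def)

lemma ord_rec_limit: "is_limit a \<Longrightarrow> ord_rec z s l a = l (ord_rec z s l ` {..<a})"
  by (subst ord_rec.simps) (simp add: is_limit_def)

instantiation cord :: plus
begin
definition plus_cord :: "cord \<Rightarrow> cord \<Rightarrow> cord" where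
  "a + b = ord_rec (a :: cord) osuc Sup b"
instance ..
end

text \<open>\<open>omult a n\<close> is the ordinal product \<open>a \<cdot> n\<close> for a natural number \<open>n\<close>, and \<open>opow a\<close> is
  \<open>\<omega>\<^sup>a\<close>. All suprema of countable sets of countable ordinals exist, see
  \<open>countable_bdd_above_cord\<close>.\<close>

primrec omult :: "cord \<Rightarrow> nat \<Rightarrow> cord" where
  "omult a 0 = 0"
| "omult a (Suc n) = omult a n + a"

definition opow :: "cord \<Rightarrow> cord" where
  "opow = ord_rec 1 (\<lambda>c. SUP n. omult c n) Sup"

text \<open>\<open>cnf a p m\<close> is \<open>\<omega>\<^bsup>a 0\<^esup> \<cdot> p 0 + \<dots> + \<omega>\<^bsup>a m\<^esup> \<cdot> p m\<close>.\<close>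

primrec cnf :: "(nat \<Rightarrow> cord) \<Rightarrow> (nat \<Rightarrow> nat) \<Rightarrow> nat \<Rightarrow> cord" where
  "cnf a p 0 = omult (opow (a 0)) (p 0)"
| "cnf a p (Suc m) = cnf a p m + omult (opow (a (Suc m))) (p (Suc m))"


section \<open>The Schreier system\<close>

text \<open>A choice, for every limit ordinal \<open>l\<close>, of a sequence \<open>fs l 1 < fs l 2 < \<dots>\<close> of successor
  ordinals with supremum \<open>l\<close>; the value \<open>fs l 0\<close> is irrelevant.\<close>

definition ladder_system :: "(cord \<Rightarrow> nat \<Rightarrow> cord) \<Rightarrow> bool" where
  "ladder_system fs \<longleftrightarrow>
     (\<forall>l. is_limit l \<longrightarrow>
        (\<forall>n\<ge>1. is_osuc (fs l n) \<and> fs l n < l \<and> fs l n < fs l (Suc n)) \<and>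
        (SUP n\<in>{1..}. fs l n) = l)"

definition set_less :: "nat set \<Rightarrow> nat set \<Rightarrow> bool" where
  "set_less s t \<longleftrightarrow> (\<forall>x\<in>s. \<forall>y\<in>t. x < y)"

text \<open>\<open>schreier fs \<xi> s\<close> says that \<open>s \<in> \<A>\<^sub>\<xi>\<close>. The recursion on \<open>\<xi>\<close> is written as an inductive
  predicate with one rule for each form of \<open>\<xi>\<close>; the only overlap, between \<open>one\<close> and \<open>succ\<close> at
  \<open>\<xi> = 1\<close>, gives the same sets. In rule \<open>cantor\<close> the index \<open>0\<close> plays the role of the leading
  term, i.e. \<open>a 0 = \<alpha>\<close> and \<open>p 0 = p\<close>.\<close>

inductive schreier :: "(cord \<Rightarrow> nat \<Rightarrow> cord) \<Rightarrow> cord \<Rightarrow> nat set \<Rightarrow> bool"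
  for fs :: "cord \<Rightarrow> nat \<Rightarrow> cord" where
  zero: "schreier fs 0 {}"
| one: "1 \<le> n \<Longrightarrow> schreier fs 1 {n}"
| succ: "1 \<le> n \<Longrightarrow> set_less {n} s \<Longrightarrow> schreier fs z s \<Longrightarrow> schreier fs (osuc z) ({n} \<union> s)"
| pow_succ: "1 \<le> n \<Longrightarrow> n = Min (s 1) \<Longrightarrow>
    \<forall>i\<in>{1..n}. \<forall>j\<in>{1..n}. i < j \<longrightarrow> set_less (s i) (s j) \<Longrightarrow>
    \<forall>i\<in>{1..n}. schreier fs (opow b) (s i) \<Longrightarrow>
    schreier fs (opow (osuc b)) (\<Union>i\<in>{1..n}. s i)"
| pow_limit: "is_limit l \<Longrightarrow> s \<noteq> {} \<Longrightarrow> schreier fs (opow (fs l (Min s))) s \<Longrightarrow>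
    schreier fs (opow l) s"
| cantor: "is_limit x \<Longrightarrow> opow (a 0) < x \<Longrightarrow> x < opow (osuc (a 0)) \<Longrightarrow> x = cnf a p m \<Longrightarrow>
    \<forall>i\<le>m. 0 < a i \<and> 1 \<le> p i \<Longrightarrow> \<forall>i<m. a (Suc i) < a i \<Longrightarrow>
    \<forall>i\<le>m. \<forall>j\<in>{1..p i}. schreier fs (opow (a i)) (s i j) \<Longrightarrow>
    \<forall>i\<le>m. \<forall>j\<in>{1..p i}. \<forall>k\<in>{1..p i}. j < k \<longrightarrow> set_less (s i j) (s i k) \<Longrightarrow>
    \<forall>i\<le>m. \<forall>k\<le>m. i < k \<longrightarrow> set_less (\<Union>j\<in>{1..p k}. s k j) (\<Union>j\<in>{1..p i}. s i j) \<Longrightarrow>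
    schreier fs x (\<Union>i\<le>m. \<Union>j\<in>{1..p i}. s i j)"


section \<open>Words and reductions\<close>

text \<open>Letters are the elements of an arbitrary type; \<open>S\<close> is the alphabet and \<open>v\<close> the variable.
  Finite sequences of words are lists of lists, and infinite sequences are indexed from \<open>0\<close>,
  so that \<open>w n\<close> is the \<open>(n + 1)\<close>-st term.\<close>

definition words :: "'a set \<Rightarrow> 'a list set" where
  "words S = {w. w \<noteq> [] \<and> set w \<subseteq> S}"

definition vwords :: "'a set \<Rightarrow> 'a \<Rightarrow> 'a list set" where
  "vwords S v = words (insert v S) - words S"

definition subst :: "'a \<Rightarrow> 'a \<Rightarrow> 'a list \<Rightarrow> 'a list" where
  "subst v a w = map (\<lambda>x. if x = v then a else x) w"

definition star :: "'a list list set \<Rightarrow> 'a list list set" where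
  "star H = {[]} \<union> {s. \<exists>t\<in>H. prefix s t}"

definition is_tree :: "'a list list set \<Rightarrow> bool" where
  "is_tree H \<longleftrightarrow> star H = H"

text \<open>For a sequence of words \<open>t\<close>, \<open>start t i = k\<^bsub>i+1\<^esub> - 1\<close> in the usual notation where the
  \<open>(i + 1)\<close>-st word occupies the positions \<open>k\<^bsub>i+1\<^esub>, \<dots>, k\<^bsub>i+2\<^esub> - 1\<close>, counted from \<open>1\<close>.\<close>

definition start :: "(nat \<Rightarrow> 'a list) \<Rightarrow> nat \<Rightarrow> nat" where
  "start t i = (\<Sum>j<i. length (t j))"

definition dset :: "'a list list \<Rightarrow> nat set" where
  "dset t = {start ((!) t) i + 1 | i. 1 \<le> i \<and> i < length t}"

text \<open>\<open>block v w k t = w\<^sub>k(t\<^sub>0) * w\<^bsub>k+1\<^esub>(t\<^sub>1) * \<dots>\<close>\<close>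

definition block :: "'a \<Rightarrow> (nat \<Rightarrow> 'a list) \<Rightarrow> nat \<Rightarrow> 'a list \<Rightarrow> 'a list" where
  "block v w k t = concat (map (\<lambda>j. subst v (t ! j) (w (k + j))) [0..<length t])"

definition red_fin :: "'a \<Rightarrow> (nat \<Rightarrow> 'a list) \<Rightarrow> 'a list list \<Rightarrow> 'a list list" where
  "red_fin v w t = map (\<lambda>i. block v w (start ((!) t) i) (t ! i)) [0..<length t]"

definition red_inf :: "'a \<Rightarrow> (nat \<Rightarrow> 'a list) \<Rightarrow> (nat \<Rightarrow> 'a list) \<Rightarrow> nat \<Rightarrow> 'a list" where
  "red_inf v w t = (\<lambda>i. block v w (start t i) (t i))"

definition RW_fin :: "'a set \<Rightarrow> 'a \<Rightarrow> (nat \<Rightarrow> 'a list) \<Rightarrow> 'a list list set" where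
  "RW_fin S v w = red_fin v w ` lists (words S)"

definition VRW_fin :: "'a set \<Rightarrow> 'a \<Rightarrow> (nat \<Rightarrow> 'a list) \<Rightarrow> 'a list list set" where
  "VRW_fin S v w = red_fin v w ` lists (vwords S v)"

definition RW :: "'a set \<Rightarrow> 'a \<Rightarrow> (nat \<Rightarrow> 'a list) \<Rightarrow> 'a list set" where
  "RW S v w = {x. [x] \<in> RW_fin S v w}"

definition VRW :: "'a set \<Rightarrow> 'a \<Rightarrow> (nat \<Rightarrow> 'a list) \<Rightarrow> 'a list set" where
  "VRW S v w = {x. [x] \<in> VRW_fin S v w}"

definition variable_reduction :: "'a set \<Rightarrow> 'a \<Rightarrow> (nat \<Rightarrow> 'a list) \<Rightarrow> (nat \<Rightarrow> 'a list) \<Rightarrow> bool" where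
  "variable_reduction S v u w \<longleftrightarrow> (\<exists>t. (\<forall>i. t i \<in> vwords S v) \<and> u = red_inf v w t)"

text \<open>The variable reductions of a finite sequence of variable words; all its terms are used.\<close>

definition VRW_list :: "'a set \<Rightarrow> 'a \<Rightarrow> 'a list list \<Rightarrow> 'a list list set" where
  "VRW_list S v w =
     {u. \<exists>t\<in>lists (words (insert v S)). length (concat t) = length w \<and>
         u = red_fin v ((!) w) t \<and> u \<in> lists (vwords S v)}"


section \<open>Hereditary subfamilies and the families \<open>W\<^sup>\<xi>\<close>\<close>

definition angle :: "'a set \<Rightarrow> 'a \<Rightarrow> 'a list list \<Rightarrow> 'a list list set" where
  "angle S v t = {s. list_all2 (\<lambda>x y. \<exists>a\<in>S. x = subst v a y) s t}"

definition hered_words :: "'a set \<Rightarrow> 'a \<Rightarrow> 'a list list set \<Rightarrow> 'a list list set" where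
  "hered_words S v G =
     {[]} \<union>
     {s\<in>G. \<exists>t\<in>lists (vwords S v). t \<noteq> [] \<and> s \<in> angle S v t \<and> angle S v t \<subseteq> G \<and>
        (\<forall>t1. t1 \<noteq> [] \<and> prefix t1 t \<longrightarrow> (\<forall>u\<in>VRW_list S v t1. angle S v u \<subseteq> G))}"

definition hered_vwords :: "'a set \<Rightarrow> 'a \<Rightarrow> 'a list list set \<Rightarrow> 'a list list set" where
  "hered_vwords S v F =
     {[]} \<union> {t\<in>F. t \<noteq> [] \<and> (\<forall>t1. t1 \<noteq> [] \<and> prefix t1 t \<longrightarrow> VRW_list S v t1 \<subseteq> F)}"

text \<open>Since \<open>\<A>\<^sub>0 = {\<emptyset>}\<close> and \<open>dset\<close> of a non-empty sequence is empty only for one-term sequences,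
  the case \<open>\<xi> = 0\<close> need not be separated.\<close>

definition Wxi :: "(cord \<Rightarrow> nat \<Rightarrow> cord) \<Rightarrow> 'a set \<Rightarrow> cord \<Rightarrow> 'a list list set" where
  "Wxi fs S x = {s\<in>lists (words S). s \<noteq> [] \<and> schreier fs x (dset s)}"

definition VWxi :: "(cord \<Rightarrow> nat \<Rightarrow> cord) \<Rightarrow> 'a set \<Rightarrow> 'a \<Rightarrow> cord \<Rightarrow> 'a list list set" where
  "VWxi fs S v x = {s\<in>lists (vwords S v). s \<noteq> [] \<and> schreier fs x (dset s)}"


section \<open>Pointwise closed families\<close>

definition Dset :: "'a set \<Rightarrow> 'a \<Rightarrow> (nat \<times> 'a) set" where
  "Dset S v = {1..} \<times> insert v S"

definition blocks :: "'a list list \<Rightarrow> (nat \<times> 'a) set set" where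
  "blocks s =
     {{(start ((!) s) i + 1 + j, s ! i ! j) | j. j < length (s ! i)} | i. i < length s}"

definition char_fun :: "'a set \<Rightarrow> 'a \<Rightarrow> 'a list list \<Rightarrow> (nat \<times> 'a) set \<Rightarrow> bool" where
  "char_fun S v s = restrict (\<lambda>A. A \<in> blocks s) (Fpow (Dset S v))"

definition pointwise_closed :: "'a set \<Rightarrow> 'a \<Rightarrow> 'a list list set \<Rightarrow> bool" where
  "pointwise_closed S v H \<longleftrightarrow>
     closedin (product_topology (\<lambda>_. discrete_topology (UNIV :: bool set)) (Fpow (Dset S v)))
       (char_fun S v ` H)"


section \<open>The strong Cantor--Bendixson index\<close>

definition propto_var :: "'a set \<Rightarrow> 'a \<Rightarrow> 'a list \<Rightarrow> 'a list \<Rightarrow> bool" where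
  "propto_var S v x y \<longleftrightarrow> strict_prefix x y \<and> drop (length x) y \<in> vwords S v"

text \<open>The derivative is defined once for both kinds of words: \<open>R\<close> is the set of finite
  (variable) reductions, \<open>R1\<close> that of (variable) reduced words, and \<open>pr\<close> the relation
  \<open>\<propto>\<close>. For \<open>s = []\<close> the set \<open>A\<^sub>s\<close> below is \<open>{w \<in> R1. [w] \<notin> H}\<close>.\<close>

definition cb_A :: "('a list \<Rightarrow> 'a list \<Rightarrow> bool) \<Rightarrow> 'a list set \<Rightarrow> 'a list list set \<Rightarrow>
    'a list list \<Rightarrow> 'a list set" where
  "cb_A pr R1 H s = {w\<in>R1. pr (concat s) w \<and> s @ [drop (length (concat s)) w] \<notin> H}"

definition cb_deriv :: "('a list \<Rightarrow> 'a list \<Rightarrow> bool) \<Rightarrow> 'a list list set \<Rightarrow> 'a list set \<Rightarrow>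
    'a list list set \<Rightarrow> 'a list list set" where
  "cb_deriv pr R R1 H =
     {s\<in>H \<inter> R. \<nexists>f :: nat \<Rightarrow> 'a list. \<forall>n. f n \<in> cb_A pr R1 H s \<and> pr (f n) (f (Suc n))}"

definition cb_iter :: "('b set \<Rightarrow> 'b set) \<Rightarrow> 'b set \<Rightarrow> cord \<Rightarrow> 'b set" where
  "cb_iter D H = ord_rec (D H) D Inter"

definition cb_words :: "'a set \<Rightarrow> 'a \<Rightarrow> (nat \<Rightarrow> 'a list) \<Rightarrow> 'a list list set \<Rightarrow> cord \<Rightarrow>
    'a list list set" where
  "cb_words S v u = cb_iter (cb_deriv strict_prefix (RW_fin S v u) (RW S v u))"

definition cb_vwords :: "'a set \<Rightarrow> 'a \<Rightarrow> (nat \<Rightarrow> 'a list) \<Rightarrow> 'a list list set \<Rightarrow> cord \<Rightarrow>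
    'a list list set" where
  "cb_vwords S v u = cb_iter (cb_deriv (propto_var S v) (VRW_fin S v u) (VRW S v u))"

text \<open>\<open>is_sO K \<xi>\<close>: for the transfinite sequence \<open>K\<close> of derivatives, the index exists and is \<open>\<xi>\<close>.\<close>

definition is_sO :: "(cord \<Rightarrow> 'b set) \<Rightarrow> cord \<Rightarrow> bool" where
  "is_sO K x \<longleftrightarrow> K x = {} \<and> (\<forall>y<x. K y \<noteq> {})"

text \<open>\<open>is_zeta_words S v G w \<xi>\<close> and \<open>is_zeta_vwords S v F w \<xi>\<close>: all the indices \<open>sO\<^sub>u\<close> exist as
  countable ordinals, their supremum over \<open>u \<prec> w\<close> is a countable ordinal, and it is \<open>\<xi>\<close>.
  (On type \<open>cord\<close>, \<open>Sup\<close> alone would say nothing for unbounded sets.)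

  These ordinals are only meant for pointwise closed families. For variable words, closedness
  follows when no \<open>u \<prec> w\<close> satisfies \<open>VRW_fin S v u \<subseteq> F\<close>. For words the analogous implication
  fails, since the sequence \<open>t\<close> in \<open>hered_words\<close> need not be a reduction of \<open>w\<close>: for \<open>S = {a, b}\<close>,
  \<open>w\<close> constantly \<open>av\<close> and \<open>G\<close> the set of finite reductions of the constant sequence \<open>vb\<close>, the
  sequences \<open>(ab, \<dots>, ab)\<close> make the family non-closed, but no \<open>u \<prec> w\<close> has its reductions in \<open>G\<close>.\<close>

definition is_sup_of_indices :: "('u \<Rightarrow> bool) \<Rightarrow> ('u \<Rightarrow> cord \<Rightarrow> 'b set) \<Rightarrow> cord \<Rightarrow> bool" where
  "is_sup_of_indices P K x \<longleftrightarrow>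
     (\<forall>u. P u \<longrightarrow> (\<exists>y. is_sO (K u) y)) \<and>
     bdd_above {y. \<exists>u. P u \<and> is_sO (K u) y} \<and>
     x = Sup {y. \<exists>u. P u \<and> is_sO (K u) y}"

definition is_zeta_words :: "'a set \<Rightarrow> 'a \<Rightarrow> 'a list list set \<Rightarrow> (nat \<Rightarrow> 'a list) \<Rightarrow> cord \<Rightarrow> bool" where
  "is_zeta_words S v G w =
     is_sup_of_indices (\<lambda>u. variable_reduction S v u w)
       (\<lambda>u. cb_words S v u (hered_words S v G \<inter> RW_fin S v w))"

definition is_zeta_vwords :: "'a set \<Rightarrow> 'a \<Rightarrow> 'a list list set \<Rightarrow> (nat \<Rightarrow> 'a list) \<Rightarrow> cord \<Rightarrow> bool" where
  "is_zeta_vwords S v F w =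
     is_sup_of_indices (\<lambda>u. variable_reduction S v u w)
       (\<lambda>u. cb_vwords S v u (hered_vwords S v F \<inter> VRW_fin S v w))"

end

theory Submission
  imports Defs
begin

text \<open>Both halves rest on a Ramsey theorem for open sets of infinite reductions: given a family
  \<open>O\<close> of finite sequences, some \<open>u \<prec> w\<close> has no finite reduction in \<open>O\<close>, or each of its
  infinite reductions has an initial segment in \<open>O\<close>. It follows by fusion from a pair of
  idempotent ultrafilters \<open>p\<close> on words and \<open>q\<close> on variable words with \<open>p q = q p = q\<close>, all of
  whose substitution instances \<open>q(a)\<close> equal \<open>p\<close>; these are found in the algebra of filters, where
  minimality arguments replace compactness.

  Take for \<open>O\<close> the members of \<open>W\<^sup>\<xi>\<close> that lie in the given tree. The first alternative is the
  claim. In the second, all reductions of \<open>u\<close> stay in the tree until their cuts form a set in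
  \<open>\<A>\<^sub>\<xi>\<close>. The families \<open>\<A>\<^sub>\<xi>\<close> have rank at least \<open>\<xi>\<close> on every infinite set of positions, so after
  thinning \<open>u\<close> there is a system of sets of cuts, closed under subsets, all of whose members come
  before \<open>\<A>\<^sub>\<xi>\<close> and which still has rank \<open>\<xi>\<close>. Being closed under subsets it consists of reductions in
  the hereditary part, and so the index is at least \<open>\<xi>\<close>, against \<open>\<xi> > \<zeta>\<close>.

  The indices have a common countable bound as soon as the hereditary part has no infinite branch,
  because the strong derivative is contained in the derivative of the tree under one-term
  extension.\<close>

section \<open>Ordinal arithmetic\<close>

text \<open>Two demands shape the auxiliary system of cuts. Heredity: variable reductions of a
  finite sequence merge its words, so a system reaching the hereditary part must tolerate the
  deletion of arbitrary cuts, and nothing ensures this for the sets without an initial segment in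
  \<A>_\<xi>. Cuts are therefore labelled by decreasing ordinals that bound the remaining rank from
  below; deleting a cut leaves the other labels decreasing. Strength: the derivative allows no
  infinite chain of exceptional continuations, so a sequence survives as soon as all sufficiently
  long continuations do. Hence rank is measured by cofinite branching, and a label d may stand at
  every position beyond a number attached to d. In the half on words, failure of the first
  alternative does not make the hereditary part closed. The ordinal is then found below a reduction
  all of whose infinite reductions leave the tree, and it is tied to \<zeta> only in the closed
  case.\<close>

lemma cord_cases [case_names zero osuc limit]:
  assumes "a = (0::cord) \<Longrightarrow> P" "\<And>b. a = osuc b \<Longrightarrow> P" "is_limit a \<Longrightarrow> P"
  shows P
  using assms by (auto simp: is_limit_def is_osuc_def)

lemma cord_pos_iff: "0 < (a::cord) \<longleftrightarrow> a \<noteq> 0"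
  using zero_le_cord[of a] by (auto simp: le_less)

lemma is_limit_pos: "is_limit a \<Longrightarrow> 0 < a"
  by (simp add: is_limit_def cord_pos_iff)

lemma osuc_less_limit: "is_limit l \<Longrightarrow> a < l \<Longrightarrow> osuc a < l"
  using osuc_le_iff[of a l] by (auto simp: is_limit_def is_osuc_def le_less)

lemma bdd_above_image_lessThan_cord [simp]: "bdd_above ((f :: cord \<Rightarrow> cord) ` {..<a})"
  by (intro countable_bdd_above_cord countable_image countable_lessThan_cord)

lemma less_Sup_image_limit:
  assumes "is_limit l" "b < Sup ((f :: cord \<Rightarrow> cord) ` {..<l})"
  shows "\<exists>c<l. b < f c"
proof -
  have "f ` {..<l} \<noteq> {}" using is_limit_pos[OF assms(1)] by auto
  then show ?thesis using assms(2) by (subst (asm) less_cSup_iff) auto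
qed

lemma image_le_Sup_limit: "c < l \<Longrightarrow> (f :: cord \<Rightarrow> cord) c \<le> Sup (f ` {..<l})"
  by (rule cSup_upper) auto

lemma cord_add_0 [simp]: "a + 0 = (a::cord)"
  by (simp add: plus_cord_def)

lemma cord_add_osuc [simp]: "a + osuc b = osuc (a + b)"
  by (simp add: plus_cord_def)

lemma cord_add_limit: "is_limit l \<Longrightarrow> a + l = Sup ((\<lambda>b. a + b) ` {..<l})"
  by (simp add: plus_cord_def ord_rec_limit)

lemma cord_add_less_mono: "b < c \<Longrightarrow> a + b < a + (c::cord)"
proof (induction c arbitrary: b rule: less_induct)
  case (less c)
  show ?case
  proof (cases c rule: cord_cases)
    case zero with less.prems show ?thesis using cord_pos_iff zero_le_cord by (metis not_le)
  next
    case (osuc d)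
    then have "b \<le> d" using less.prems by (simp add: less_osuc_iff)
    then have "a + b \<le> a + d" using less.IH[of d b] osuc by (auto simp: le_less)
    then show ?thesis using osuc by (simp add: less_osuc_iff)
  next
    case limit
    have 1: "osuc b < c" using limit less.prems by (rule osuc_less_limit)
    have "a + b < a + osuc b" by simp
    also have "\<dots> \<le> a + c" using 1 by (simp only: cord_add_limit[OF limit] image_le_Sup_limit)
    finally show ?thesis .
  qed
qed

lemma cord_add_le_mono: "b \<le> c \<Longrightarrow> a + b \<le> a + (c::cord)"
  using cord_add_less_mono[of b c a] by (auto simp: le_less)

lemma cord_add_left_cancel: "a + b = a + (c::cord) \<longleftrightarrow> b = c"
  by (metis cord_add_less_mono less_irrefl linorder_neqE)

lemma cord_le_add: "a \<le> a + (b::cord)"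
  using cord_add_le_mono[of 0 b a] by simp

text \<open>Treats successor and limit \<open>x\<close> alike, so that later inductions over sums
  need no case distinction; for \<open>x = 0\<close> there would be no candidate for
  \<open>c\<close>.\<close>

lemma cord_less_addD: "0 < x \<Longrightarrow> b < a + x \<Longrightarrow> \<exists>c<x. b \<le> a + (c::cord)"
proof (cases x rule: cord_cases)
  case (osuc z)
  assume "b < a + x"
  then have "b \<le> a + z" using osuc by (simp add: less_osuc_iff)
  then show ?thesis using osuc less_osuc by blast
next
  case limit
  assume "b < a + x"
  then show ?thesis using less_Sup_image_limit[OF limit, of b "\<lambda>c. a + c"]
    by (auto simp: cord_add_limit[OF limit] intro: less_imp_le)
qed simp

lemma cord_0_add [simp]: "0 + a = (a::cord)"
proof (induction a rule: less_induct)
  case (less a)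
  show ?case
  proof (cases a rule: cord_cases)
    case (osuc b) then show ?thesis using less by simp
  next
    case limit
    have eq: "(\<lambda>b. 0 + b) ` {..<a} = {..<a}" using less by force
    have "Sup {..<a} = a"
    proof (rule antisym)
      show "Sup {..<a} \<le> a" using is_limit_pos[OF limit] by (intro cSup_least) auto
      show "a \<le> Sup {..<a}"
      proof (rule ccontr)
        assume "\<not> a \<le> Sup {..<a}"
        then have "Sup {..<a} < a" by simp
        then have 1: "osuc (Sup {..<a}) < a" by (rule osuc_less_limit[OF limit])
        have "bdd_above {..<a}" by (simp add: countable_bdd_above_cord countable_lessThan_cord)
        then have "osuc (Sup {..<a}) \<le> Sup {..<a}" using 1 by (intro cSup_upper) auto
        then show False by (simp add: osuc_le_iff)
      qed
    qed
    then show ?thesis by (simp add: cord_add_limit[OF limit] eq)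
  qed simp
qed

lemma cord_add_right_mono: "a \<le> b \<Longrightarrow> a + c \<le> b + (c::cord)"
proof (induction c rule: less_induct)
  case (less c)
  show ?case
  proof (cases c rule: cord_cases)
    case zero then show ?thesis using less by simp
  next
    case (osuc d)
    then have "a + d \<le> b + d" using less by simp
    then show ?thesis using osuc by (simp add: osuc_le_iff less_osuc_iff)
  next
    case limit
    have "Sup ((\<lambda>d. a + d) ` {..<c}) \<le> b + c"
    proof (rule cSup_least)
      fix x assume "x \<in> (\<lambda>d. a + d) ` {..<c}"
      then obtain d where d: "d < c" "x = a + d" by auto
      then have "x \<le> b + d" using less by simp
      also have "b + d \<le> b + c" using d by (intro cord_add_le_mono) simp
      finally show "x \<le> b + c" .
    qed (use is_limit_pos[OF limit] in auto)
    then show ?thesis by (simp add: cord_add_limit[OF limit, of a])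
  qed
qed

lemma cord_add_assoc: "(a + b) + c = a + (b + (c::cord))"
proof (induction c rule: less_induct)
  case (less c)
  show ?case
  proof (cases c rule: cord_cases)
    case limit
    show ?thesis
    proof (rule antisym)
      show "a + b + c \<le> a + (b + c)"
      proof (rule ccontr)
        assume "\<not> a + b + c \<le> a + (b + c)"
        then have "a + (b + c) < (a + b) + c" by simp
        from cord_less_addD[OF is_limit_pos[OF limit] this] obtain d where
          d: "d < c" "a + (b + c) \<le> a + b + d" by blast
        then have "a + (b + c) \<le> a + (b + d)" using less by simp
        moreover have "a + (b + d) < a + (b + c)" using d by (intro cord_add_less_mono)
        ultimately show False by simp
      qed
      show "a + (b + c) \<le> a + b + c"
      proof (rule ccontr)
        assume "\<not> a + (b + c) \<le> a + b + c"
        then have lt: "a + b + c < a + (b + c)" by simp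
        have "b < b + c" using cord_add_less_mono[OF is_limit_pos[OF limit], of b] by simp
        then have "0 < b + c" using zero_le_cord[of b] by (rule le_less_trans[rotated])
        from cord_less_addD[OF this lt] obtain x where x: "x < b + c" "a + b + c \<le> a + x" by blast
        from cord_less_addD[OF is_limit_pos[OF limit] x(1)] obtain d where
          d: "d < c" "x \<le> b + d" by blast
        have "a + x \<le> a + (b + d)" using d by (intro cord_add_le_mono)
        also have "\<dots> = a + b + d" using less d by simp
        also have "\<dots> < a + b + c" using d by (intro cord_add_less_mono)
        finally show False using x by simp
      qed
    qed
  qed (use less in simp_all)
qed

section \<open>Powers of omega and uniqueness of the Cantor normal form\<close>

lemma omult_le_Suc: "omult a n \<le> omult a (Suc n)"
  by (simp add: cord_le_add)

lemma omult_mono: "m \<le> n \<Longrightarrow> omult a m \<le> omult a n"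
  by (rule lift_Suc_mono_le[of "omult a"]) (rule omult_le_Suc)

lemma omult_Suc_left: "omult a (Suc n) = a + omult a n"
  by (induction n) (simp_all add: cord_add_assoc)

lemma opow_0 [simp]: "opow 0 = 1"
  by (simp add: opow_def)

lemma opow_osuc: "opow (osuc a) = (SUP n. omult (opow a) n)"
  by (simp add: opow_def)

lemma opow_limit: "is_limit l \<Longrightarrow> opow l = Sup (opow ` {..<l})"
  by (simp add: opow_def ord_rec_limit)

lemma bdd_above_range_nat_cord [simp]: "bdd_above (range (f :: nat \<Rightarrow> cord))"
  by (simp add: countable_bdd_above_cord)

lemma omult_le_opow_osuc: "omult (opow a) n \<le> opow (osuc a)"
  unfolding opow_osuc by (rule cSup_upper) auto

lemma less_opow_osucD: "b < opow (osuc a) \<Longrightarrow> \<exists>n. b < omult (opow a) n"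
  unfolding opow_osuc by (subst (asm) less_cSup_iff) auto

lemma opow_pos [simp]: "0 < opow a"
proof (induction a rule: less_induct)
  case (less a)
  show ?case
  proof (cases a rule: cord_cases)
    case zero then show ?thesis by (simp add: one_cord_def cord_pos_iff)
  next
    case (osuc b)
    then have "0 < opow b" using less by simp
    also have "\<dots> \<le> opow a" using omult_le_opow_osuc[of b 1] osuc by simp
    finally show ?thesis .
  next
    case limit
    then have "0 < opow 0" "opow 0 \<le> opow a"
      using less is_limit_pos[OF limit]
      by (simp_all only: opow_limit[OF limit] image_le_Sup_limit)
    then show ?thesis by (rule less_le_trans)
  qed
qed

lemma omult_opow_less: "omult (opow a) n < opow (osuc a)"
proof -
  have "omult (opow a) n < omult (opow a) (Suc n)"
    using cord_add_less_mono[OF opow_pos[of a], of "omult (opow a) n"] by simp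
  also have "\<dots> \<le> opow (osuc a)" by (rule omult_le_opow_osuc)
  finally show ?thesis .
qed

lemma opow_less_osuc: "opow a < opow (osuc a)"
  using omult_opow_less[of a 1] by simp

lemma opow_less_mono: "a < b \<Longrightarrow> opow a < opow b"
proof (induction b arbitrary: a rule: less_induct)
  case (less b)
  show ?case
  proof (cases b rule: cord_cases)
    case zero with less.prems show ?thesis using cord_pos_iff zero_le_cord by (metis not_le)
  next
    case (osuc d)
    then have "a \<le> d" using less.prems by (simp add: less_osuc_iff)
    then have "opow a \<le> opow d" using less.IH[of d a] osuc by (auto simp: le_less)
    then show ?thesis using opow_less_osuc[of d] osuc by simp
  next
    case limit
    have 1: "osuc a < b" using limit less.prems by (rule osuc_less_limit)
    have "opow a < opow (osuc a)" by (rule opow_less_osuc)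
    also have "\<dots> \<le> opow b" using 1 by (simp only: opow_limit[OF limit] image_le_Sup_limit)
    finally show ?thesis .
  qed
qed

lemma opow_mono: "a \<le> b \<Longrightarrow> opow a \<le> opow b"
  using opow_less_mono[of a b] by (auto simp: le_less)

lemma opow_inject [simp]: "opow a = opow b \<longleftrightarrow> a = b"
  by (metis opow_less_mono less_irrefl linorder_neqE)

text \<open>A Cantor normal form is represented by the non-increasing list of its exponents, each
  repeated according to its coefficient.\<close>

primrec opow_sum :: "cord list \<Rightarrow> cord" where
  "opow_sum [] = 0"
| "opow_sum (c # cs) = opow c + opow_sum cs"

lemma opow_sum_append: "opow_sum (cs @ ds) = opow_sum cs + opow_sum ds"
  by (induction cs) (simp_all add: cord_add_assoc)

lemma opow_sum_replicate: "opow_sum (replicate n c) = omult (opow c) n"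
  by (induction n) (simp_all add: omult_Suc_left del: omult.simps(2))

lemma opow_sum_le_omult: "\<forall>d\<in>set cs. d \<le> c \<Longrightarrow> opow_sum cs \<le> omult (opow c) (length cs)"
proof (induction cs)
  case (Cons d cs)
  have "opow d + opow_sum cs \<le> opow c + opow_sum cs"
    using Cons by (intro cord_add_right_mono opow_mono) auto
  also have "\<dots> \<le> opow c + omult (opow c) (length cs)"
    using Cons by (intro cord_add_le_mono) auto
  finally show ?case by (simp add: omult_Suc_left del: omult.simps(2))
qed simp

lemma opow_add_nonzero: "opow c + a \<noteq> 0"
  using less_le_trans[OF opow_pos cord_le_add[of "opow c" a]] by auto

lemma sorted_wrt_replicate_ge: "sorted_wrt (\<ge>) (replicate n (c :: 'a :: preorder))"
  by (induction n) auto

text \<open>If the leading exponents differ, say \<open>c < d\<close>, the first sum is at most a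
  finite multiple of \<open>opow c\<close>, hence below \<open>opow (osuc c)\<close> and so below
  the second sum. Uniqueness makes all applications of the rule \<open>cantor\<close> at a given
  ordinal speak of the same list.\<close>

lemma opow_sum_inject:
  assumes "sorted_wrt (\<ge>) cs" "sorted_wrt (\<ge>) ds" "opow_sum cs = opow_sum ds"
  shows "cs = ds"
  using assms
proof (induction cs arbitrary: ds)
  case Nil
  then show ?case
    by (cases ds) (auto simp: opow_add_nonzero dest!: sym[of 0])
next
  case (Cons c cs)
  show ?case
  proof (cases ds)
    case Nil
    then show ?thesis using Cons.prems opow_add_nonzero by simp
  next
    case (Cons d ds')
    have *: "\<not> c < d" if "sorted_wrt (\<ge>) (c # cs)" "opow_sum (c # cs) = opow_sum (d # ds')"
      for c d :: cord and cs ds'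
    proof
      assume "c < d"
      have "opow_sum (c # cs) \<le> omult (opow c) (length (c # cs))"
        using that by (intro opow_sum_le_omult) auto
      also have "\<dots> < opow (osuc c)" by (rule omult_opow_less)
      also have "\<dots> \<le> opow d" using \<open>c < d\<close> by (intro opow_mono) (simp add: osuc_le_iff)
      also have "\<dots> \<le> opow_sum (d # ds')" by (simp add: cord_le_add)
      finally show False using that by simp
    qed
    have "\<not> c < d" "\<not> d < c"
      using *[of c cs d ds'] *[of d ds' c cs] Cons.prems Cons by auto
    then have "c = d" by simp
    then show ?thesis using Cons Cons.prems Cons.IH[of ds'] by (simp add: cord_add_left_cancel)
  qed
qed

definition cnf_list :: "(nat \<Rightarrow> cord) \<Rightarrow> (nat \<Rightarrow> nat) \<Rightarrow> nat \<Rightarrow> cord list" where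
  "cnf_list a p m = concat (map (\<lambda>i. replicate (p i) (a i)) [0..<Suc m])"

lemma cnf_list_Suc: "cnf_list a p (Suc m) = cnf_list a p m @ replicate (p (Suc m)) (a (Suc m))"
  by (simp add: cnf_list_def)

lemma opow_sum_cnf_list: "opow_sum (cnf_list a p m) = cnf a p m"
  by (induction m) (simp_all add: cnf_list_Suc opow_sum_append opow_sum_replicate, simp add: cnf_list_def opow_sum_replicate)

lemma sorted_cnf_list:
  assumes "\<forall>i<m. a (Suc i) < a i"
  shows "sorted_wrt (\<ge>) (cnf_list a p m) \<and> (\<forall>c\<in>set (cnf_list a p m). a m \<le> c)"
  using assms
proof (induction m)
  case 0
  then show ?case by (simp add: cnf_list_def sorted_wrt_replicate_ge)
next
  case (Suc m)
  then have "a (Suc m) < a m" by simp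
  then show ?case using Suc
    by (auto simp: cnf_list_Suc sorted_wrt_append sorted_wrt_replicate_ge intro: less_imp_le less_le_trans)
qed

section \<open>Large families of finite sets\<close>

text \<open>Only sets entirely to the right of \<open>E\<close> remain, so that taking quotients by
  increasing points reads the members of \<open>A\<close> from left to right. The empty set appears
  exactly when \<open>E\<close> itself has reached \<open>A\<close>.\<close>

definition quot :: "nat set set \<Rightarrow> nat set \<Rightarrow> nat set set" where
  "quot A E = {s. set_less E s \<and> E \<union> s \<in> A}"

text \<open>\<open>large x A\<close> says that the tree of those sets that have no initial segment in \<open>A\<close> has rank
  at least \<open>x\<close>, where only cofinite branching is counted, so that the rank is inherited by every
  infinite set of positions.\<close>

function large :: "cord \<Rightarrow> nat set set \<Rightarrow> bool" where
  "large x A \<longleftrightarrow> (\<forall>b<x. {} \<notin> A \<and> (\<exists>N. \<forall>n\<ge>N. large b (quot A {n})))"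
  by pat_completeness auto
termination by (relation "inv_image {(x, y). x < y} fst") (auto simp: wf_inv_image wf)

declare large.simps [simp del]

lemma largeI:
  assumes "\<And>b. b < x \<Longrightarrow> {} \<notin> A" "\<And>b. b < x \<Longrightarrow> \<exists>N. \<forall>n\<ge>N. large b (quot A {n})"
  shows "large x A"
  using assms by (subst large.simps) blast

lemma large_nonempty: "large x A \<Longrightarrow> 0 < x \<Longrightarrow> {} \<notin> A"
  by (subst (asm) large.simps) blast

lemma large_quot: "large x A \<Longrightarrow> b < x \<Longrightarrow> \<exists>N. \<forall>n\<ge>N. large b (quot A {n})"
  by (subst (asm) large.simps) blast

lemma large_0 [simp]: "large 0 A"
  using zero_le_cord not_le by (intro largeI) blast+

lemma large_mono: "large x A \<Longrightarrow> y \<le> x \<Longrightarrow> large y A"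
  by (rule largeI) (auto intro: large_quot dest: large_nonempty less_le_trans[of _ y x]
     le_less_trans[OF zero_le_cord])

lemma quot_mono: "A \<subseteq> B \<Longrightarrow> quot A E \<subseteq> quot B E"
  by (auto simp: quot_def)

lemma large_subset: "large x B \<Longrightarrow> A \<subseteq> B \<Longrightarrow> large x A"
proof (induction x arbitrary: A B rule: less_induct)
  case (less x)
  show ?case
  proof (rule largeI)
    fix b assume b: "b < x"
    show "{} \<notin> A" using less.prems large_nonempty[of x B] le_less_trans[OF zero_le_cord b] by blast
    obtain N where "\<forall>n\<ge>N. large b (quot B {n})" using large_quot[OF less.prems(1) b] ..
    then show "\<exists>N. \<forall>n\<ge>N. large b (quot A {n})"
      using less.IH[OF b] quot_mono[OF less.prems(2)] by blast
  qed
qed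

lemma quot_Un: "quot (A \<union> B) E = quot A E \<union> quot B E"
  by (auto simp: quot_def)

text \<open>Here cofinite branching pays: two cofinite sets of good \<open>n\<close> have a cofinite
  intersection. The rules of \<open>schreier\<close> can thus be estimated one by one.\<close>

lemma large_Un: "large x A \<Longrightarrow> large x B \<Longrightarrow> large x (A \<union> B)"
proof (induction x arbitrary: A B rule: less_induct)
  case (less x)
  show ?case
  proof (rule largeI)
    fix b assume b: "b < x"
    then have "0 < x" using zero_le_cord le_less_trans by blast
    then show "{} \<notin> A \<union> B" using less.prems large_nonempty by blast
    obtain N N' where "\<forall>n\<ge>N. large b (quot A {n})" "\<forall>n\<ge>N'. large b (quot B {n})"
      using large_quot[OF _ b] less.prems by blast
    then have "\<forall>n\<ge>max N N'. large b (quot (A \<union> B) {n})"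
      using less.IH[OF b] by (simp add: quot_Un)
    then show "\<exists>N. \<forall>n\<ge>N. large b (quot (A \<union> B) {n})" ..
  qed
qed

definition fsum :: "nat set set \<Rightarrow> nat set set \<Rightarrow> nat set set" where
  "fsum A B = {s \<union> t | s t. s \<in> A \<and> t \<in> B \<and> set_less s t}"

lemma quot_fsum: "quot (fsum A B) {n} \<subseteq> fsum (quot A {n}) B \<union> (if {} \<in> A then quot B {n} else {})"
proof
  fix x assume "x \<in> quot (fsum A B) {n}"
  then obtain s t where st: "{n} \<union> x = s \<union> t" "s \<in> A" "t \<in> B" "set_less s t" "set_less {n} x"
    by (auto simp: quot_def fsum_def)
  have n: "n \<notin> x" using st by (auto simp: set_less_def)
  show "x \<in> fsum (quot A {n}) B \<union> (if {} \<in> A then quot B {n} else {})"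
  proof (cases "n \<in> s")
    case True
    then have "n \<notin> t" using st by (auto simp: set_less_def)
    then have "x = (s - {n}) \<union> t" using st(1) n True by (auto simp: set_eq_iff)
    moreover have "s - {n} \<in> quot A {n}"
      using st True by (auto simp: quot_def set_less_def insert_absorb)
    moreover have "set_less (s - {n}) t" using st by (auto simp: set_less_def)
    ultimately show ?thesis using st by (auto simp: fsum_def)
  next
    case False
    then have "n \<in> t" using st by blast
    have "s = {}"
    proof (rule ccontr)
      assume "s \<noteq> {}"
      then obtain k where k: "k \<in> s" by auto
      then have "k < n" "k \<in> x" using False \<open>n \<in> t\<close> st by (auto simp: set_less_def)
      then show False using st by (auto simp: set_less_def)
    qed
    then show ?thesis using st by (auto simp: quot_def)
  qed
qed

text \<open>Points spent on the first summand only postpone the traversal of the second.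
  \<open>A\<close> varies in the induction because the next point may be consumed on either
  side.\<close>

lemma large_fsum_right: "large y B \<Longrightarrow> large y (fsum A B)"
proof (induction y arbitrary: A rule: less_induct)
  case (less y)
  show ?case
  proof (rule largeI)
    fix b assume b: "b < y"
    then have "0 < y" using zero_le_cord le_less_trans by blast
    then show "{} \<notin> fsum A B" using less.prems large_nonempty by (auto simp: fsum_def)
    obtain N where N: "\<forall>n\<ge>N. large b (quot B {n})" using large_quot[OF less.prems b] ..
    have "large b (quot (fsum A B) {n})" if "n \<ge> N" for n
      by (rule large_subset[OF _ quot_fsum], rule large_Un)
         (use less.IH[OF b] less.prems large_mono[of y B b] b N that
           in \<open>auto simp: less_imp_le intro: large_subset[of b "quot B {n}"]\<close>)
    then show "\<exists>N. \<forall>n\<ge>N. large b (quot (fsum A B) {n})" by blast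
  qed
qed

text \<open>The sets from \<open>A\<close> come first, so the rank \<open>x\<close> is used up
  before \<open>y\<close>. This explains the order \<open>y + x\<close>, and matches the recursion
  of addition on its right summand.\<close>

lemma large_fsum: "large x A \<Longrightarrow> large y B \<Longrightarrow> large (y + x) (fsum A B)"
proof (induction x arbitrary: A rule: less_induct)
  case (less x)
  show ?case
  proof (cases "x = 0")
    case True
    then show ?thesis using large_fsum_right[OF less.prems(2)] by simp
  next
    case False
    then have x: "0 < x" by (simp add: cord_pos_iff)
    then have A: "{} \<notin> A" using large_nonempty less.prems by blast
    show ?thesis
    proof (rule largeI)
      show "{} \<notin> fsum A B" using A by (auto simp: fsum_def)
      fix b assume "b < y + x"
      then obtain c where c: "c < x" "b \<le> y + c" using cord_less_addD[OF x] by blast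
      obtain N where N: "\<forall>n\<ge>N. large c (quot A {n})" using large_quot[OF less.prems(1) c(1)] ..
      have "large b (quot (fsum A B) {n})" if "n \<ge> N" for n
        by (rule large_subset[OF _ quot_fsum], rule large_mono[OF _ c(2)])
           (use less.IH[OF c(1)] less.prems(2) N A that in simp)
      then show "\<exists>N. \<forall>n\<ge>N. large b (quot (fsum A B) {n})" by blast
    qed
  qed
qed

section \<open>Largeness of the Schreier families\<close>

text \<open>The block of the leading exponent comes last in the set, as in the rule
  \<open>cantor\<close>; by the order reversal in \<open>large_fsum\<close> the ranks then add up to
  \<open>opow_sum\<close>.\<close>

primrec pow_family :: "(cord \<Rightarrow> nat \<Rightarrow> cord) \<Rightarrow> cord list \<Rightarrow> nat set set" where
  "pow_family fs [] = {{}}"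
| "pow_family fs (c # cs) = fsum (pow_family fs cs) {s. schreier fs (opow c) s}"

lemma large_pow_family:
  assumes "\<forall>c\<in>set cs. large (opow c) {s. schreier fs (opow c) s}"
  shows "large (opow_sum cs) (pow_family fs cs)"
  using assms by (induction cs) (auto intro: large_fsum)

lemma pow_family_append:
  "t \<in> pow_family fs ds \<Longrightarrow> s \<in> pow_family fs cs \<Longrightarrow> set_less t s \<Longrightarrow>
    t \<union> s \<in> pow_family fs (cs @ ds)"
proof (induction cs arbitrary: s)
  case (Cons c cs)
  then obtain x y where xy: "s = x \<union> y" "x \<in> pow_family fs cs" "schreier fs (opow c) y" "set_less x y"
    by (auto simp: fsum_def)
  have "t \<union> x \<in> pow_family fs (cs @ ds)" using Cons xy by (auto simp: set_less_def)
  moreover have "set_less (t \<union> x) y" using Cons xy by (auto simp: set_less_def)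
  moreover have "t \<union> s = (t \<union> x) \<union> y" using xy by blast
  ultimately show ?case using xy by (auto simp: fsum_def)
qed simp

lemma pow_family_replicate:
  assumes "\<forall>j\<in>{1..n}. schreier fs (opow c) (s j)" "\<forall>j\<in>{1..n}. \<forall>k\<in>{1..n}. j < k \<longrightarrow> set_less (s j) (s k)"
  shows "(\<Union>j\<in>{1..n}. s j) \<in> pow_family fs (replicate n c)"
  using assms
proof (induction n)
  case (Suc n)
  have "(\<Union>j\<in>{1..Suc n}. s j) = (\<Union>j\<in>{1..n}. s j) \<union> s (Suc n)"
    by (simp add: atLeastAtMostSuc_conv Un_commute)
  moreover have "set_less (s j) (s (Suc n))" if "j \<in> {1..n}" for j
    using Suc.prems(2) that by simp
  then have "set_less (\<Union>j\<in>{1..n}. s j) (s (Suc n))" unfolding set_less_def by blast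
  moreover have "(\<Union>j\<in>{1..n}. s j) \<in> pow_family fs (replicate n c)"
    using Suc by simp
  moreover have "schreier fs (opow c) (s (Suc n))" using Suc.prems(1) by simp
  ultimately show ?case unfolding replicate_Suc pow_family.simps fsum_def by blast
qed simp

lemma pow_family_cnf_list:
  assumes "\<forall>i\<le>m. \<forall>j\<in>{1..p i}. schreier fs (opow (a i)) (s i j)"
    "\<forall>i\<le>m. \<forall>j\<in>{1..p i}. \<forall>k\<in>{1..p i}. j < k \<longrightarrow> set_less (s i j) (s i k)"
    "\<forall>i\<le>m. \<forall>k\<le>m. i < k \<longrightarrow> set_less (\<Union>j\<in>{1..p k}. s k j) (\<Union>j\<in>{1..p i}. s i j)"
  shows "(\<Union>i\<le>m. \<Union>j\<in>{1..p i}. s i j) \<in> pow_family fs (cnf_list a p m)"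
  using assms
proof (induction m)
  case 0
  then show ?case using pow_family_replicate[of "p 0" fs "a 0" "s 0"] by (simp add: cnf_list_def)
next
  case (Suc m)
  have eq: "(\<Union>i\<le>Suc m. \<Union>j\<in>{1..p i}. s i j) =
      (\<Union>j\<in>{1..p (Suc m)}. s (Suc m) j) \<union> (\<Union>i\<le>m. \<Union>j\<in>{1..p i}. s i j)"
    unfolding atMost_Suc by blast
  have 1: "(\<Union>j\<in>{1..p (Suc m)}. s (Suc m) j) \<in> pow_family fs (replicate (p (Suc m)) (a (Suc m)))"
    using Suc.prems by (intro pow_family_replicate) auto
  have 2: "(\<Union>i\<le>m. \<Union>j\<in>{1..p i}. s i j) \<in> pow_family fs (cnf_list a p m)"
    using Suc by simp
  have "set_less (\<Union>j\<in>{1..p (Suc m)}. s (Suc m) j) (\<Union>j\<in>{1..p i}. s i j)" if "i \<le> m" for i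
    using Suc.prems(3) that by simp
  then have 3: "set_less (\<Union>j\<in>{1..p (Suc m)}. s (Suc m) j) (\<Union>i\<le>m. \<Union>j\<in>{1..p i}. s i j)"
    unfolding set_less_def by blast
  show ?case unfolding eq cnf_list_Suc by (rule pow_family_append[OF 1 2 3])
qed

lemma finite_schreier: "schreier fs x s \<Longrightarrow> finite s"
proof (induction rule: schreier.induct)
  case (pow_succ n s b)
  then show ?case by (intro finite_UN_I finite_atLeastAtMost) blast
next
  case (cantor x a p m s)
  have "\<forall>i\<le>m. \<forall>j\<in>{1..p i}. finite (s i j)" using cantor.IH by blast
  then show ?case by (intro finite_UN_I finite_atLeastAtMost finite_atMost) simp
qed auto

text \<open>The quotient at every single \<open>n\<close> is controlled; this is what makes the diagonal rule
  \<open>pow_limit\<close> work, and the reason for the ladders to consist of successors.\<close>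

lemma large_quot_pow_osuc:
  assumes IH: "large (opow b) {s. schreier fs (opow b) s}"
    and A: "A \<subseteq> {(\<Union>i\<in>{1..n}. s i) | n s. 1 \<le> n \<and> n = Min (s 1) \<and>
      (\<forall>i\<in>{1..n}. \<forall>j\<in>{1..n}. i < j \<longrightarrow> set_less (s i) (s j)) \<and>
      (\<forall>i\<in>{1..n}. schreier fs (opow b) (s i))}"
  shows "{} \<notin> A" "large (omult (opow b) n) (quot A {Suc n})"
proof -
  have ne: "s \<noteq> {}" if "schreier fs (opow b) s" for s
    using large_nonempty[OF IH opow_pos] that by auto
  \<comment> \<open>The first block contains the minimum, and the minimum counts the blocks;
    \<open>Min x - 1\<close> of them follow.\<close>
  have rep: "\<exists>s1 t. x = s1 \<union> t \<and> t \<in> pow_family fs (replicate (Min x - 1) b) \<and> set_less s1 t \<and> Min x \<in> s1 \<and> finite x"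
    if "x \<in> A" for x
  proof -
    from subsetD[OF A that] obtain n s where x: "x = (\<Union>i\<in>{1..n}. s i)" "1 \<le> n" "n = Min (s 1)"
      "\<forall>i\<in>{1..n}. \<forall>j\<in>{1..n}. i < j \<longrightarrow> set_less (s i) (s j)"
      "\<forall>i\<in>{1..n}. schreier fs (opow b) (s i)" by (elim CollectE exE conjE)
    obtain k where k: "n = Suc k" using x(2) by (cases n) auto
    let ?t = "\<Union>j\<in>{1..k}. s (Suc j)"
    have s1: "schreier fs (opow b) (s 1)" using x by simp
    have n: "n \<in> s 1" using Min_in[OF finite_schreier[OF s1] ne[OF s1]] x by simp
    have xe: "x = s 1 \<union> ?t"
    proof -
      have eq: "{1..n} = insert 1 (Suc ` {1..k})"
        unfolding k image_Suc_atLeastAtMost by auto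
      show ?thesis
        unfolding x(1) eq by (simp add: image_image del: image_Suc_atLeastAtMost)
    qed
    have lt: "set_less (s 1) ?t"
    proof -
      have "set_less (s 1) (s (Suc j))" if "j \<in> {1..k}" for j using x(4) k that by simp
      then show ?thesis unfolding set_less_def by blast
    qed
    have fin: "finite x" unfolding x(1) using x(5) finite_schreier by blast
    have "Min x = n"
    proof (rule Min_eqI[OF fin])
      show "n \<in> x" using n xe by blast
      fix y assume "y \<in> x"
      then consider "y \<in> s 1" | "y \<in> ?t" using xe by blast
      then show "n \<le> y"
      proof cases
        case 1
        then show ?thesis using x(3) finite_schreier[OF s1] by simp
      next
        case 2
        then show ?thesis using lt n unfolding set_less_def by (blast intro: less_imp_le)
      qed
    qed
    moreover have "?t \<in> pow_family fs (replicate k b)"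
      using x(4,5) k by (intro pow_family_replicate) auto
    ultimately show ?thesis using xe lt k n fin by auto
  qed
  show "{} \<notin> A" using rep by blast
  \<comment> \<open>With minimum \<open>Suc n\<close>, whatever is left of the first block is
    absorbed by \<open>UNIV\<close>; the \<open>n\<close> later blocks already provide the
    rank.\<close>
  have "quot A {Suc n} \<subseteq> fsum UNIV (pow_family fs (replicate n b))"
  proof
    fix x assume "x \<in> quot A {Suc n}"
    then have x: "{Suc n} \<union> x \<in> A" "set_less {Suc n} x" by (auto simp: quot_def)
    obtain y z where yz: "{Suc n} \<union> x = y \<union> z"
      "z \<in> pow_family fs (replicate (Min ({Suc n} \<union> x) - 1) b)" "set_less y z" "Min ({Suc n} \<union> x) \<in> y" "finite ({Suc n} \<union> x)"
      using rep[OF x(1)] by blast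
    have m: "Min ({Suc n} \<union> x) = Suc n"
    proof (rule Min_eqI)
      show "Suc n \<le> k" if "k \<in> {Suc n} \<union> x" for k
        using that x(2) by (auto simp: set_less_def less_imp_le)
    qed (use yz(5) in simp_all)
    have "Suc n \<notin> z" "Suc n \<notin> x" using yz(3,4) m x(2) by (auto simp: set_less_def)
    then have "x = ({Suc n} \<union> x) - {Suc n}" by simp
    also have "\<dots> = (y - {Suc n}) \<union> z" unfolding yz(1) using \<open>Suc n \<notin> z\<close> by (simp add: Un_Diff)
    finally have "x = (y - {Suc n}) \<union> z" .
    moreover have "set_less (y - {Suc n}) z" using yz by (auto simp: set_less_def)
    ultimately show "x \<in> fsum UNIV (pow_family fs (replicate n b))" using yz(2) m unfolding fsum_def by auto
  qed
  moreover have "large (omult (opow b) n) (pow_family fs (replicate n b))"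
    using large_pow_family[of "replicate n b" fs] IH by (simp add: opow_sum_replicate)
  ultimately show "large (omult (opow b) n) (quot A {Suc n})"
    using large_fsum_right large_subset by blast
qed

lemma opow_osuc_not_osuc: "opow (osuc b) \<noteq> osuc z"
proof
  assume eq: "opow (osuc b) = osuc z"
  then obtain n where "z < omult (opow b) n" using less_opow_osucD[of z b] by auto
  then have "osuc z \<le> omult (opow b) n" by (simp add: osuc_le_iff)
  then show False using omult_opow_less[of b n] eq by simp
qed

lemma schreier_opow_osucD:
  assumes "schreier fs (opow (osuc b)) s"
  shows "\<exists>n s'. s = (\<Union>i\<in>{1..n}. s' i) \<and> 1 \<le> n \<and> n = Min (s' 1) \<and>
      (\<forall>i\<in>{1..n}. \<forall>j\<in>{1..n}. i < j \<longrightarrow> set_less (s' i) (s' j)) \<and>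
      (\<forall>i\<in>{1..n}. schreier fs (opow b) (s' i))"
  using assms
proof (cases rule: schreier.cases)
  case zero
  then show ?thesis using opow_pos[of "osuc b"] by simp
next
  case one
  then show ?thesis using opow_osuc_not_osuc by (simp add: one_cord_def)
next
  case succ
  then show ?thesis using opow_osuc_not_osuc by simp
next
  case (pow_succ n s' b')
  then show ?thesis by auto
next
  case (pow_limit l)
  then show ?thesis by (auto simp: is_limit_def is_osuc_def)
next
  case (cantor a p m)
  from cantor(3,4) have "opow (a 0) < opow (osuc b)" "opow (osuc b) < opow (osuc (a 0))" by auto
  then have "a 0 < osuc b" "osuc b < osuc (a 0)"
    using opow_mono not_le by blast+
  then have False by (simp add: less_osuc_iff osuc_le_iff)
  then show ?thesis ..
qed

lemma large_empty [simp]: "large x {}"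
  by (induction x rule: less_induct) (intro largeI, auto simp: quot_def)

text \<open>Each rule contributes one family, and their union is handled by \<open>large_Un\<close>.
  Rules whose form does not match \<open>x\<close> contribute the empty family, which is large for
  every ordinal.\<close>

theorem large_schreier:
  assumes fs: "ladder_system fs"
  shows "large x {s. schreier fs x s}"
proof (induction x rule: less_induct)
  case (less x)
  define A where "A = {s. \<exists>n t z. x = osuc z \<and> s = {n} \<union> t \<and> set_less {n} t \<and> schreier fs z t}"
  define B where "B b = {(\<Union>i\<in>{1..n}. s i) | n s. 1 \<le> n \<and> n = Min (s 1) \<and>
      (\<forall>i\<in>{1..n}. \<forall>j\<in>{1..n}. i < j \<longrightarrow> set_less (s i) (s j)) \<and>
      (\<forall>i\<in>{1..n}. schreier fs (opow b) (s i))}" for b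
  define C where "C l = {s. s \<noteq> {} \<and> schreier fs (opow (fs l (Min s))) s \<and> finite s}" for l
  have fin: "finite s" if "schreier fs y s" for y s using that by (rule finite_schreier)
  have LA: "large x A"
  proof (rule largeI)
    show "{} \<notin> A" by (auto simp: A_def)
    fix b assume b: "b < x"
    show "\<exists>N. \<forall>n\<ge>N. large b (quot A {n})"
    proof (cases "\<exists>z. x = osuc z")
      case True
      then obtain z where z: "x = osuc z" ..
      have "quot A {n} \<subseteq> {s. schreier fs z s}" for n
      proof
        fix s assume "s \<in> quot A {n}"
        then obtain m t where t: "{n} \<union> s = {m} \<union> t" "set_less {m} t" "schreier fs z t" "set_less {n} s"
          by (auto simp: quot_def A_def z)
        have "n = m"
          using t by (simp add: set_less_def set_eq_iff) (metis less_asym)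
        moreover have "n \<notin> s" "m \<notin> t" using t by (auto simp: set_less_def)
        ultimately have "s = t" using t(1) by (simp add: insert_ident)
        then show "s \<in> {s. schreier fs z s}" using t by simp
      qed
      moreover have "large b {s. schreier fs z s}"
        using less[of z] z b by (auto simp: less_osuc_iff intro: large_mono)
      ultimately have "large b (quot A {n})" for n using large_subset by blast
      then show ?thesis by blast
    next
      case False
      then have "A = {}" by (auto simp: A_def)
      then show ?thesis by (simp add: quot_def)
    qed
  qed
  have LB: "large x (B b)" if x: "x = opow (osuc b)" for b
  proof (rule largeI)
    have L: "large (opow b) {s. schreier fs (opow b) s}"
      using less[of "opow b"] x opow_less_osuc by simp
    show "{} \<notin> B b" by (rule large_quot_pow_osuc(1)[OF L]) (simp add: B_def)
    fix c assume "c < x"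
    then obtain k where k: "c < omult (opow b) k" using less_opow_osucD x by blast
    have "large c (quot (B b) {n})" if n: "n \<ge> Suc k" for n
    proof -
      obtain j where j: "n = Suc j" using n by (cases n) auto
      have "large (omult (opow b) j) (quot (B b) {Suc j})"
        by (rule large_quot_pow_osuc(2)[OF L]) (simp add: B_def)
      moreover have "c \<le> omult (opow b) j"
        using k omult_mono[of k j "opow b"] j n by simp
      ultimately show ?thesis using j large_mono by blast
    qed
    then show "\<exists>N. \<forall>n\<ge>N. large c (quot (B b) {n})" by blast
  qed
  have LC: "large x (C l)" if x: "x = opow l" and l: "is_limit l" for l
  proof (rule largeI)
    have bsub: "\<exists>b. fs l n = osuc b \<and> opow (osuc b) < x \<and> s \<in> B b"
      if "n \<ge> 1" "schreier fs (opow (fs l n)) s" for n s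
    proof -
      obtain b where b: "fs l n = osuc b" "osuc b < l"
        using fs l \<open>n \<ge> 1\<close> unfolding ladder_system_def is_osuc_def by metis
      then show ?thesis
        using schreier_opow_osucD[of fs b s] that(2) x opow_less_mono by (auto simp: B_def)
    qed
    have LI: "large (opow b) {s. schreier fs (opow b) s}" if "opow (osuc b) < x" for b
      using less[of "opow b"] opow_less_osuc[of b] that by simp
    show "{} \<notin> C l" by (auto simp: C_def)
    fix c assume "c < x"
    then obtain d where d: "d < l" "c < opow d"
      using less_Sup_image_limit[OF l, of c opow] x by (auto simp: opow_limit[OF l])
    obtain k where k: "k \<ge> 1" "d < fs l k"
    proof -
      have "(SUP n\<in>{1..}. fs l n) = l" using fs l unfolding ladder_system_def by blast
      then have "d < (SUP n\<in>{1..}. fs l n)" using d by simp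
      then show thesis
        using that by (subst (asm) less_cSup_iff) (auto intro: countable_bdd_above_cord)
    qed
    \<comment> \<open>The ladder has passed \<open>d\<close> at \<open>k\<close> and grows strictly
      from \<open>j\<close> to \<open>n\<close>, so even the predecessor \<open>b\<close> of
      \<open>fs l n\<close> lies above \<open>d\<close>.\<close>
    have "large c (quot (C l) {n})" if n: "n \<ge> Suc k" for n
    proof -
      obtain j where j: "n = Suc j" "j \<ge> k" "j \<ge> 1" using n k by (cases n) auto
      have mono: "fs l k \<le> fs l j" using j(2)
      proof (induction j rule: dec_induct)
        case (step i)
        then have "fs l i < fs l (Suc i)" using fs l k unfolding ladder_system_def by auto
        then show ?case using step by simp
      qed simp
      have lt: "fs l j < fs l n" using fs l j unfolding ladder_system_def by auto
      obtain b where b: "fs l n = osuc b" "osuc b < l"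
        using fs l j unfolding ladder_system_def is_osuc_def
        by (metis Suc_eq_plus1_left le_add1)
      have "d < b" using k mono lt b by (simp add: less_osuc_iff)
      have bx: "opow (osuc b) < x" using x b opow_less_mono by simp
      have q: "quot (C l) {n} \<subseteq> quot (B b) {n}"
      proof
        fix s assume s: "s \<in> quot (C l) {n}"
        then have "Min ({n} \<union> s) = n"
          by (intro Min_eqI) (auto simp: quot_def C_def set_less_def less_imp_le)
        then have "schreier fs (opow (fs l n)) ({n} \<union> s)" using s by (auto simp: quot_def C_def)
        then have "{n} \<union> s \<in> B b" using bsub[of n] j b by auto
        then show "s \<in> quot (B b) {n}" using s by (auto simp: quot_def)
      qed
      have "large (omult (opow b) j) (quot (B b) {Suc j})"
        by (rule large_quot_pow_osuc(2)[OF LI[OF bx]]) (simp add: B_def)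
      then have 1: "large (omult (opow b) j) (quot (C l) {n})"
        using q j large_subset by blast
      have "c \<le> opow d" using d by simp
      also have "\<dots> \<le> opow b" using \<open>d < b\<close> by (intro opow_mono) simp
      also have "\<dots> \<le> omult (opow b) j" using omult_mono[of 1 j "opow b"] j by simp
      finally show ?thesis using 1 large_mono by blast
    qed
    then show "\<exists>N. \<forall>n\<ge>N. large c (quot (C l) {n})" by blast
  qed
  show ?case
  proof (cases "x = 0")
    case False
    define B' where "B' = {s. \<exists>b. x = opow (osuc b) \<and> s \<in> B b}"
    define C' where "C' = {s. \<exists>l. is_limit l \<and> x = opow l \<and> s \<in> C l}"
    define D' where "D' = {s. \<exists>a p m. is_limit x \<and> opow (a 0) < x \<and> x < opow (osuc (a 0)) \<and> x = cnf a p m \<and>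
        (\<forall>i\<le>m. 0 < a i \<and> 1 \<le> p i) \<and> (\<forall>i<m. a (Suc i) < a i) \<and> s \<in> pow_family fs (cnf_list a p m)}"
    have "{s. schreier fs x s} \<subseteq> A \<union> (B' \<union> (C' \<union> D'))"
    proof
      fix s assume "s \<in> {s. schreier fs x s}"
      then have s: "schreier fs x s" by simp
      then show "s \<in> A \<union> (B' \<union> (C' \<union> D'))"
      proof (cases rule: schreier.cases)
        case zero then show ?thesis using False by simp
      next
        case (one n)
        then have "s \<in> A" using schreier.zero[of fs]
          by (auto simp: A_def one_cord_def set_less_def)
        then show ?thesis by simp
      next
        case (succ n t z)
        then have "s \<in> A" by (auto simp: A_def)
        then show ?thesis by simp
      next
        case (pow_succ n s' b)
        then have "s \<in> B b" unfolding B_def by blast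
        then show ?thesis using pow_succ by (auto simp: B'_def)
      next
        case (pow_limit l)
        then have "s \<in> C l"
          using fin[OF pow_limit(4)] by (auto simp: C_def)
        then show ?thesis using pow_limit by (auto simp: C'_def)
      next
        case (cantor a p m s')
        then have "s \<in> pow_family fs (cnf_list a p m)" using pow_family_cnf_list[of m p fs a s'] by simp
        then have "s \<in> D'" unfolding D'_def using cantor(2-7) by blast
        then show ?thesis by simp
      qed
    qed
    moreover have "large x B'"
    proof (cases "\<exists>b. x = opow (osuc b)")
      case True
      then obtain b where "x = opow (osuc b)" ..
      moreover from this have "B' = B b" by (auto simp: B'_def)
      ultimately show ?thesis using LB by simp
    qed (simp add: B'_def)
    moreover have "large x C'"
    proof (cases "\<exists>l. is_limit l \<and> x = opow l")
      case True
      then obtain l where "is_limit l" "x = opow l" by blast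
      moreover from this have "C' = C l" by (auto simp: C'_def)
      ultimately show ?thesis using LC by simp
    next
      case False
      then have "C' = {}" unfolding C'_def by blast
      then show ?thesis by simp
    qed
    moreover have "large x D'"
    \<comment> \<open>Members of \<open>D'\<close> may come with different \<open>a\<close>,
      \<open>p\<close>, \<open>m\<close>; uniqueness of the normal form puts them all into the
      family of a single list.\<close>
    proof (cases "\<exists>cs. sorted_wrt (\<ge>) cs \<and> x = opow_sum cs \<and> (\<forall>c\<in>set cs. opow c < x)")
      case True
      then obtain cs where cs: "sorted_wrt (\<ge>) cs" "x = opow_sum cs" "\<forall>c\<in>set cs. opow c < x" by blast
      have "D' \<subseteq> pow_family fs cs"
      proof
        fix s assume "s \<in> D'"
        then obtain a p m where *: "x = cnf a p m" "\<forall>i<m. a (Suc i) < a i" "s \<in> pow_family fs (cnf_list a p m)"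
          by (auto simp: D'_def)
        have "cnf_list a p m = cs"
          using sorted_cnf_list[OF *(2)] cs * by (intro opow_sum_inject) (auto simp: opow_sum_cnf_list)
        then show "s \<in> pow_family fs cs" using * by simp
      qed
      moreover have "large x (pow_family fs cs)"
        using large_pow_family[of cs fs] cs less by auto
      ultimately show ?thesis using large_subset by blast
    next
      case F: False
      have "D' = {}"
      proof (rule ccontr)
        assume "D' \<noteq> {}"
        then obtain a p m where *: "x = cnf a p m" "\<forall>i<m. a (Suc i) < a i" "opow (a 0) < x"
          by (auto simp: D'_def)
        have dec: "a i \<le> a 0" if "i \<le> m" for i
          using that by (induction i) (use *(2) in \<open>auto simp: Suc_le_eq intro: less_imp_le less_le_trans\<close>)
        have "opow c < x" if "c \<in> set (cnf_list a p m)" for c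
        proof -
          from that obtain i where "c = a i" "i \<le> m" by (auto simp: cnf_list_def)
          then show ?thesis using opow_mono[OF dec[of i]] *(3) by simp
        qed
        then show False using F sorted_cnf_list[OF *(2)] * by (metis opow_sum_cnf_list)
      qed
      then show ?thesis by simp
    qed
    ultimately show ?thesis using LA large_Un large_subset by (meson)
  qed simp
qed

section \<open>Idempotent ultrafilters on words\<close>

text \<open>The convolution induced by concatenation; on ultrafilters it is the product of the
  Stone-Cech compactification of the semigroup of words. A filter stands for the closed set of the
  ultrafilters below it.\<close>

definition fprod :: "'a list filter \<Rightarrow> 'a list filter \<Rightarrow> 'a list filter" (infixl "\<odot>" 70) where
  "F \<odot> G = Abs_filter (\<lambda>P. \<forall>\<^sub>F x in F. \<forall>\<^sub>F y in G. P (x @ y))"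

lemma eventually_fprod: "eventually P (F \<odot> G) \<longleftrightarrow> (\<forall>\<^sub>F x in F. \<forall>\<^sub>F y in G. P (x @ y))"
  unfolding fprod_def
proof (rule eventually_Abs_filter, rule is_filter.intro)
  fix P Q :: "'a list \<Rightarrow> bool"
  show "\<forall>\<^sub>F x in F. \<forall>\<^sub>F y in G. Q (x @ y)"
    if le: "\<forall>x. P x \<longrightarrow> Q x" and "\<forall>\<^sub>F x in F. \<forall>\<^sub>F y in G. P (x @ y)"
  proof -
    have "(\<forall>\<^sub>F y in G. P (x @ y)) \<longrightarrow> (\<forall>\<^sub>F y in G. Q (x @ y))" for x
      using le by (auto elim!: eventually_mono)
    then show ?thesis using eventually_mono[OF that(2), of "\<lambda>x. \<forall>\<^sub>F y in G. Q (x @ y)"] by blast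
  qed
qed (auto simp: eventually_conj_iff)

lemma fprod_assoc: "F \<odot> G \<odot> H = F \<odot> (G \<odot> H)"
  by (simp add: filter_eq_iff eventually_fprod)

lemma fprod_mono:
  assumes "F \<le> F'" "G \<le> G'"
  shows "F \<odot> G \<le> F' \<odot> G'"
proof (rule filter_leI)
  fix P assume "eventually P (F' \<odot> G')"
  then have "\<forall>\<^sub>F x in F. \<forall>\<^sub>F y in G'. P (x @ y)"
    using assms(1) by (simp add: eventually_fprod filter_leD)
  then show "eventually P (F \<odot> G)"
    unfolding eventually_fprod
    using eventually_mono[of "\<lambda>x. \<forall>\<^sub>F y in G'. P (x @ y)" F "\<lambda>x. \<forall>\<^sub>F y in G. P (x @ y)"] filter_leD[OF assms(2)]
    by blast
qed

lemma fprod_nonbot: "F \<noteq> bot \<Longrightarrow> G \<noteq> bot \<Longrightarrow> F \<odot> G \<noteq> bot"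
proof
  assume *: "F \<noteq> bot" "G \<noteq> bot" and "F \<odot> G = bot"
  then have "\<forall>\<^sub>F x in F \<odot> G. False" by simp
  then have "\<forall>\<^sub>F x in F. \<forall>\<^sub>F y in G. False" by (simp only: eventually_fprod)
  then show False using * by simp
qed

lemma fprod_principal_le:
  "principal A \<odot> principal B \<le> principal C \<longleftrightarrow> (\<forall>x\<in>A. \<forall>y\<in>B. x @ y \<in> C)"
  by (simp add: le_principal eventually_fprod eventually_principal)

lemma filtermap_fprod:
  "(\<And>x y. f (x @ y) = f x @ f y) \<Longrightarrow> filtermap f (F \<odot> G) = filtermap f F \<odot> filtermap f G"
  by (simp add: filter_eq_iff eventually_filtermap eventually_fprod)

section \<open>Ultrafilters as minimal proper filters\<close>

definition ultra :: "'a filter \<Rightarrow> bool" where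
  "ultra F \<longleftrightarrow> F \<noteq> bot \<and> (\<forall>P. eventually P F \<or> (\<forall>\<^sub>F x in F. \<not> P x))"

lemma ultra_nonbot: "ultra F \<Longrightarrow> F \<noteq> bot"
  by (simp add: ultra_def)

lemma nonbot_not_both: "F \<noteq> bot \<Longrightarrow> eventually P F \<Longrightarrow> \<forall>\<^sub>F x in F. \<not> P x \<Longrightarrow> False"
  using eventually_conj[of P F "\<lambda>x. \<not> P x"] by (simp add: trivial_limit_def)

lemma ultra_not_eventually: "ultra F \<Longrightarrow> \<not> eventually P F \<longleftrightarrow> (\<forall>\<^sub>F x in F. \<not> P x)"
  using nonbot_not_both unfolding ultra_def by blast

lemma ultra_minimal: "ultra F \<Longrightarrow> G \<noteq> bot \<Longrightarrow> G \<le> F \<Longrightarrow> G = F"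
proof (rule antisym)
  assume *: "ultra F" "G \<noteq> bot" "G \<le> F"
  show "F \<le> G"
  proof (rule filter_leI)
    fix P assume P: "eventually P G"
    show "eventually P F"
    proof (rule ccontr)
      assume "\<not> eventually P F"
      then have "\<forall>\<^sub>F x in F. \<not> P x" using * by (auto simp: ultra_def)
      then show False using P filter_leD[OF *(3)] nonbot_not_both[OF *(2)] by blast
    qed
  qed
qed

lemma ultra_filtermap: "ultra F \<Longrightarrow> ultra (filtermap f F)"
  by (simp add: ultra_def eventually_filtermap filtermap_bot_iff)

lemma ultra_fprod:
  assumes "ultra F" "ultra G" shows "ultra (F \<odot> G)"
  unfolding ultra_def
proof (intro conjI allI)
  show "F \<odot> G \<noteq> bot" using assms by (metis fprod_nonbot ultra_nonbot)
  show "eventually P (F \<odot> G) \<or> (\<forall>\<^sub>F x in F \<odot> G. \<not> P x)" for P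
    unfolding eventually_fprod ultra_not_eventually[OF assms(2), symmetric]
    using assms(1) by (auto simp: ultra_def)
qed

text \<open>An event of the infimum of a chain already holds in some member, so properness survives.
  This takes the place of the finite intersection property.\<close>

lemma Inf_chain_nonbot:
  assumes "C \<noteq> {}" "\<forall>F\<in>C. F \<noteq> bot" "\<forall>F\<in>C. \<forall>G\<in>C. F \<le> G \<or> G \<le> F"
  shows "Inf C \<noteq> (bot :: 'a filter)"
proof -
  have "eventually P (Inf C) \<longleftrightarrow> (\<exists>F\<in>C. eventually P F)" for P
  proof (rule eventually_Inf_base)
    fix F G assume FG: "F \<in> C" "G \<in> C"
    then have "F \<le> G \<or> G \<le> F" using assms(3) by blast
    then show "\<exists>x\<in>C. x \<le> inf F G" using FG by (metis inf.boundedI order_refl)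
  qed (rule assms(1))
  then show ?thesis using assms by (simp add: trivial_limit_def)
qed

lemma filter_minimal_exists:
  fixes F :: "'a filter"
  assumes "P F"
    and chain: "\<And>C. C \<noteq> {} \<Longrightarrow> \<forall>F\<in>C. P F \<Longrightarrow> \<forall>F\<in>C. \<forall>G\<in>C. F \<le> G \<or> G \<le> F \<Longrightarrow> P (Inf C)"
  shows "\<exists>G\<le>F. P G \<and> (\<forall>H\<le>G. P H \<longrightarrow> H = G)"
proof -
  let ?A = "{G. G \<le> F \<and> P G}"
  have "\<exists>m\<in>?A. \<forall>a\<in>?A. m \<ge> a \<longrightarrow> a = m"
  proof (rule predicate_Zorn)
    show "partial_order_on ?A (relation_of (\<ge>) ?A)"
      by (rule partial_order_on_relation_ofI) auto
    fix C assume C: "C \<in> Chains (relation_of (\<ge>) ?A)"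
    then have sub: "C \<subseteq> ?A" and lin: "\<forall>F\<in>C. \<forall>G\<in>C. F \<le> G \<or> G \<le> F"
      by (auto simp: Chains_def relation_of_def)
    show "\<exists>u\<in>?A. \<forall>a\<in>C. a \<ge> u"
    proof (cases "C = {}")
      case True
      then show ?thesis using assms(1) by auto
    next
      case False
      then have "P (Inf C)" using sub lin by (intro chain) auto
      moreover have "Inf C \<le> F" using False sub by (metis (mono_tags) Inf_lower2 ex_in_conv mem_Collect_eq subsetD)
      ultimately show ?thesis by (intro bexI[of _ "Inf C"]) (auto intro: Inf_lower)
    qed
  qed
  then obtain m where m: "m \<le> F" "P m" "\<forall>a. a \<le> F \<and> P a \<and> a \<le> m \<longrightarrow> a = m" by auto
  then have "\<forall>H\<le>m. P H \<longrightarrow> H = m" using order_trans by blast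
  then show ?thesis using m by blast
qed

lemma ultra_exists:
  assumes "F \<noteq> bot" shows "\<exists>p\<le>F. ultra (p :: 'a filter)"
proof -
  have "\<exists>G\<le>F. G \<noteq> bot \<and> (\<forall>H\<le>G. H \<noteq> bot \<longrightarrow> H = G)"
  proof (rule filter_minimal_exists)
    show "Inf C \<noteq> bot" if "C \<noteq> {}" "\<forall>F\<in>C. F \<noteq> bot" "\<forall>F\<in>C. \<forall>G\<in>C. F \<le> G \<or> G \<le> F" for C :: "'a filter set"
      using that by (rule Inf_chain_nonbot)
  qed (rule assms)
  then obtain G where G: "G \<le> F" "G \<noteq> bot" "\<And>H. H \<le> G \<Longrightarrow> H \<noteq> bot \<Longrightarrow> H = G" by blast
  have "eventually P G \<or> (\<forall>\<^sub>F x in G. \<not> P x)" for P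
  proof (cases "inf G (principal {x. \<not> P x}) = bot")
    case True
    then show ?thesis by (simp add: trivial_limit_def eventually_inf_principal)
  next
    case False
    then have "inf G (principal {x. \<not> P x}) = G" using G by simp
    moreover have "\<forall>\<^sub>F x in inf G (principal {x. \<not> P x}). \<not> P x"
      by (simp add: eventually_inf_principal)
    ultimately show ?thesis by simp
  qed
  then show ?thesis using G by (auto simp: ultra_def)
qed

text \<open>Right translation by an ultrafilter maps the closed set of ultrafilters below \<open>F\<close> onto a
  closed set, and the fibres of this map are closed.\<close>

lemma fprod_fibre:
  assumes p: "ultra p" and q: "ultra q" and le: "q \<le> F \<odot> p"
  shows "\<exists>G\<le>F. G \<noteq> bot \<and> G \<odot> p = q \<and> (\<forall>H\<le>F. H \<odot> p \<le> q \<longrightarrow> H \<le> G)"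
proof -
  \<comment> \<open>Event by event, these restrictions of \<open>F\<close> say that right
    translation by \<open>p\<close> leads to \<open>q\<close>; their infimum is the fibre over
    \<open>q\<close>.\<close>
  define b where "b A = inf F (principal {z. \<forall>\<^sub>F y in p. A (z @ y)})" for A
  define G where "G = Inf (b ` {A. eventually A q})"
  have nonbot: "b A \<noteq> bot" if "eventually A q" for A
  proof
    assume "b A = bot"
    then have "\<forall>\<^sub>F x in F \<odot> p. \<not> A x"
      by (simp add: b_def trivial_limit_def eventually_inf_principal eventually_fprod
          ultra_not_eventually[OF p])
    then show False using filter_leD[OF le] that nonbot_not_both ultra_nonbot[OF q] by blast
  qed
  have "eventually P G \<longleftrightarrow> (\<exists>x\<in>b ` {A. eventually A q}. eventually P x)" for P
    unfolding G_def
  proof (rule eventually_Inf_base)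
    show "b ` {A. eventually A q} \<noteq> {}" by (auto intro: exI[of _ "\<lambda>_. True"])
    fix x y assume "x \<in> b ` {A. eventually A q}" "y \<in> b ` {A. eventually A q}"
    then obtain A B where AB: "x = b A" "y = b B" "eventually A q" "eventually B q" by auto
    have "b (\<lambda>z. A z \<and> B z) \<le> inf x y"
      using AB by (auto simp: b_def le_principal eventually_inf_principal eventually_conj_iff intro: inf.coboundedI1)
    then show "\<exists>z\<in>b ` {A. eventually A q}. z \<le> inf x y"
      using AB by (intro bexI[of _ "b (\<lambda>z. A z \<and> B z)"]) (auto simp: eventually_conj_iff)
  qed
  then have G: "G \<noteq> bot" using nonbot by (auto simp: trivial_limit_def)
  have bG: "G \<le> b A" if "eventually A q" for A unfolding G_def using that by (intro Inf_lower) auto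
  have "G \<odot> p \<le> q"
  proof (rule filter_leI)
    fix A assume "eventually A q"
    moreover have "\<forall>\<^sub>F z in b A. \<forall>\<^sub>F y in p. A (z @ y)"
      by (simp add: b_def eventually_inf_principal)
    ultimately show "eventually A (G \<odot> p)"
      using bG filter_leD unfolding eventually_fprod by blast
  qed
  then have "G \<odot> p = q" using q G p by (metis ultra_minimal fprod_nonbot ultra_nonbot)
  moreover have "G \<le> F" using bG[of "\<lambda>_. True"] by (simp add: b_def)
  moreover have "H \<le> G" if "H \<le> F" "H \<odot> p \<le> q" for H
    unfolding G_def using that filter_leD[OF that(2)]
    by (intro Inf_greatest) (auto simp: b_def le_principal eventually_fprod)
  ultimately show ?thesis using G by blast
qed

text \<open>The Ellis-Numakura argument. For \<open>p\<close> below a minimal subsemigroup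
  \<open>G\<close>, minimality gives \<open>G \<odot> p = G\<close>; the fibre of this translation
  over \<open>p\<close> is again a subsemigroup, hence all of \<open>G\<close>, and \<open>G\<close>
  collapses to \<open>p\<close>.\<close>

lemma ellis:
  assumes "F \<noteq> bot" "F \<odot> F \<le> F"
  shows "\<exists>p\<le>F. ultra p \<and> p \<odot> p = p"
proof -
  have "\<exists>G\<le>F. (G \<noteq> bot \<and> G \<odot> G \<le> G) \<and> (\<forall>H\<le>G. (H \<noteq> bot \<and> H \<odot> H \<le> H) \<longrightarrow> H = G)"
  proof (rule filter_minimal_exists)
    fix C :: "'a list filter set"
    assume C: "C \<noteq> {}" "\<forall>F\<in>C. F \<noteq> bot \<and> F \<odot> F \<le> F" "\<forall>F\<in>C. \<forall>G\<in>C. F \<le> G \<or> G \<le> F"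
    have "Inf C \<odot> Inf C \<le> Inf C"
    proof (rule Inf_greatest)
      fix G assume G: "G \<in> C"
      then have "Inf C \<odot> Inf C \<le> G \<odot> G" by (intro fprod_mono Inf_lower)
      then show "Inf C \<odot> Inf C \<le> G" using C G by (meson order_trans)
    qed
    then show "Inf C \<noteq> bot \<and> Inf C \<odot> Inf C \<le> Inf C" using Inf_chain_nonbot C by blast
  qed (use assms in simp)
  then obtain G where G: "G \<le> F" "G \<noteq> bot" "G \<odot> G \<le> G"
    and min: "\<And>H. H \<le> G \<Longrightarrow> H \<noteq> bot \<Longrightarrow> H \<odot> H \<le> H \<Longrightarrow> H = G" by blast
  obtain p where p: "p \<le> G" "ultra p" using ultra_exists[OF G(2)] by blast
  have pG: "p \<odot> G \<le> G" using fprod_mono[OF p(1) order_refl] G(3) by (rule order_trans)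
  have "G \<odot> p = G"
  proof (rule min)
    show "G \<odot> p \<le> G" using fprod_mono[OF order_refl p(1)] G(3) by (rule order_trans)
    show "G \<odot> p \<noteq> bot" using G p by (metis fprod_nonbot ultra_nonbot)
    have "G \<odot> p \<odot> (G \<odot> p) = G \<odot> (p \<odot> G) \<odot> p" by (simp add: fprod_assoc)
    also have "\<dots> \<le> G \<odot> G \<odot> p" using pG by (intro fprod_mono order_refl)
    also have "\<dots> \<le> G \<odot> p" using G(3) by (intro fprod_mono order_refl)
    finally show "G \<odot> p \<odot> (G \<odot> p) \<le> G \<odot> p" .
  qed
  then obtain H where H: "H \<le> G" "H \<noteq> bot" "H \<odot> p = p" "\<forall>H'\<le>G. H' \<odot> p \<le> p \<longrightarrow> H' \<le> H"
    using fprod_fibre[of p p G] p by auto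
  \<comment> \<open>By associativity \<open>H \<odot> H\<close> is also translated to
    \<open>p\<close>, and the fibre \<open>H\<close> lies above every such filter below
    \<open>G\<close>.\<close>
  have "H \<odot> H \<le> H"
    using H G fprod_mono[OF H(1) H(1)] by (metis fprod_assoc order_refl order_trans)
  then have "H = G" using H by (intro min)
  then have "G = p" using H \<open>G \<odot> p = G\<close> by simp
  then show ?thesis using G(1) p(2) \<open>G \<odot> p = G\<close> by blast
qed

section \<open>The pair of ultrafilters on words and on variable words\<close>

lemma subst_append: "subst v a (x @ y) = subst v a x @ subst v a y"
  by (simp add: subst_def)

lemma subst_words: "x \<in> words S \<Longrightarrow> v \<notin> S \<Longrightarrow> subst v a x = x"
  by (auto simp: subst_def words_def intro!: map_idI)

lemma subst_in_words: "x \<in> words (insert v S) \<Longrightarrow> a \<in> S \<Longrightarrow> subst v a x \<in> words S"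
  by (auto simp: subst_def words_def)

text \<open>The idempotent \<open>p\<close> is taken in a minimal left ideal of the ultrafilters on
  words, and \<open>q\<close> is an idempotent on variable words with
  \<open>p \<odot> q = q \<odot> p = q\<close>. Substitution of a letter is a homomorphism fixing
  \<open>p\<close>, so it sends \<open>q\<close> to an idempotent on words that absorbs
  \<open>p\<close> in the same way, and minimality leaves only \<open>p\<close> itself.\<close>

theorem carlson_ultrafilters:
  assumes "S \<noteq> {}" "v \<notin> S"
  shows "\<exists>p q. ultra p \<and> ultra q \<and> p \<le> principal (words S) \<and> q \<le> principal (vwords S v) \<and>
    p \<odot> p = p \<and> p \<odot> q = q \<and> q \<odot> p = q \<and> q \<odot> q = q \<and> (\<forall>a\<in>S. filtermap (subst v a) q = p)"
proof -
  let ?W = "principal (words S)" and ?V = "principal (vwords S v)"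
  obtain a where "a \<in> S" using assms by auto
  then have Wne: "?W \<noteq> bot" by (auto simp: principal_eq_bot_iff words_def intro!: exI[of _ "[a]"])
  have Vne: "?V \<noteq> bot"
  proof -
    have "[v] \<in> vwords S v" using assms by (simp add: words_def vwords_def)
    then show ?thesis by (auto simp: principal_eq_bot_iff)
  qed
  have WW: "?W \<odot> ?W \<le> ?W" by (auto simp: fprod_principal_le words_def)
  have WV: "?W \<odot> ?V \<le> ?V" and VW: "?V \<odot> ?W \<le> ?V" and VV: "?V \<odot> ?V \<le> ?V"
    by (auto simp: fprod_principal_le words_def vwords_def)
  have "\<exists>L\<le>?W. (L \<noteq> bot \<and> ?W \<odot> L \<le> L) \<and> (\<forall>H\<le>L. (H \<noteq> bot \<and> ?W \<odot> H \<le> H) \<longrightarrow> H = L)"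
  proof (rule filter_minimal_exists)
    fix C :: "'a list filter set"
    assume C: "C \<noteq> {}" "\<forall>F\<in>C. F \<noteq> bot \<and> ?W \<odot> F \<le> F" "\<forall>F\<in>C. \<forall>G\<in>C. F \<le> G \<or> G \<le> F"
    have "?W \<odot> Inf C \<le> Inf C"
    proof (rule Inf_greatest)
      fix G assume G: "G \<in> C"
      then have "?W \<odot> Inf C \<le> ?W \<odot> G" by (intro fprod_mono Inf_lower order_refl)
      then show "?W \<odot> Inf C \<le> G" using C G by (meson order_trans)
    qed
    then show "Inf C \<noteq> bot \<and> ?W \<odot> Inf C \<le> Inf C" using Inf_chain_nonbot C by blast
  qed (use Wne WW in simp)
  then obtain L where L: "L \<le> ?W" "L \<noteq> bot" "?W \<odot> L \<le> L"
    and min: "\<And>H. H \<le> L \<Longrightarrow> H \<noteq> bot \<Longrightarrow> ?W \<odot> H \<le> H \<Longrightarrow> H = L" by blast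
  have "L \<odot> L \<le> L" using fprod_mono[OF L(1) order_refl] L(3) by (rule order_trans)
  then obtain p where p: "p \<le> L" "ultra p" "p \<odot> p = p" using ellis[OF L(2)] by blast
  have pW: "p \<le> ?W" using p L by simp
  have left_ideal: "?W \<odot> e = L" if "e \<le> L" "e \<noteq> bot" for e
  proof (rule min)
    show "?W \<odot> e \<le> L" using fprod_mono[OF order_refl that(1)] L(3) by (rule order_trans)
    show "?W \<odot> e \<noteq> bot" using that Wne by (intro fprod_nonbot)
    show "?W \<odot> (?W \<odot> e) \<le> ?W \<odot> e"
      unfolding fprod_assoc[symmetric] using WW by (intro fprod_mono order_refl)
  qed
  have pV: "p \<odot> ?V \<le> ?V" using fprod_mono[OF pW order_refl] WV by (rule order_trans)
  have "?V \<odot> p \<odot> (?V \<odot> p) = ?V \<odot> (p \<odot> ?V) \<odot> p" by (simp add: fprod_assoc)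
  also have "\<dots> \<le> ?V \<odot> ?V \<odot> p" using pV by (intro fprod_mono order_refl)
  also have "\<dots> \<le> ?V \<odot> p" using VV by (intro fprod_mono order_refl)
  finally have "?V \<odot> p \<odot> (?V \<odot> p) \<le> ?V \<odot> p" .
  moreover have "?V \<odot> p \<noteq> bot" using Vne p by (metis fprod_nonbot ultra_nonbot)
  ultimately obtain q0 where q0: "q0 \<le> ?V \<odot> p" "ultra q0" "q0 \<odot> q0 = q0" using ellis by blast
  obtain x where x: "x \<odot> p = q0" using fprod_fibre[OF p(2) q0(2,1)] by blast
  have q0p: "q0 \<odot> p = q0" unfolding x[symmetric] fprod_assoc p(3) ..
  \<comment> \<open>\<open>q0\<close> absorbs \<open>p\<close> on the right because it factors
    through \<open>p\<close>. Multiplying by \<open>p\<close> on the left gains absorption on that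
    side too and keeps idempotence.\<close>
  define q where "q = p \<odot> q0"
  have "q0 \<le> ?V" using q0(1) fprod_mono[OF order_refl pW, of ?V] VW by (meson order_trans)
  then have qV: "q \<le> ?V" unfolding q_def using fprod_mono[OF order_refl, of q0 ?V p] pV by (meson order_trans)
  have uq: "ultra q" unfolding q_def using p q0 by (intro ultra_fprod)
  have pq: "p \<odot> q = q" unfolding q_def fprod_assoc[symmetric] p(3) ..
  have qp: "q \<odot> p = q" unfolding q_def fprod_assoc q0p ..
  have qq: "q \<odot> q = q"
  proof -
    have "q \<odot> q = p \<odot> (q0 \<odot> p) \<odot> q0" unfolding q_def by (simp add: fprod_assoc)
    then show ?thesis unfolding q0p q_def by (simp add: fprod_assoc q0)
  qed
  have "filtermap (subst v a) q = p" if a: "a \<in> S" for a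
  proof -
    define e where "e = filtermap (subst v a) q"
    have fp: "filtermap (subst v a) p = p"
    proof -
      have "\<forall>\<^sub>F x in p. subst v a x = x"
        using pW subst_words[OF _ assms(2)] by (auto simp: le_principal elim!: eventually_mono)
      then show ?thesis
        by (auto simp: filter_eq_iff eventually_filtermap elim: eventually_elim2)
    qed
    have hom: "filtermap (subst v a) (F \<odot> G) = filtermap (subst v a) F \<odot> filtermap (subst v a) G" for F G
      by (rule filtermap_fprod) (rule subst_append)
    have ep: "e \<odot> p = e" and pe: "p \<odot> e = e" and ee: "e \<odot> e = e"
      using hom[of q p] hom[of p q] hom[of q q] by (simp_all add: fp qp pq qq e_def)
    have ue: "ultra e" unfolding e_def using uq by (rule ultra_filtermap)
    have "e \<le> ?W"
      using qV subst_in_words[OF _ a] unfolding e_def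
      by (auto simp: le_principal eventually_filtermap vwords_def elim!: eventually_mono)
    \<comment> \<open>As \<open>e = e \<odot> p\<close>, it lies in the left ideal \<open>L\<close>.
      By minimality \<open>L\<close> is generated by \<open>e\<close> as well, so
      \<open>p = y \<odot> e\<close> for some \<open>y\<close>, whence
      \<open>p \<odot> e = p\<close>.\<close>
    then have "e \<le> ?W \<odot> p" using fprod_mono[of e ?W p p] ep by simp
    then have "e \<le> L" using left_ideal[OF p(1) ultra_nonbot[OF p(2)]] by simp
    then have "?W \<odot> e = L" using left_ideal ue ultra_nonbot by blast
    then obtain y where y: "y \<odot> e = p" using fprod_fibre[OF ue p(2), of ?W] p(1) by auto
    have "p \<odot> e = p" unfolding y[symmetric] fprod_assoc ee ..
    then show ?thesis using pe e_def by simp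
  qed
  then show ?thesis using p(2,3) uq pW qV pq qp qq by blast
qed

section \<open>Reductions\<close>

lemma start_0 [simp]: "start t 0 = 0"
  by (simp add: start_def)

lemma start_Suc [simp]: "start t (Suc i) = start t i + length (t i)"
  by (simp add: start_def)

lemma start_mono: "i \<le> j \<Longrightarrow> start t i \<le> start t j"
  by (rule lift_Suc_mono_le[of "start t"]) simp_all

lemma start_nth: "i \<le> length t \<Longrightarrow> start ((!) t) i = length (concat (take i t))"
  by (induction i) (simp_all add: take_Suc_conv_app_nth)

lemma subst_subst: "subst v a (subst v b y) = subst v (if b = v then a else b) y"
  by (auto simp: subst_def)

lemma subst_self [simp]: "subst v v y = y"
  by (simp add: subst_def map_idI)

lemma length_subst [simp]: "length (subst v a y) = length y"
  by (simp add: subst_def)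

lemma block_Nil [simp]: "block v w k [] = []"
  by (simp add: block_def)

lemma block_snoc: "block v w k (x @ [a]) = block v w k x @ subst v a (w (k + length x))"
proof -
  have "map (\<lambda>j. subst v ((x @ [a]) ! j) (w (k + j))) [0..<length x] =
      map (\<lambda>j. subst v (x ! j) (w (k + j))) [0..<length x]"
    by (rule map_cong) (simp_all add: nth_append)
  then show ?thesis by (simp add: block_def del: map_eq_conv)
qed

lemma block_append: "block v w k (x @ y) = block v w k x @ block v w (k + length x) y"
  by (induction y rule: rev_induct) (simp_all add: block_snoc add.assoc flip: append_assoc)

lemma block_single [simp]: "block v w k [a] = subst v a (w k)"
  using block_snoc[of v w k "[]" a] by simp

lemma block_Cons: "block v w k (a # x) = subst v a (w k) @ block v w (Suc k) x"
  using block_append[of v w k "[a]" x] by simp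

lemma start_add_length_block: "start w k + length (block v w k x) = start w (k + length x)"
  by (induction x rule: rev_induct) (simp_all add: block_snoc)

lemma length_block_0: "length (block v w 0 x) = start w (length x)"
  using start_add_length_block[of w 0 v x] by simp

lemma subst_block: "subst v a (block v w k x) = block v w k (subst v a x)"
proof (induction x rule: rev_induct)
  case (snoc b x)
  have "subst v a (x @ [b]) = subst v a x @ [if b = v then a else b]"
    by (simp add: subst_def)
  then show ?case using snoc by (simp add: block_snoc subst_append subst_subst)
qed (simp add: subst_def)

lemma block_cong: "(\<And>j. j < length x \<Longrightarrow> w (k + j) = w' (k + j)) \<Longrightarrow> block v w k x = block v w' k x"
  unfolding block_def by (rule arg_cong[where f = concat], rule map_cong) simp_all

text \<open>One letter of \<open>x\<close> consumes a whole word of \<open>t\<close>, which explains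
  the offset \<open>start t k\<close> in \<open>w\<close>. This identity makes reductions
  compose.\<close>

lemma block_red_inf: "block v (red_inf v w t) k x = block v w (start t k) (block v t k x)"
proof (induction x rule: rev_induct)
  case (snoc a x)
  then show ?case
    by (simp add: block_snoc block_append start_add_length_block red_inf_def subst_block)
qed simp

lemma start_red_inf: "start (red_inf v w t) k = start w (start t k)"
  by (induction k) (simp_all add: red_inf_def start_add_length_block)

lemma red_inf_red_inf: "red_inf v (red_inf v w t) s = red_inf v w (red_inf v t s)"
proof
  fix i show "red_inf v (red_inf v w t) s i = red_inf v w (red_inf v t s) i"
    unfolding red_inf_def[of v "red_inf v w t"] red_inf_def[of v w "red_inf v t s"]
    by (simp add: block_red_inf start_red_inf) (simp add: red_inf_def)
qed

lemma red_fin_Nil [simp]: "red_fin v w [] = []"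
  by (simp add: red_fin_def)

lemma red_fin_snoc:
  "red_fin v w (t @ [x]) = red_fin v w t @ [block v w (length (concat t)) x]"
proof -
  have "start ((!) (t @ [x])) i = start ((!) t) i" if "i \<le> length t" for i
    using that by (simp add: start_nth)
  then show ?thesis
    by (simp add: red_fin_def nth_append start_nth cong: map_cong)
qed

lemma length_red_fin [simp]: "length (red_fin v w t) = length t"
  by (simp add: red_fin_def)

lemma red_fin_eq_Nil_iff [simp]: "red_fin v w t = [] \<longleftrightarrow> t = []"
  by (simp add: red_fin_def)

lemma red_fin_single [simp]: "red_fin v w [x] = [block v w 0 x]"
  using red_fin_snoc[of v w "[]" x] by simp

lemma concat_red_fin: "concat (red_fin v w t) = block v w 0 (concat t)"
  by (induction t rule: rev_induct) (simp_all add: red_fin_snoc block_append)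

lemma red_fin_append_prefix: "prefix (red_fin v w t) (red_fin v w (t @ s))"
proof (induction s rule: rev_induct)
  case (snoc x s)
  then show ?case using red_fin_snoc[of v w "t @ s" x] by (auto intro: prefix_order.trans)
qed simp

lemma take_red_fin: "take i (red_fin v w t) = red_fin v w (take i t)"
proof -
  have "prefix (red_fin v w (take i t)) (red_fin v w t)"
    using red_fin_append_prefix[of v w "take i t" "drop i t"] by simp
  then obtain r where r: "red_fin v w t = red_fin v w (take i t) @ r" by (auto simp: prefix_def)
  from arg_cong[OF r, of length] have "length r = length t - min i (length t)" by auto
  then show ?thesis using r by (cases "i \<le> length t") auto
qed

lemma nth_red_fin: "i < length t \<Longrightarrow> red_fin v w t ! i = block v w (length (concat (take i t))) (t ! i)"
  by (simp add: red_fin_def start_nth)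

lemma red_fin_red_inf: "red_fin v (red_inf v w t) s = red_fin v w (red_fin v t s)"
  by (induction s rule: rev_induct)
     (simp_all add: red_fin_snoc block_red_inf concat_red_fin length_block_0)

lemma red_fin_cong:
  "(\<And>j. j < length (concat t) \<Longrightarrow> w j = w' j) \<Longrightarrow> red_fin v w t = red_fin v w' t"
proof (induction t rule: rev_induct)
  case (snoc x t)
  have "block v w (length (concat t)) x = block v w' (length (concat t)) x"
    using snoc.prems by (intro block_cong) simp
  then show ?case using snoc by (simp add: red_fin_snoc)
qed simp

text \<open>Composition for finite sequences; the length bound keeps \<open>(!)\<close> within the
  list, beyond which its values are unspecified.\<close>

lemma red_fin_nth_red_fin:
  assumes "length (concat r) \<le> length t"
  shows "red_fin v ((!) (red_fin v w t)) r = red_fin v w (red_fin v ((!) t) r)"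
proof -
  have "red_fin v ((!) (red_fin v w t)) r = red_fin v (red_inf v w ((!) t)) r"
    using assms by (intro red_fin_cong) (simp add: red_inf_def nth_red_fin start_nth)
  then show ?thesis by (simp add: red_fin_red_inf)
qed

lemma red_inf_map_prefix:
  "map (red_inf v w t) [0..<n] = red_fin v w (map t [0..<n])"
proof (induction n)
  case (Suc n)
  have "length (concat (map t [0..<n])) = start t n" by (simp add: start_def length_concat comp_def interv_sum_list_conv_sum_set_nat atLeast0LessThan)
  then show ?case using Suc by (simp add: red_fin_snoc red_inf_def)
qed simp

section \<open>Positions where a sequence of words is cut\<close>

definition cuts :: "'a list list \<Rightarrow> nat set" where
  "cuts t = {length (concat (take i t)) | i. 1 \<le> i \<and> i < length t}"

lemma cuts_Nil [simp]: "cuts [] = {}" and cuts_single [simp]: "cuts [x] = {}"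
  by (auto simp: cuts_def)

lemma cuts_snoc: "t \<noteq> [] \<Longrightarrow> cuts (t @ [x]) = insert (length (concat t)) (cuts t)"
proof -
  assume t: "t \<noteq> []"
  have take: "take i (t @ [x]) = take i t" if "i \<le> length t" for i using that by simp
  have "cuts (t @ [x]) = (\<lambda>i. length (concat (take i (t @ [x])))) ` {i. 1 \<le> i \<and> i < Suc (length t)}"
    unfolding cuts_def setcompr_eq_image by simp
  also have "{i. 1 \<le> i \<and> i < Suc (length t)} = insert (length t) {i. 1 \<le> i \<and> i < length t}"
    using t by (auto simp: Suc_le_eq)
  also have "(\<lambda>i. length (concat (take i (t @ [x])))) ` insert (length t) {i. 1 \<le> i \<and> i < length t} =
      insert (length (concat t)) ((\<lambda>i. length (concat (take i t))) ` {i. 1 \<le> i \<and> i < length t})"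
    unfolding image_insert by (intro arg_cong2[where f = insert] image_cong) (simp_all del: take_append add: take)
  also have "(\<lambda>i. length (concat (take i t))) ` {i. 1 \<le> i \<and> i < length t} = cuts t"
    unfolding cuts_def setcompr_eq_image ..
  finally show ?thesis .
qed

text \<open>Cuts are counted in letters of the pattern \<open>t\<close>, so they are independent of
  the words being reduced. \<open>start u\<close> converts them into positions, and the
  \<open>+ 1\<close> is the counting from 1 in \<open>dset\<close>.\<close>

lemma dset_red_fin: "dset (red_fin v u t) = (\<lambda>j. start u j + 1) ` cuts t"
proof -
  have "start ((!) (red_fin v u t)) i = start u (length (concat (take i t)))" if "i < length t" for i
    using that by (simp add: start_nth take_red_fin concat_red_fin length_block_0)
  then show ?thesis unfolding dset_def cuts_def by force
qed

lemma concat_nonempty: "r \<noteq> [] \<Longrightarrow> \<forall>x\<in>set r. x \<noteq> [] \<Longrightarrow> concat r \<noteq> []"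
  by (cases r) auto

lemma length_concat_take_less:
  assumes "\<forall>x\<in>set t. x \<noteq> []" "i < j" "j \<le> length t"
  shows "length (concat (take i t)) < length (concat (take j t))"
  using assms(2,3)
proof (induction j)
  case (Suc j)
  have "length (t ! j) > 0" using assms(1) Suc.prems by simp
  then have "length (concat (take j t)) < length (concat (take (Suc j) t))"
    using Suc.prems by (simp add: take_Suc_conv_app_nth)
  then show ?case using Suc by (cases "i = j") auto
qed simp

text \<open>A reduction merges neighbouring words and substitutes letters without changing lengths;
  it can delete cuts but creates none.\<close>

lemma cuts_red_fin_nth_subset:
  assumes "length (concat r) = length t" "\<forall>x\<in>set r. x \<noteq> []"
  shows "cuts (red_fin v ((!) t) r) \<subseteq> cuts t"
proof
  fix k assume "k \<in> cuts (red_fin v ((!) t) r)"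
  then obtain i where i: "1 \<le> i" "i < length r" "k = length (concat (take i (red_fin v ((!) t) r)))"
    by (auto simp: cuts_def)
  let ?n = "length (concat (take i r))"
  have r: "concat r = concat (take i r) @ concat (drop i r)"
    by (metis append_take_drop_id concat_append)
  have "take i r \<noteq> []" "drop i r \<noteq> []" using i by auto
  then have "concat (take i r) \<noteq> []" "concat (drop i r) \<noteq> []"
    using assms(2) by (meson concat_nonempty in_set_takeD in_set_dropD)+
  then have n: "1 \<le> ?n" "?n < length t"
    using arg_cong[OF r, of length] assms(1) by (auto simp: Suc_le_eq)
  have "k = start ((!) t) ?n"
    using i by (simp add: take_red_fin concat_red_fin length_block_0)
  then show "k \<in> cuts t" using n by (auto simp: cuts_def start_nth)
qed

lemma cuts_map_length: "map length s = map length t \<Longrightarrow> cuts s = cuts t"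
proof -
  assume eq: "map length s = map length t"
  have "length (concat (take i s)) = length (concat (take i t))" for i
    using eq by (simp add: length_concat take_map[symmetric])
  moreover have "length s = length t" using eq by (rule map_eq_imp_length_eq)
  ultimately show ?thesis by (simp add: cuts_def)
qed

section \<open>Words and variable words as two kinds of words\<close>

locale alphabet =
  fixes S :: "'a set" and v :: 'a
  assumes finite_S: "finite S" and S_nonempty: "S \<noteq> {}" and v_notin_S: "v \<notin> S"
begin

abbreviation A :: "'a set" where "A \<equiv> insert v S"

definition vseq :: "(nat \<Rightarrow> 'a list) \<Rightarrow> bool" where
  "vseq u \<longleftrightarrow> (\<forall>i. u i \<in> vwords S v)"

definition kind :: "'a list set \<Rightarrow> bool" where
  "kind K \<longleftrightarrow> K = words S \<or> K = vwords S v"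

lemma words_A: "x \<in> words A \<longleftrightarrow> x \<noteq> [] \<and> set x \<subseteq> A"
  by (simp add: words_def)

lemma words_S: "x \<in> words S \<longleftrightarrow> x \<in> words A \<and> v \<notin> set x"
  using v_notin_S by (auto simp: words_def)

lemma vwords_iff: "x \<in> vwords S v \<longleftrightarrow> x \<in> words A \<and> v \<in> set x"
  by (auto simp: vwords_def words_S)

lemma kind_words: "kind K \<Longrightarrow> x \<in> K \<Longrightarrow> x \<in> words A"
  by (auto simp: kind_def words_S vwords_iff)

lemma kind_lists: "kind K \<Longrightarrow> t \<in> lists K \<Longrightarrow> t \<in> lists (words A)"
  using kind_words by (auto simp: lists_eq_set)

lemma kind_nonempty: "kind K \<Longrightarrow> x \<in> K \<Longrightarrow> x \<noteq> []"
  using kind_words words_A by blast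

lemma kind_replicate: "kind K \<Longrightarrow> \<exists>a\<in>A. \<forall>n. replicate (Suc n) a \<in> K"
proof -
  assume "kind K"
  moreover obtain a where "a \<in> S" using S_nonempty by blast
  moreover from this have "replicate (Suc n) a \<in> words S" for n by (auto simp: words_def)
  moreover have "replicate (Suc n) v \<in> vwords S v" for n by (auto simp: vwords_iff words_A)
  ultimately show ?thesis unfolding kind_def by blast
qed

lemma vseq_in: "vseq u \<Longrightarrow> u i \<in> words A" "vseq u \<Longrightarrow> v \<in> set (u i)" "vseq u \<Longrightarrow> u i \<noteq> []"
  by (auto simp: vseq_def vwords_iff words_A)

lemma set_block:
  assumes "vseq u" "set x \<subseteq> A"
  shows "set (block v u k x) \<subseteq> A \<and> (v \<in> set (block v u k x) \<longleftrightarrow> v \<in> set x)"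
  using assms(2)
proof (induction x rule: rev_induct)
  case (snoc a x)
  have "set (subst v a (u (k + length x))) \<subseteq> A"
    using snoc.prems vseq_in(1)[OF assms(1), of "k + length x"] by (auto simp: subst_def words_A)
  moreover have "v \<in> set (subst v a (u (k + length x))) \<longleftrightarrow> v = a"
    using vseq_in(2)[OF assms(1), of "k + length x"] by (auto simp: subst_def)
  ultimately show ?case using snoc by (auto simp: block_snoc)
qed simp

lemma block_eq_Nil_iff: "vseq u \<Longrightarrow> block v u k x = [] \<longleftrightarrow> x = []"
  by (cases x) (auto simp: block_Cons subst_def vseq_in)

lemma block_words_A: "vseq u \<Longrightarrow> x \<in> words A \<Longrightarrow> block v u k x \<in> words A"
  using set_block[of u x k] block_eq_Nil_iff[of u k x] by (auto simp: words_A)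

text \<open>Every term of \<open>u\<close> contains the variable, so the variable survives in the
  block exactly when it is a letter of the pattern.\<close>

lemma block_kind: "vseq u \<Longrightarrow> kind K \<Longrightarrow> x \<in> words A \<Longrightarrow> block v u k x \<in> K \<longleftrightarrow> x \<in> K"
  using block_words_A[of u x k] set_block[of u x k] by (auto simp: kind_def words_S vwords_iff words_A)

lemma red_fin_lists_A: "vseq u \<Longrightarrow> t \<in> lists (words A) \<Longrightarrow> red_fin v u t \<in> lists (words A)"
proof (induction t rule: rev_induct)
  case (snoc x t)
  then show ?case by (simp add: red_fin_snoc block_words_A)
qed simp

lemma red_fin_lists_kind:
  assumes "vseq u" "kind K" "t \<in> lists (words A)"
  shows "red_fin v u t \<in> lists K \<longleftrightarrow> t \<in> lists K"
  using assms(3)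
proof (induction t rule: rev_induct)
  case (snoc x t)
  then show ?case using assms(1,2) by (simp add: red_fin_snoc block_kind)
qed simp

lemma vseq_red_inf: "vseq w \<Longrightarrow> vseq t \<Longrightarrow> vseq (red_inf v w t)"
  using block_kind[of w "vwords S v"] vseq_in(1) unfolding vseq_def red_inf_def
  by (simp add: kind_def vwords_iff)

text \<open>Substituting different letters into \<open>u k\<close> gives words of equal length that
  differ where the variable stood, so a block can be decoded letter by letter.\<close>

lemma prefix_block_imp_prefix:
  assumes "vseq u" "prefix (block v u k x) (block v u k y)"
  shows "prefix x y"
  using assms(2)
proof (induction x arbitrary: y k)
  case (Cons a x)
  have ne: "u k \<noteq> []" and vin: "v \<in> set (u k)" using vseq_in[OF assms(1)] by auto
  obtain b y' where y: "y = b # y'"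
    using Cons.prems ne by (cases y) (auto simp: block_Cons subst_def)
  have "subst v a (u k) = subst v b (u k)" "prefix (block v u (Suc k) x) (block v u (Suc k) y')"
    using Cons.prems by (auto simp: y block_Cons prefix_def)
  then have "prefix x y'" and "a = b"
    using Cons.IH vin by (auto simp: subst_def)
  then show ?case using y by simp
qed simp

lemma block_inject: "vseq u \<Longrightarrow> block v u k x = block v u k y \<longleftrightarrow> x = y"
  using prefix_block_imp_prefix[of u k] by (metis prefix_order.antisym prefix_order.refl)

lemma red_fin_inject: "vseq u \<Longrightarrow> red_fin v u t = red_fin v u s \<longleftrightarrow> t = s"
proof (induction t arbitrary: s rule: rev_induct)
  case Nil
  then show ?case by (metis red_fin_Nil red_fin_eq_Nil_iff)
next
  case (snoc x t)
  show ?case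
  proof (cases s rule: rev_cases)
    case (snoc s' y)
    then show ?thesis using snoc.IH[of s'] snoc.prems by (auto simp: red_fin_snoc block_inject)
  qed simp
qed

definition reds :: "'a list set \<Rightarrow> (nat \<Rightarrow> 'a list) \<Rightarrow> 'a list list set" where
  "reds K u = red_fin v u ` lists K"

lemma reds_words: "reds (words S) u = RW_fin S v u"
  by (simp add: reds_def RW_fin_def)

lemma reds_vwords: "reds (vwords S v) u = VRW_fin S v u"
  by (simp add: reds_def VRW_fin_def)

lemma variable_reduction_iff: "variable_reduction S v u w \<longleftrightarrow> (\<exists>t. vseq t \<and> u = red_inf v w t)"
  by (simp add: variable_reduction_def vseq_def)

lemma variable_reduction_vseq: "vseq w \<Longrightarrow> variable_reduction S v u w \<Longrightarrow> vseq u"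
  by (auto simp: variable_reduction_iff vseq_red_inf)

lemma variable_reduction_trans:
  "variable_reduction S v x u \<Longrightarrow> variable_reduction S v u w \<Longrightarrow> variable_reduction S v x w"
  unfolding variable_reduction_iff by (metis red_inf_red_inf vseq_red_inf)

lemma reds_mono:
  assumes "variable_reduction S v u w" "kind K"
  shows "reds K u \<subseteq> reds K w"
proof
  fix s assume "s \<in> reds K u"
  then obtain r where r: "r \<in> lists K" "s = red_fin v u r" by (auto simp: reds_def)
  obtain t where t: "vseq t" "u = red_inf v w t" using assms(1) by (auto simp: variable_reduction_iff)
  have "red_fin v t r \<in> lists K" using r red_fin_lists_kind[OF t(1) assms(2)] kind_lists[OF assms(2)] by blast
  then show "s \<in> reds K w" using r t by (auto simp: reds_def red_fin_red_inf)
qed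

end

section \<open>A Ramsey theorem for open families of sequences of words\<close>

context alphabet
begin

text \<open>Such a filter is the join of the two ultrafilters of \<open>carlson_ultrafilters\<close>; working with the
  join makes the two kinds of words symmetric.\<close>

definition carlson_filter :: "'a list filter \<Rightarrow> bool" where
  "carlson_filter F \<longleftrightarrow>
     (\<forall>P. eventually P F \<longrightarrow> (\<forall>\<^sub>F x in F. \<forall>\<^sub>F y in F. P (x @ y))) \<and>
     (\<forall>P. \<forall>a\<in>A. eventually P F \<longrightarrow> (\<forall>\<^sub>F x in F. P (subst v a x))) \<and>
     (\<forall>P. eventually P F \<longrightarrow> (\<exists>x\<in>vwords S v. P x)) \<and>
     (\<forall>P K. kind K \<longrightarrow> (\<forall>\<^sub>F x in F. x \<in> K \<longrightarrow> P x) \<or> (\<forall>\<^sub>F x in F. x \<in> K \<longrightarrow> \<not> P x))"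

text \<open>The four products of \<open>p\<close> and \<open>q\<close> give the first clause.
  Substitutions fix the words under \<open>p\<close> and carry \<open>q\<close> to \<open>p\<close>,
  or leave it alone for the letter \<open>v\<close>. As \<open>p\<close> and \<open>q\<close> live
  on disjoint kinds, restricting the join to one kind leaves a single ultrafilter.\<close>

lemma carlson_filter_exists: "\<exists>F. carlson_filter F"
proof -
  obtain p q where u: "ultra p" "ultra q" and pW: "p \<le> principal (words S)"
    and qV: "q \<le> principal (vwords S v)"
    and pp: "p \<odot> p = p" and pq: "p \<odot> q = q" and qp: "q \<odot> p = q" and qq: "q \<odot> q = q"
    and sub: "\<forall>a\<in>S. filtermap (subst v a) q = p"
    using carlson_ultrafilters[OF S_nonempty v_notin_S] by blast
  have pW': "\<forall>\<^sub>F x in p. x \<in> words S" and qV': "\<forall>\<^sub>F x in q. x \<in> vwords S v"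
    using pW qV by (simp_all add: le_principal)
  have "carlson_filter (sup p q)"
    unfolding carlson_filter_def eventually_sup
  proof (intro conjI allI impI ballI)
    fix P
    assume P: "eventually P p \<and> eventually P q"
    have "eventually P (p \<odot> p)" "eventually P (p \<odot> q)" "eventually P (q \<odot> p)" "eventually P (q \<odot> q)"
      using P pp pq qp qq by simp_all
    then show "\<forall>\<^sub>F x in p. eventually (\<lambda>y. P (x @ y)) p \<and> eventually (\<lambda>y. P (x @ y)) q"
      "\<forall>\<^sub>F x in q. eventually (\<lambda>y. P (x @ y)) p \<and> eventually (\<lambda>y. P (x @ y)) q"
      by (simp_all add: eventually_fprod eventually_conj_iff)
    have "\<forall>\<^sub>F x in q. x \<in> vwords S v \<and> P x" using qV' P by (simp add: eventually_conj_iff)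
    then show "\<exists>x\<in>vwords S v. P x"
      using eventually_happens'[OF ultra_nonbot[OF u(2)]] by blast
    fix a assume a: "a \<in> A"
    show "\<forall>\<^sub>F x in p. P (subst v a x)"
      using pW' conjunct1[OF P]
    proof eventually_elim
      case (elim x)
      then have "subst v a x = x" using v_notin_S by (rule_tac subst_words)
      then show ?case using elim by simp
    qed
    show "\<forall>\<^sub>F x in q. P (subst v a x)"
    proof (cases "a = v")
      case False
      then have "filtermap (subst v a) q = p" using a sub by simp
      then have "eventually P (filtermap (subst v a) q)" using P by simp
      then show ?thesis by (simp add: eventually_filtermap)
    qed (use P in simp)
  next
    fix P K assume K: "kind K"
    have nW: "\<forall>\<^sub>F x in q. x \<notin> words S" using qV' by (rule eventually_mono) (simp add: words_S vwords_iff)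
    have nV: "\<forall>\<^sub>F x in p. x \<notin> vwords S v" using pW' by (rule eventually_mono) (simp add: words_S vwords_iff)
    have mono: "\<forall>\<^sub>F x in r. x \<in> L \<longrightarrow> R x" if "eventually R r" for R r and L :: "'a list set"
      using that by (rule eventually_mono) simp
    have vac: "\<forall>\<^sub>F x in r. x \<in> L \<longrightarrow> R x" if "\<forall>\<^sub>F x in r. x \<notin> L" for R r and L :: "'a list set"
      using that by (rule eventually_mono) simp
    have "eventually P p \<or> eventually (\<lambda>x. \<not> P x) p" "eventually P q \<or> eventually (\<lambda>x. \<not> P x) q"
      using u by (auto simp: ultra_def)
    then show "(\<forall>\<^sub>F x in p. x \<in> K \<longrightarrow> P x) \<and> (\<forall>\<^sub>F x in q. x \<in> K \<longrightarrow> P x) \<or>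
      (\<forall>\<^sub>F x in p. x \<in> K \<longrightarrow> \<not> P x) \<and> (\<forall>\<^sub>F x in q. x \<in> K \<longrightarrow> \<not> P x)"
      using K vac[OF nW] vac[OF nV] mono unfolding kind_def by metis
  qed
  then show ?thesis ..
qed

text \<open>A pair \<open>(s, x)\<close> consists of the completed words \<open>s\<close> of a reduction of \<open>u\<^sub>0, \<dots>, u\<^bsub>n-1\<^esub>\<close>
  and the unfinished last word \<open>x\<close>.\<close>

definition partial_step :: "('a list list \<times> 'a list) set \<Rightarrow> 'a list \<Rightarrow> ('a list list \<times> 'a list) set" where
  "partial_step Q u = (\<Union>(s, x)\<in>Q. \<Union>a\<in>A. {(s, x @ subst v a u), (s @ [x @ subst v a u], [])})"

text \<open>The terms of \<open>u\<close> are chosen one after another. Idempotence carries "almost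
  all continuations" across each new piece, so the last word may stay unfinished; as the alphabet is
  finite, only finitely many states occur at each stage, and one variable word serves them
  all.\<close>

lemma fusion:
  assumes F: "carlson_filter F" and X0: "[] \<in> X"
    and X: "\<And>t. t \<in> X \<Longrightarrow> \<forall>\<^sub>F x in F. t @ [x] \<in> X"
  shows "\<exists>u. vseq u \<and> red_fin v u ` lists (words A) \<subseteq> X"
proof -
  \<comment> \<open>An unfinished word must be acceptable as it stands and have almost all of its
    continuations acceptable; for \<open>x = []\<close> no word has begun and only the second demand
    remains.\<close>
  define good where "good = (\<lambda>(s, x). s \<in> X \<and> (x \<noteq> [] \<longrightarrow> s @ [x] \<in> X) \<and> (\<forall>\<^sub>F y in F. s @ [x @ y] \<in> X))"
  have step: "\<exists>u\<in>vwords S v. \<forall>r\<in>partial_step Q u. good r" if Q: "finite Q" "\<forall>r\<in>Q. good r" for Q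
  proof -
    let ?R = "\<lambda>(s, x) y. s @ [x @ y] \<in> X \<and> (\<forall>\<^sub>F z in F. s @ [x @ y @ z] \<in> X)"
    have "\<forall>\<^sub>F u in F. ?R r (subst v a u)" if "r \<in> Q" "a \<in> A" for r a
    proof -
      obtain s x where r: "r = (s, x)" by (cases r)
      have "\<forall>\<^sub>F y in F. s @ [x @ y] \<in> X" using Q that r by (auto simp: good_def)
      then have "\<forall>\<^sub>F y in F. ?R (s, x) y"
        using F[unfolded carlson_filter_def, THEN conjunct1, rule_format, of "\<lambda>y. s @ [x @ y] \<in> X"]
        by (simp add: eventually_conj_iff)
      then show ?thesis using F that(2) unfolding carlson_filter_def r by blast
    qed
    then have "\<forall>\<^sub>F u in F. \<forall>r\<in>Q. \<forall>a\<in>A. ?R r (subst v a u)"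
      using Q finite_S by (auto simp only: eventually_ball_finite_distrib finite_insert)
    then obtain u where u: "u \<in> vwords S v" "\<forall>r\<in>Q. \<forall>a\<in>A. ?R r (subst v a u)"
      using F unfolding carlson_filter_def by blast
    have "good r" if "r \<in> partial_step Q u" for r
    proof -
      from that obtain s x a where sx: "(s, x) \<in> Q" "a \<in> A"
        "r = (s, x @ subst v a u) \<or> r = (s @ [x @ subst v a u], [])"
        unfolding partial_step_def by blast
      have "?R (s, x) (subst v a u)" using u sx by blast
      moreover have "s \<in> X" using Q(2) sx by (auto simp: good_def)
      ultimately show ?thesis using sx(3) X[of "s @ [x @ subst v a u]"] by (auto simp: good_def)
    qed
    then show ?thesis using u(1) by blast
  qed
  have "\<exists>Q. \<forall>n. (finite (Q n) \<and> (\<forall>r\<in>Q n. good r) \<and> (n = 0 \<longrightarrow> Q n = {([], [])})) \<and>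
    (\<exists>u\<in>vwords S v. Q (Suc n) = partial_step (Q n) u)"
  proof (rule dependent_nat_choice)
    have "good ([], [])" using X0 X[OF X0] by (simp add: good_def)
    then show "\<exists>Q. finite Q \<and> (\<forall>r\<in>Q. good r) \<and> (0 = 0 \<longrightarrow> Q = {([], [])})"
      by (intro exI[of _ "{([], [])}"]) simp
    fix Q and n :: nat assume Q: "finite Q \<and> (\<forall>r\<in>Q. good r) \<and> (n = 0 \<longrightarrow> Q = {([], [])})"
    then obtain u where u: "u \<in> vwords S v" "\<forall>r\<in>partial_step Q u. good r" using step by blast
    have "finite (partial_step Q u)"
      using Q finite_S unfolding partial_step_def
      by (intro finite_UN_I) (simp_all add: split_def)
    then show "\<exists>Q'. (finite Q' \<and> (\<forall>r\<in>Q'. good r) \<and> (Suc n = 0 \<longrightarrow> Q' = {([], [])})) \<and>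
        (\<exists>u\<in>vwords S v. Q' = partial_step Q u)"
      using u by (intro exI[of _ "partial_step Q u"] conjI bexI[of _ u] impI) simp_all
  qed
  then obtain Q where Q': "\<forall>n. (finite (Q n) \<and> (\<forall>r\<in>Q n. good r) \<and> (n = 0 \<longrightarrow> Q n = {([], [])})) \<and>
    (\<exists>u\<in>vwords S v. Q (Suc n) = partial_step (Q n) u)" ..
  have Q: "\<forall>r\<in>Q n. good r" for n using spec[OF Q', of n] by (elim conjE)
  have Q_Suc: "\<exists>u\<in>vwords S v. Q (Suc n) = partial_step (Q n) u" for n
    using spec[OF Q', of n] by (elim conjE)
  have Q0: "Q 0 = {([], [])}" using spec[OF Q', of 0] by (simp only: simp_thms)
  have "\<forall>n. \<exists>u. u \<in> vwords S v \<and> Q (Suc n) = partial_step (Q n) u" using Q_Suc by blast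
  from choice[OF this] obtain u where
    u: "\<And>n. u n \<in> vwords S v" "\<And>n. Q (Suc n) = partial_step (Q n) (u n)" by blast
  have extend: "(s, x @ subst v a (u n)) \<in> Q (Suc n)" "(s @ [x @ subst v a (u n)], []) \<in> Q (Suc n)"
    if "(s, x) \<in> Q n" "a \<in> A" for s x a n
    using that unfolding u(2) partial_step_def by blast+
  have unfinished: "(red_fin v u t, block v u (length (concat t)) y) \<in> Q (length (concat t) + length y)"
    if "(red_fin v u t, []) \<in> Q (length (concat t))" "set y \<subseteq> A" for t y
    using that(2)
  proof (induction y rule: rev_induct)
    case (snoc a y)
    then show ?case using extend(1) by (simp add: block_snoc)
  qed (use that in simp)
  have fin: "(red_fin v u t, []) \<in> Q (length (concat t))" if "t \<in> lists (words A)" for t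
    using that
  proof (induction t rule: rev_induct)
    case (snoc x t)
    then obtain y a where x: "x = y @ [a]" "set y \<subseteq> A" "a \<in> A"
      by (cases x rule: rev_cases) (auto simp: words_A)
    have "(red_fin v u t, block v u (length (concat t)) y) \<in> Q (length (concat t) + length y)"
      using unfinished snoc x by auto
    then show ?case using extend(2)[OF _ x(3)] x by (simp add: red_fin_snoc block_snoc)
  qed (simp add: Q0)
  have "red_fin v u ` lists (words A) \<subseteq> X"
    using fin Q unfolding good_def by fastforce
  moreover have "vseq u" using u by (simp add: vseq_def)
  ultimately show ?thesis by blast
qed

end

text \<open>Says that \<open>O'\<close> is unavoidable above \<open>t\<close>, witnessed by a
  well-founded tree in which \<open>F\<close>-almost every word of \<open>K\<close> is allowed at
  each node. The set \<open>B\<close> keeps the recursive premise a plain bounded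
  quantifier.\<close>

inductive hits :: "'a list filter \<Rightarrow> 'a list set \<Rightarrow> 'a list list set \<Rightarrow> 'a list list \<Rightarrow> bool"
  for F K O' where
  base: "t \<in> O' \<Longrightarrow> hits F K O' t"
| step: "\<forall>\<^sub>F x in F. x \<in> K \<longrightarrow> x \<in> B \<Longrightarrow> \<forall>x\<in>B. hits F K O' (t @ [x]) \<Longrightarrow> hits F K O' t"

text \<open>Unfolds a derivation into its tree of sequences. Branching is \<open>F\<close>-large
  until \<open>O'\<close> is met, and an infinite branch must meet \<open>O'\<close> because
  derivations are well-founded.\<close>

lemma hits_tree:
  assumes "hits F K O' t"
  shows "\<exists>X. t \<in> X \<and> (\<forall>s\<in>X. prefix t s) \<and> (\<forall>s\<in>X. s \<in> O' \<or> (\<forall>\<^sub>F x in F. x \<in> K \<longrightarrow> s @ [x] \<in> X)) \<and>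
    (\<forall>f. (\<forall>n. t @ map f [0..<n] \<in> X) \<longrightarrow> (\<exists>n. t @ map f [0..<n] \<in> O'))"
  using assms
proof induction
  case (base t)
  then show ?case by (intro exI[of _ "{t}"]) (auto intro: exI[of _ 0])
next
  case (step B t)
  define W where "W x X \<longleftrightarrow> t @ [x] \<in> X \<and> (\<forall>s\<in>X. prefix (t @ [x]) s) \<and>
    (\<forall>s\<in>X. s \<in> O' \<or> (\<forall>\<^sub>F y in F. y \<in> K \<longrightarrow> s @ [y] \<in> X)) \<and>
    (\<forall>f. (\<forall>n. (t @ [x]) @ map f [0..<n] \<in> X) \<longrightarrow> (\<exists>n. (t @ [x]) @ map f [0..<n] \<in> O'))" for x X
  have "\<forall>x\<in>B. \<exists>X. W x X" using step.IH unfolding W_def by blast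
  then obtain X where "\<forall>x\<in>B. W x (X x)" using bchoice by blast
  then have X: "\<And>x. x \<in> B \<Longrightarrow> t @ [x] \<in> X x" "\<And>x s. x \<in> B \<Longrightarrow> s \<in> X x \<Longrightarrow> prefix (t @ [x]) s"
    "\<And>x s. x \<in> B \<Longrightarrow> s \<in> X x \<Longrightarrow> s \<in> O' \<or> (\<forall>\<^sub>F y in F. y \<in> K \<longrightarrow> s @ [y] \<in> X x)"
    "\<And>x f. x \<in> B \<Longrightarrow> (\<forall>n. (t @ [x]) @ map f [0..<n] \<in> X x) \<Longrightarrow> \<exists>n. (t @ [x]) @ map f [0..<n] \<in> O'"
    unfolding W_def by blast+
  let ?Y = "insert t (\<Union>x\<in>B. X x)"
  have "s \<in> O' \<or> (\<forall>\<^sub>F x in F. x \<in> K \<longrightarrow> s @ [x] \<in> ?Y)" if s: "s \<in> ?Y" for s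
  proof (cases "s = t")
    case True
    have "\<forall>\<^sub>F x in F. x \<in> K \<longrightarrow> s @ [x] \<in> ?Y"
      using step.hyps by (rule eventually_mono) (use X(1) True in blast)
    then show ?thesis ..
  next
    case False
    then obtain x where x: "x \<in> B" "s \<in> X x" using s by blast
    have "\<forall>\<^sub>F y in F. y \<in> K \<longrightarrow> s @ [y] \<in> ?Y" if "\<forall>\<^sub>F y in F. y \<in> K \<longrightarrow> s @ [y] \<in> X x"
      using that by (rule eventually_mono) (use x in blast)
    then show ?thesis using X(3)[OF x] by blast
  qed
  moreover have "\<exists>n. t @ map f [0..<n] \<in> O'" if f: "\<forall>n. t @ map f [0..<n] \<in> ?Y" for f
  proof -
    have mapf: "map f [0..<Suc n] = f 0 # map (\<lambda>i. f (Suc i)) [0..<n]" for n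
      by (simp add: upt_conv_Cons map_Suc_upt[symmetric] comp_def del: upt_Suc)
    have *: "f 0 \<in> B \<and> (t @ [f 0]) @ map (\<lambda>i. f (Suc i)) [0..<n] \<in> X (f 0)" for n
    proof -
      have "t @ map f [0..<Suc n] \<in> ?Y" using f by blast
      then obtain x where x: "x \<in> B" "t @ f 0 # map (\<lambda>i. f (Suc i)) [0..<n] \<in> X x"
        unfolding mapf by auto
      then have "prefix (t @ [x]) (t @ f 0 # map (\<lambda>i. f (Suc i)) [0..<n])" using X(2) by blast
      then have "x = f 0" by simp
      then show ?thesis using x by simp
    qed
    then obtain n where "(t @ [f 0]) @ map (\<lambda>i. f (Suc i)) [0..<n] \<in> O'" using X(4)[of "f 0"] by blast
    then have "t @ map f [0..<Suc n] \<in> O'" unfolding mapf by simp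
    then show ?thesis ..
  qed
  moreover have "\<forall>s\<in>?Y. prefix t s" using X(2) by (auto simp: prefix_def)
  ultimately show ?case by (intro exI[of _ ?Y]) blast
qed

context alphabet
begin

text \<open>Fusion is run inside one of two sets. If \<open>[]\<close> does not hit
  \<open>O'\<close>, it is the set of sequences that do not hit, closed under almost all extensions
  since \<open>F\<close> is an ultrafilter on \<open>K\<close>. Otherwise it is the tree of a
  derivation, which may be left only after \<open>O'\<close> has been met.\<close>

lemma open_ramsey_basic:
  assumes K: "kind K"
  shows "\<exists>u. vseq u \<and> ((\<forall>t\<in>lists K. red_fin v u t \<notin> O') \<or>
    (\<forall>t. (\<forall>i. t i \<in> K) \<longrightarrow> (\<exists>n. map (red_inf v u t) [0..<n] \<in> O')))"
proof -
  obtain F where F: "carlson_filter F" using carlson_filter_exists ..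
  show ?thesis
  proof (cases "hits F K O' []")
    case False
    define X where "X = {s. s \<in> lists K \<longrightarrow> \<not> hits F K O' s}"
    have "\<exists>u. vseq u \<and> red_fin v u ` lists (words A) \<subseteq> X"
    proof (rule fusion[OF F])
      show "[] \<in> X" using False by (simp add: X_def)
      fix t assume t: "t \<in> X"
      show "\<forall>\<^sub>F x in F. t @ [x] \<in> X"
      proof (cases "t \<in> lists K")
        case True
        then have "\<not> hits F K O' t" using t by (simp add: X_def)
        then have "\<not> (\<forall>\<^sub>F x in F. x \<in> K \<longrightarrow> hits F K O' (t @ [x]))"
        proof (rule contrapos_nn)
          assume ev: "\<forall>\<^sub>F x in F. x \<in> K \<longrightarrow> hits F K O' (t @ [x])"
          show "hits F K O' t"
            by (rule hits.step[where B = "{x. hits F K O' (t @ [x])}"]) (use ev in simp_all)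
        qed
        then have "\<forall>\<^sub>F x in F. x \<in> K \<longrightarrow> \<not> hits F K O' (t @ [x])"
          using F[unfolded carlson_filter_def, THEN conjunct2, THEN conjunct2, THEN conjunct2,
              rule_format, OF K, of "\<lambda>x. hits F K O' (t @ [x])"] by simp
        then show ?thesis by (rule eventually_mono) (simp add: X_def)
      qed (simp add: X_def)
    qed
    then obtain u where u: "vseq u" "red_fin v u ` lists (words A) \<subseteq> X" by blast
    have "red_fin v u t \<notin> O'" if "t \<in> lists K" for t
    proof -
      have "t \<in> lists (words A)" using kind_lists[OF K that] .
      then have "red_fin v u t \<in> lists K" "red_fin v u t \<in> X"
        using red_fin_lists_kind[OF u(1) K] that u(2) by auto
      then show ?thesis using hits.base by (auto simp: X_def)
    qed
    then show ?thesis using u(1) by blast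
  next
    case True
    from hits_tree[OF this] obtain Y where Y: "[] \<in> Y"
      "\<And>s. s \<in> Y \<Longrightarrow> s \<in> O' \<or> (\<forall>\<^sub>F x in F. x \<in> K \<longrightarrow> s @ [x] \<in> Y)"
      "\<And>f. \<forall>n. map f [0..<n] \<in> Y \<Longrightarrow> \<exists>n. map f [0..<n] \<in> O'" by (auto simp: append_Nil)
    define X where "X = {s. s \<in> lists K \<longrightarrow> s \<in> Y \<or> (\<exists>n. take n s \<in> O')}"
    have "\<exists>u. vseq u \<and> red_fin v u ` lists (words A) \<subseteq> X"
    proof (rule fusion[OF F])
      show "[] \<in> X" using Y by (simp add: X_def)
      fix t assume t: "t \<in> X"
      consider "t \<notin> lists K" | n where "take n t \<in> O'" | "t \<in> Y" "t \<notin> O'"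
      proof (cases "t \<in> lists K \<and> (\<forall>n. take n t \<notin> O')")
        case True
        then have "t \<in> Y" "take (length t) t \<notin> O'" using t unfolding X_def by blast+
        then show ?thesis using that(3) by simp
      qed (use that in blast)
      then show "\<forall>\<^sub>F x in F. t @ [x] \<in> X"
      proof cases
        case (2 n)
        then have "take (min n (length t)) (t @ [x]) \<in> O'" for x
          by (cases "n \<le> length t") (simp_all add: min_def)
        then have "t @ [x] \<in> X" for x unfolding X_def by blast
        then show ?thesis by simp
      next
        case 3
        then have "\<forall>\<^sub>F x in F. x \<in> K \<longrightarrow> t @ [x] \<in> Y" using Y(2) by blast
        then show ?thesis by (rule eventually_mono) (simp add: X_def)
      qed (simp add: X_def)
    qed
    then obtain u where u: "vseq u" "red_fin v u ` lists (words A) \<subseteq> X" by blast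
    have "\<exists>n. map (red_inf v u t) [0..<n] \<in> O'" if t: "\<forall>i. t i \<in> K" for t
    proof (rule ccontr)
      assume no: "\<not> ?thesis"
      have "map (red_inf v u t) [0..<n] \<in> Y" for n
      proof -
        have 1: "map t [0..<n] \<in> lists K" using t by auto
        have "map t [0..<n] \<in> lists (words A)" using kind_lists[OF K 1] .
        then have "map (red_inf v u t) [0..<n] \<in> lists K" "map (red_inf v u t) [0..<n] \<in> X"
          using red_fin_lists_kind[OF u(1) K] 1 u(2) unfolding red_inf_map_prefix by auto
        moreover have "take m (map (red_inf v u t) [0..<n]) \<notin> O'" for m
          using no by (cases "m \<le> n") (simp_all add: take_map)
        ultimately show ?thesis by (auto simp: X_def)
      qed
      then show False using Y(3)[of "red_inf v u t"] no by blast
    qed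
    then show ?thesis using u(1) by blast
  qed
qed

text \<open>Pulling \<open>O'\<close> back along the reduction of \<open>w\<close> turns the claim
  into one about patterns, and composition of reductions brings the answer back.\<close>

theorem open_ramsey:
  assumes K: "kind K"
  shows "\<exists>u. variable_reduction S v u w \<and> (reds K u \<inter> O' = {} \<or>
    (\<forall>t. (\<forall>i. t i \<in> K) \<longrightarrow> (\<exists>n. map (red_inf v u t) [0..<n] \<in> O')))"
proof -
  obtain r where r: "vseq r" "(\<forall>t\<in>lists K. red_fin v r t \<notin> {t. red_fin v w t \<in> O'}) \<or>
    (\<forall>t. (\<forall>i. t i \<in> K) \<longrightarrow> (\<exists>n. map (red_inf v r t) [0..<n] \<in> {t. red_fin v w t \<in> O'}))"
    using open_ramsey_basic[OF K, of "{t. red_fin v w t \<in> O'}"] by blast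
  let ?u = "red_inf v w r"
  have "variable_reduction S v ?u w" using r(1) variable_reduction_iff by blast
  moreover have "reds K ?u \<inter> O' = {}" if "\<forall>t\<in>lists K. red_fin v r t \<notin> {t. red_fin v w t \<in> O'}"
    using that by (auto simp: reds_def red_fin_red_inf)
  moreover have "map (red_inf v ?u t) [0..<n] = red_fin v w (map (red_inf v r t) [0..<n])" for t n
    by (simp only: red_inf_red_inf red_inf_map_prefix)
  ultimately show ?thesis using r(2) by (intro exI[of _ ?u]) auto
qed

end

section \<open>Transfinite derivatives\<close>

lemma cb_iter_0 [simp]: "cb_iter D H 0 = D H"
  and cb_iter_osuc [simp]: "cb_iter D H (osuc x) = D (cb_iter D H x)"
  and cb_iter_limit: "is_limit x \<Longrightarrow> cb_iter D H x = (\<Inter>y\<in>{..<x}. cb_iter D H y)"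
  by (simp_all add: cb_iter_def ord_rec_limit)

lemma cb_iter_antimono:
  assumes "\<And>P. D P \<subseteq> P" "x \<le> y"
  shows "cb_iter D H y \<subseteq> cb_iter D H x"
  using assms(2)
proof (induction y arbitrary: x rule: less_induct)
  case (less y)
  show ?case
  proof (cases "x = y")
    case False
    then have xy: "x < y" using less.prems by simp
    show ?thesis
    proof (cases y rule: cord_cases)
      case zero
      then show ?thesis using xy zero_le_cord[of x] by (simp add: not_le[symmetric])
    next
      case (osuc z)
      then have "cb_iter D H z \<subseteq> cb_iter D H x" using less.IH[of z x] xy by (simp add: less_osuc_iff)
      then show ?thesis using assms(1)[of "cb_iter D H z"] osuc by simp
    next
      case limit
      then show ?thesis using xy by (auto simp: cb_iter_limit)
    qed
  qed simp
qed

lemma cb_iter_mono: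
  assumes "\<And>P Q. P \<subseteq> Q \<Longrightarrow> D P \<subseteq> E Q"
  shows "cb_iter D H x \<subseteq> cb_iter E H x"
proof (induction x rule: less_induct)
  case (less x)
  show ?case
  proof (cases x rule: cord_cases)
    case limit
    then show ?thesis using less by (auto simp: cb_iter_limit)
  qed (use assms less in simp_all)
qed

section \<open>The derivative of a tree under one-term extension\<close>

definition extendable :: "'a list set \<Rightarrow> 'a list set" where
  "extendable P = {s \<in> P. \<exists>x. s @ [x] \<in> P}"

definition branching :: "'a list set \<Rightarrow> bool" where
  "branching H \<longleftrightarrow> (\<exists>s f. \<forall>n. s @ map f [0..<n] \<in> H)"

lemma branchingI:
  assumes "s \<in> P" "\<And>s. s \<in> P \<Longrightarrow> \<exists>x. s @ [x] \<in> P"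
  shows "branching P"
proof -
  have "\<exists>g. \<forall>n. g n \<in> P \<and> (n = 0 \<longrightarrow> g n = s) \<and> (\<exists>x. g (Suc n) = g n @ [x])"
    using dependent_nat_choice[of "\<lambda>n g. g \<in> P \<and> (n = 0 \<longrightarrow> g = s)" "\<lambda>n g g'. \<exists>x. g' = g @ [x]"] assms
    by (metis nat.distinct(1))
  then obtain g where g: "\<And>n. g n \<in> P" "g 0 = s" "\<And>n. \<exists>x. g (Suc n) = g n @ [x]" by blast
  from choice[of "\<lambda>n x. g (Suc n) = g n @ [x]"] g(3) obtain h where h: "\<And>n. g (Suc n) = g n @ [h n]" by blast
  have "g n = s @ map h [0..<n]" for n by (induction n) (simp_all add: g(2) h)
  then show ?thesis using g(1) unfolding branching_def by metis
qed

lemma branching_mono: "branching P \<Longrightarrow> P \<subseteq> Q \<Longrightarrow> branching Q"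
  unfolding branching_def by blast

text \<open>A non-empty stage that loses nothing could be extended forever, against the absence of
  branches. If no stage were empty, choosing an element lost at each stage would inject the
  uncountable set of all countable ordinals into \<open>H\<close>.\<close>

lemma extendable_vanishes:
  assumes "\<not> branching H" "countable H"
  shows "\<exists>x. cb_iter extendable H x = {}"
proof (rule ccontr)
  assume ne: "\<nexists>x. cb_iter extendable H x = {}"
  let ?T = "cb_iter extendable H"
  have sub: "extendable P \<subseteq> P" for P :: "'a list set" by (auto simp: extendable_def)
  have anti: "?T y \<subseteq> ?T x" if "x \<le> y" for x y using sub that by (rule cb_iter_antimono)
  have TH: "?T x \<subseteq> H" for x using anti[of 0 x] sub[of H] by auto
  have "\<exists>s. s \<in> ?T x \<and> s \<notin> ?T (osuc x)" for x
  proof (rule ccontr)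
    assume "\<nexists>s. s \<in> ?T x \<and> s \<notin> ?T (osuc x)"
    then have "\<And>s. s \<in> ?T x \<Longrightarrow> \<exists>y. s @ [y] \<in> ?T x" by (auto simp: extendable_def)
    then have "branching (?T x)" using ne branchingI by blast
    then show False using assms(1) branching_mono TH by blast
  qed
  then obtain e where e: "\<And>x. e x \<in> ?T x \<and> e x \<notin> ?T (osuc x)" by metis
  have "e x \<noteq> e y" if "x < y" for x y
    using e[of x] e[of y] anti[of "osuc x" y] that by (auto simp: osuc_le_iff)
  then have "inj e" by (metis injI linorder_neqE)
  moreover have "countable (range e)" using e TH assms(2) by (blast intro: countable_subset)
  ultimately have "countable (UNIV :: cord set)" by (rule countable_image_inj_on[rotated])
  then show False using uncountable_UNIV_cord by simp
qed

lemma cb_deriv_subset: "cb_deriv pr R R1 P \<subseteq> P"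
  by (auto simp: cb_deriv_def)

context alphabet
begin

text \<open>The two halves of the theorem are treated together: the data for words, resp. variable
  words, are a kind of words, the relation \<open>\<propto>\<close> and the hereditary subfamily.\<close>

definition admissible :: "'a list set \<Rightarrow> ('a list \<Rightarrow> 'a list \<Rightarrow> bool) \<Rightarrow>
    ('a list list set \<Rightarrow> 'a list list set) \<Rightarrow> bool" where
  "admissible K pr her \<longleftrightarrow> (K = words S \<and> pr = strict_prefix \<and> her = hered_words S v) \<or>
     (K = vwords S v \<and> pr = propto_var S v \<and> her = hered_vwords S v)"

abbreviation derivs :: "'a list set \<Rightarrow> ('a list \<Rightarrow> 'a list \<Rightarrow> bool) \<Rightarrow> (nat \<Rightarrow> 'a list) \<Rightarrow>
    'a list list set \<Rightarrow> cord \<Rightarrow> 'a list list set" where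
  "derivs K pr u \<equiv> cb_iter (cb_deriv pr (reds K u) {x. [x] \<in> reds K u})"

lemma admissible_kind: "admissible K pr her \<Longrightarrow> kind K"
  by (auto simp: admissible_def kind_def)

lemma admissible_strict_prefix: "admissible K pr her \<Longrightarrow> pr x y \<Longrightarrow> strict_prefix x y"
  by (auto simp: admissible_def propto_var_def)

lemma single_reds: "[x] \<in> reds K u \<longleftrightarrow> (\<exists>y\<in>K. x = block v u 0 y)"
proof
  assume "[x] \<in> reds K u"
  then obtain t where t: "t \<in> lists K" "[x] = red_fin v u t" by (auto simp: reds_def)
  from arg_cong[OF t(2), of length] have "length t = Suc 0" by simp
  then obtain y where "t = [y]" by (auto simp: length_Suc_conv)
  then show "\<exists>y\<in>K. x = block v u 0 y" using t by auto
qed (auto simp: reds_def intro!: image_eqI[where x = "[_]"])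

lemma admissible_block:
  assumes "admissible K pr her" "vseq u" "z \<in> K"
  shows "pr (block v u 0 x) (block v u 0 (x @ z))"
proof -
  have K: "kind K" using assms(1) by (rule admissible_kind)
  have "block v u (length x) z \<in> K"
    using block_kind[OF assms(2) K kind_words[OF K assms(3)]] assms(3) by simp
  moreover from this have "block v u (length x) z \<noteq> []" using kind_nonempty[OF K] by blast
  ultimately show ?thesis using assms(1)
    by (auto simp: admissible_def propto_var_def block_append strict_prefix_def)
qed

lemma kind_append: "kind K \<Longrightarrow> x \<in> K \<Longrightarrow> y \<in> K \<Longrightarrow> x @ y \<in> K"
  by (auto simp: kind_def words_S vwords_iff words_A)

lemma kind_concat_append: "kind K \<Longrightarrow> t \<in> lists K \<Longrightarrow> z \<in> K \<Longrightarrow> concat t @ z \<in> K"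
  by (induction t) (auto intro: kind_append)

text \<open>Repeating one letter after \<open>concat t\<close> produces an infinite chain for
  \<open>pr\<close>. It cannot lie wholly in the exceptional set, so some member of it yields an
  extension in \<open>P\<close>. For variable words the letter is the variable, which makes the
  differences variable words.\<close>

lemma cb_deriv_extendable:
  assumes "admissible K pr her" "vseq u"
  shows "cb_deriv pr (reds K u) {x. [x] \<in> reds K u} P \<subseteq> extendable P"
proof
  fix s assume s: "s \<in> cb_deriv pr (reds K u) {x. [x] \<in> reds K u} P"
  have K: "kind K" using assms(1) by (rule admissible_kind)
  from s obtain t where t: "t \<in> lists K" "s = red_fin v u t" by (auto simp: cb_deriv_def reds_def)
  obtain a where a: "\<And>n. replicate (Suc n) a \<in> K" using kind_replicate[OF K] by blast
  define f where "f n = block v u 0 (concat t @ replicate (Suc n) a)" for n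
  have f1: "[f n] \<in> reds K u" for n
    using kind_concat_append[OF K t(1) a] unfolding single_reds f_def by blast
  have f2: "pr (concat s) (f n)" for n
    unfolding t(2) concat_red_fin f_def by (rule admissible_block[OF assms a])
  have "pr (f n) (f (Suc n))" for n
  proof -
    have eq: "concat t @ replicate (Suc (Suc n)) a = (concat t @ replicate (Suc n) a) @ [a]"
      by (simp add: replicate_append_same)
    have aK: "[a] \<in> K" using a[of 0] by simp
    show ?thesis unfolding f_def eq by (rule admissible_block[OF assms aK])
  qed
  then obtain n where "f n \<notin> cb_A pr {x. [x] \<in> reds K u} P s"
    using s unfolding cb_deriv_def by blast
  then have "s @ [drop (length (concat s)) (f n)] \<in> P" using f1 f2 by (simp add: cb_A_def)
  moreover have "s \<in> P" using s cb_deriv_subset by blast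
  ultimately show "s \<in> extendable P" by (auto simp: extendable_def)
qed

lemma reds_subset: "vseq u \<Longrightarrow> kind K \<Longrightarrow> reds K u \<subseteq> lists (words A)"
  unfolding reds_def using red_fin_lists_A[of u] kind_lists[of K] by blast

text \<open>The derivative under extension does not mention \<open>u\<close>, so one ordinal bounds
  the indices of all reductions at once.\<close>

lemma derivs_vanish:
  assumes "admissible K pr her" "\<not> branching H" "H \<subseteq> lists (words A)"
  shows "\<exists>x. \<forall>u. vseq u \<longrightarrow> derivs K pr u H x = {}"
proof -
  have "countable (words A)"
  proof (rule countable_subset)
    show "words A \<subseteq> lists A" by (auto simp: words_A)
    show "countable (lists A)" using finite_S by (intro countable_lists countable_finite) simp
  qed
  then have "countable H" using countable_subset[OF assms(3)] countable_lists by blast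
  then obtain x where x: "cb_iter extendable H x = {}" using extendable_vanishes assms(2) by blast
  have "derivs K pr u H x \<subseteq> cb_iter extendable H x" if "vseq u" for u
  proof (rule cb_iter_mono)
    fix P Q :: "'a list list set" assume "P \<subseteq> Q"
    then show "cb_deriv pr (reds K u) {x. [x] \<in> reds K u} P \<subseteq> extendable Q"
      using cb_deriv_extendable[OF assms(1) that, of P] unfolding extendable_def by blast
  qed
  then show ?thesis using x by blast
qed

end

section \<open>Sparse sets avoiding a large family\<close>

lemma quot_empty [simp]: "quot A {} = A"
  by (simp add: quot_def set_less_def)

lemma quot_quot:
  assumes "\<forall>e\<in>E. e < n" shows "quot (quot A E) {n} = quot A (E \<union> {n})"
  using assms by (auto simp: quot_def set_less_def intro: less_trans)

lemma empty_in_quot: "{} \<in> quot A E \<longleftrightarrow> E \<in> A"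
  by (simp add: quot_def set_less_def)

text \<open>At stage \<open>j\<close> only finitely many sets \<open>E\<close> and ordinals of index
  at most \<open>j\<close> matter, so they share a threshold, and the next point is taken beyond it.
  All subsets of \<open>{..p (g j)}\<close> are covered, so points may be skipped later.\<close>

lemma sparse_exists:
  fixes p :: "nat \<Rightarrow> nat"
  assumes p: "strict_mono p" and idx: "inj_on idx {..<x::cord}"
  shows "\<exists>g. strict_mono g \<and> g 0 = 0 \<and>
    (\<forall>j. \<forall>E\<subseteq>{..p (g j)}. \<forall>c<x. idx c \<le> (j::nat) \<longrightarrow> (\<exists>d>c. large d (quot A E)) \<longrightarrow>
      large c (quot A (E \<union> {p (g (Suc j))})))"
proof -
  define R where "R j k n \<longleftrightarrow> (\<forall>E\<subseteq>{..k}. \<forall>c<x. idx c \<le> j \<longrightarrow> (\<exists>d>c. large d (quot A E)) \<longrightarrow>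
      large c (quot A (E \<union> {n})))" for j k n :: nat
  have R: "\<exists>N. \<forall>n\<ge>N. R j k n" for j k
  proof -
    let ?C = "{c. c < x \<and> idx c \<le> j}"
    have "finite ?C"
    proof (rule inj_on_finite)
      show "inj_on idx ?C" using idx by (rule inj_on_subset) auto
      show "idx ` ?C \<subseteq> {..j}" by auto
    qed simp
    then have fin: "finite (Pow {..k} \<times> ?C)" by simp
    have "\<forall>\<^sub>F n in sequentially. (\<exists>d>c. large d (quot A E)) \<longrightarrow> large c (quot A (E \<union> {n}))"
      if E: "E \<subseteq> {..k}" for E c
    proof (cases "\<exists>d>c. large d (quot A E)")
      case True
      then obtain d N where "\<forall>n\<ge>N. large c (quot (quot A E) {n})" using large_quot by blast
      then have "large c (quot A (E \<union> {n}))" if "n \<ge> max N (Suc k)" for n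
        using that E by (subst quot_quot[symmetric]) auto
      then show ?thesis unfolding eventually_sequentially by blast
    next
      case False
      then show ?thesis by (intro always_eventually allI) blast
    qed
    then have "\<forall>\<^sub>F n in sequentially. \<forall>q\<in>Pow {..k} \<times> ?C.
        (\<exists>d>snd q. large d (quot A (fst q))) \<longrightarrow> large (snd q) (quot A (fst q \<union> {n}))"
      by (intro eventually_ball_finite[OF fin]) auto
    then obtain N where N: "\<And>n q. n \<ge> N \<Longrightarrow> q \<in> Pow {..k} \<times> ?C \<Longrightarrow>
        (\<exists>d>snd q. large d (quot A (fst q))) \<longrightarrow> large (snd q) (quot A (fst q \<union> {n}))"
      unfolding eventually_sequentially by blast
    have "R j k n" if "n \<ge> N" for n
      unfolding R_def
    proof (intro allI impI)
      fix E c assume "E \<subseteq> {..k}" "c < x" "idx c \<le> j" "\<exists>d>c. large d (quot A E)"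
      then show "large c (quot A (E \<union> {n}))" using N[OF that, of "(E, c)"] by simp
    qed
    then show ?thesis by blast
  qed
  have "\<exists>g. \<forall>j. (j = 0 \<longrightarrow> g j = 0) \<and> (g j < g (Suc j) \<and> R j (p (g j)) (p (g (Suc j))))"
  proof (rule dependent_nat_choice)
    fix k j :: nat
    obtain N where "\<forall>n\<ge>N. R j (p k) n" using R by blast
    moreover have "N \<le> p (max N (Suc k))" using seq_suble[OF p, of "max N (Suc k)"] by linarith
    ultimately show "\<exists>k'. (Suc j = 0 \<longrightarrow> k' = 0) \<and> k < k' \<and> R j (p k) (p k')"
      by (intro exI[of _ "max N (Suc k)"]) auto
  qed simp
  then obtain g where g: "g 0 = 0" "\<And>j. g j < g (Suc j)" "\<And>j. R j (p (g j)) (p (g (Suc j)))" by auto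
  then show ?thesis unfolding R_def by (intro exI[of _ g]) (simp add: strict_mono_Suc_iff)
qed

text \<open>Unlike membership in a Schreier family, this property of \<open>E\<close> passes to subsets. The function
  \<open>idx\<close> enumerates the ordinals below \<open>x\<close>; the bound on it leaves finitely many ordinals to be
  considered at each position.\<close>

inductive descending :: "cord \<Rightarrow> (cord \<Rightarrow> nat) \<Rightarrow> nat set \<Rightarrow> cord \<Rightarrow> bool" for x idx where
  single: "c < x \<Longrightarrow> idx c < j \<Longrightarrow> descending x idx {j} c"
| insert: "descending x idx E d \<Longrightarrow> c < d \<Longrightarrow> idx c < j \<Longrightarrow> \<forall>i\<in>E. i < j \<Longrightarrow>
    descending x idx (insert j E) c"

lemma descending_less: "descending x idx E c \<Longrightarrow> c < x"
  by (induction rule: descending.induct) auto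

text \<open>The remaining points keep their labels. If the last point is deleted, an earlier and
  hence larger label becomes the last one.\<close>

lemma descending_subset:
  "descending x idx E c \<Longrightarrow> E' \<subseteq> E \<Longrightarrow> E' \<noteq> {} \<Longrightarrow> \<exists>c'\<ge>c. descending x idx E' c'"
proof (induction arbitrary: E' rule: descending.induct)
  case (single c j)
  then have "E' = {j}" by auto
  then show ?case using descending.single[of c x idx j] single(1,2) by blast
next
  case (insert E d c j)
  show ?case
  proof (cases "j \<in> E'")
    case True
    show ?thesis
    proof (cases "E' - {j} = {}")
      case True
      then have "E' = {j}" using \<open>j \<in> E'\<close> by auto
      moreover have "c < x" using descending_less[OF insert.hyps(1)] insert.hyps(2) by simp
      ultimately show ?thesis using descending.single[of c x idx j] insert.hyps(3) by blast
    next
      case False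
      then obtain d' where d': "d' \<ge> d" "descending x idx (E' - {j}) d'"
        using insert.IH[of "E' - {j}"] insert.prems by blast
      have "descending x idx (insert j (E' - {j})) c"
        by (rule descending.insert[OF d'(2)]) (use d' insert in auto)
      then show ?thesis using \<open>j \<in> E'\<close> by (auto simp: insert_absorb)
    qed
  next
    case False
    then obtain d' where "d' \<ge> d" "descending x idx E' d'" using insert by blast
    then show ?thesis using insert.hyps(2) by (meson less_imp_le order_trans)
  qed
qed

text \<open>The last label bounds the rank that is left after all points. Avoidance is claimed only
  for segments strictly before a point: there the remaining rank is positive, while the final label
  may be 0.\<close>

lemma descending_large:
  assumes g: "strict_mono m" and A: "large x A"
    and sparse: "\<And>j E c. E \<subseteq> {..m j} \<Longrightarrow> c < x \<Longrightarrow> idx c \<le> j \<Longrightarrow> \<exists>d>c. large d (quot A E) \<Longrightarrow>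
      large c (quot A (E \<union> {m (Suc j)}))"
    and "descending x idx E c"
  shows "large c (quot A (m ` E)) \<and> (\<forall>j\<in>E. m ` {i \<in> E. i < j} \<notin> A)"
  using assms(4)
proof (induction rule: descending.induct)
  case (single c j)
  \<comment> \<open>\<open>idx c < j\<close> excludes \<open>j = 0\<close> and leaves
    \<open>idx c \<le> k\<close>, the bound under which the point after stage \<open>k\<close> was
    chosen.\<close>
  then obtain k where k: "j = Suc k" by (cases j) auto
  have "{} \<notin> A" using large_nonempty[OF A] single.hyps(1) le_less_trans[OF zero_le_cord] by blast
  moreover have "large c (quot A ({} \<union> {m (Suc k)}))"
    using single k A by (intro sparse) auto
  moreover have "m ` {i \<in> {j}. i < j} = {}" by auto
  ultimately show ?case using k by (simp del: Collect_conv_if image_is_empty)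
next
  case (insert E d c j)
  then obtain k where k: "j = Suc k" by (cases j) auto
  have "m ` E \<subseteq> {..m k}"
    using insert.hyps(4) strict_mono_mono[OF g] k by (auto simp: less_Suc_eq_le mono_def)
  moreover have "c < x" using descending_less[OF insert.hyps(1)] insert.hyps(2) by simp
  ultimately have "large c (quot A (m ` E \<union> {m (Suc k)}))"
    using insert k by (intro sparse) auto
  moreover have "m ` E \<notin> A"
    using insert.IH insert.hyps(2) large_nonempty[of d "quot A (m ` E)"] le_less_trans[OF zero_le_cord]
    by (auto simp: empty_in_quot)
  moreover have "{i \<in> insert j E. i < j} = E" "\<And>i. i \<in> E \<Longrightarrow> {i' \<in> insert j E. i' < i} = {i' \<in> E. i' < i}"
    using insert.hyps(4) by auto
  ultimately show ?case using insert.IH k by auto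
qed

section \<open>The lower bound for the index\<close>

lemma cuts_take_subset: "cuts (take n t) \<subseteq> cuts t"
  unfolding cuts_def by (auto simp: min_def split: if_splits)

lemma cuts_le: "k \<in> cuts t \<Longrightarrow> k \<le> length (concat t)"
proof -
  assume "k \<in> cuts t"
  then obtain i where k: "k = length (concat (take i t))" by (auto simp: cuts_def)
  have "concat t = concat (take i t) @ concat (drop i t)"
    by (metis append_take_drop_id concat_append)
  from arg_cong[OF this, of length] show ?thesis using k by simp
qed

lemma cuts_take:
  assumes "\<forall>x\<in>set t. x \<noteq> []" "1 \<le> n" "n < length t"
  shows "length (concat (take n t)) \<in> cuts t"
    "cuts (take n t) = {i \<in> cuts t. i < length (concat (take n t))}"
proof -
  show "length (concat (take n t)) \<in> cuts t" using assms(2,3) by (auto simp: cuts_def)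
  show "cuts (take n t) = {i \<in> cuts t. i < length (concat (take n t))}"
  proof (intro equalityI subsetI)
    fix k assume "k \<in> cuts (take n t)"
    then obtain i where i: "1 \<le> i" "i < n" "k = length (concat (take i t))"
      using assms(3) by (auto simp: cuts_def)
    then show "k \<in> {i \<in> cuts t. i < length (concat (take n t))}"
      using length_concat_take_less[OF assms(1), of i n] assms(3) by (auto simp: cuts_def)
  next
    fix k assume "k \<in> {i \<in> cuts t. i < length (concat (take n t))}"
    then obtain i where i: "1 \<le> i" "i < length t" "k = length (concat (take i t))"
      "k < length (concat (take n t))" by (auto simp: cuts_def)
    have "\<not> n \<le> i"
    proof
      assume "n \<le> i"
      then have "length (concat (take n t)) \<le> length (concat (take i t))"
        using length_concat_take_less[OF assms(1), of n i] i(2) by (cases "n = i") auto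
      then show False using i by simp
    qed
    then show "k \<in> cuts (take n t)"
      using i assms(3) unfolding cuts_def by (intro CollectI exI[of _ i]) auto
  qed
qed

section \<open>Cuts and the hereditary part of a tree\<close>

context alphabet
begin

lemma VRW_list_red_fin:
  assumes u: "vseq u" and t: "t \<in> lists (vwords S v)" and y: "y \<in> VRW_list S v (red_fin v u t)"
  shows "\<exists>t'\<in>lists (vwords S v). y = red_fin v u t' \<and> cuts t' \<subseteq> cuts t"
proof -
  have V: "kind (vwords S v)" by (simp add: kind_def)
  obtain r where r: "r \<in> lists (words A)" "length (concat r) = length t"
    "y = red_fin v ((!) (red_fin v u t)) r" "y \<in> lists (vwords S v)"
    using y by (auto simp: VRW_list_def)
  define t' where "t' = red_fin v ((!) t) r"
  \<comment> \<open>Padding with \<open>[v]\<close> gives an infinite sequence of variable words;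
    \<open>r\<close> has \<open>length t\<close> letters in all, so the padding does not change the
    reduction.\<close>
  define f where "f j = (if j < length t then t ! j else [v])" for j
  have "f j \<in> vwords S v" for j
    using t nth_mem[of j t] by (cases "j < length t") (auto simp: f_def vwords_iff[of "[v]"] words_A lists_eq_set)
  then have "vseq f" by (simp add: vseq_def)
  moreover have "t' = red_fin v f r" unfolding t'_def using r(2) by (intro red_fin_cong) (simp add: f_def)
  ultimately have "t' \<in> lists (words A)" using r(1) red_fin_lists_A by simp
  moreover have y': "y = red_fin v u t'" using r(2,3) by (simp add: red_fin_nth_red_fin t'_def)
  ultimately have "t' \<in> lists (vwords S v)" using red_fin_lists_kind[OF u V] r(4) by simp
  moreover have "cuts t' \<subseteq> cuts t"
    unfolding t'_def using r(1,2) by (intro cuts_red_fin_nth_subset) (auto simp: words_A lists_eq_set)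
  ultimately show ?thesis using y' by blast
qed

lemma angle_red_fin:
  assumes "t \<in> lists (vwords S v)" "z \<in> angle S v (red_fin v u t)"
  shows "\<exists>t'\<in>lists (words S). z = red_fin v u t' \<and> map length t' = map length t"
  using assms
proof (induction t arbitrary: z rule: rev_induct)
  case Nil
  then show ?case by (auto simp: angle_def intro!: bexI[of _ "[]"])
next
  case (snoc x t)
  from snoc.prems(2) obtain z' a where z: "z = z' @ [subst v a (block v u (length (concat t)) x)]"
    "z' \<in> angle S v (red_fin v u t)" "a \<in> S"
    by (auto simp: angle_def red_fin_snoc list_all2_append2 list_all2_Cons2)
  obtain t' where t': "t' \<in> lists (words S)" "z' = red_fin v u t'" "map length t' = map length t"
    using snoc.IH[OF _ z(2)] snoc.prems(1) by auto
  have len: "length (concat t') = length (concat t)" using t'(3) by (simp add: length_concat)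
  have "subst v a x \<in> words S"
    using snoc.prems(1) z(3) by (intro subst_in_words) (auto simp: vwords_iff)
  then show ?case using t' z len
    by (intro bexI[of _ "t' @ [subst v a x]"]) (auto simp: red_fin_snoc subst_block)
qed

text \<open>Turning the first letter of each word into the variable keeps the cuts, and substituting
  that letter back restores the word. This supplies the variable sequence demanded by
  \<open>hered_words\<close>.\<close>

lemma angle_self:
  assumes "t \<in> lists (words S)"
  shows "red_fin v u t \<in> angle S v (red_fin v u (map (\<lambda>x. v # tl x) t))"
  using assms
proof (induction t rule: rev_induct)
  case (snoc x t)
  then obtain a y where x: "x = a # y" "a \<in> S" "set y \<subseteq> S"
    by (cases x) (auto simp: words_def)
  have "subst v a y = y" using x(3) v_notin_S by (auto simp: subst_def intro!: map_idI)
  then have "x = subst v a (v # y)" using x by (simp add: subst_def)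
  then have "block v u k x = subst v a (block v u k (v # y))" for k by (simp add: subst_block)
  moreover have "length (concat (map (\<lambda>x. v # tl x) t)) = length (concat t)"
    using snoc.prems by (induction t) (auto simp: words_def)
  ultimately show ?case using snoc x
    by (auto simp: red_fin_snoc angle_def intro!: list_all2_appendI)
qed (simp add: angle_def)

text \<open>Initial segments and variable reductions only delete cuts, so a condition on cuts that
  passes to subsets leads into the hereditary part. For words the same works, since substitutions
  preserve lengths.\<close>

lemma hered_vwords_mem:
  assumes u: "vseq u"
    and T: "\<And>t. t \<in> lists (vwords S v) \<Longrightarrow> ok (cuts t) \<Longrightarrow> red_fin v u t \<in> T"
    and ok: "\<And>E E'. ok E \<Longrightarrow> E' \<subseteq> E \<Longrightarrow> ok E'"
    and t: "t \<in> lists (vwords S v)" "ok (cuts t)"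
  shows "red_fin v u t \<in> hered_vwords S v T"
proof (cases "t = []")
  case False
  have "VRW_list S v t1 \<subseteq> T" if t1: "prefix t1 (red_fin v u t)" for t1
  proof
    fix y assume y: "y \<in> VRW_list S v t1"
    obtain n where n: "t1 = red_fin v u (take n t)" using t1 by (metis prefix_def append_eq_conv_conj take_red_fin)
    have "take n t \<in> lists (vwords S v)" using t(1) by (auto simp: lists_eq_set dest: in_set_takeD)
    then obtain t' where "t' \<in> lists (vwords S v)" "y = red_fin v u t'" "cuts t' \<subseteq> cuts (take n t)"
      using VRW_list_red_fin[OF u] y n by blast
    then show "y \<in> T" using T ok[OF t(2)] cuts_take_subset by (metis order_trans)
  qed
  then show ?thesis using False T[OF t] by (simp add: hered_vwords_def)
qed (simp add: hered_vwords_def)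

lemma hered_words_mem:
  assumes u: "vseq u"
    and T: "\<And>t. t \<in> lists (words S) \<Longrightarrow> ok (cuts t) \<Longrightarrow> red_fin v u t \<in> T"
    and ok: "\<And>E E'. ok E \<Longrightarrow> E' \<subseteq> E \<Longrightarrow> ok E'"
    and t: "t \<in> lists (words S)" "ok (cuts t)"
  shows "red_fin v u t \<in> hered_words S v T"
proof (cases "t = []")
  case False
  have V: "kind (vwords S v)" by (simp add: kind_def)
  have ang: "angle S v (red_fin v u r) \<subseteq> T" if r: "r \<in> lists (vwords S v)" "ok (cuts r)" for r
  proof
    fix z assume "z \<in> angle S v (red_fin v u r)"
    then obtain r' where "r' \<in> lists (words S)" "z = red_fin v u r'" "map length r' = map length r"
      using angle_red_fin[OF r(1)] by blast
    then show "z \<in> T" using T r(2) cuts_map_length by metis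
  qed
  define r where "r = map (\<lambda>x. v # tl x) t"
  have "v # tl x \<in> vwords S v" if "x \<in> words S" for x
    using that by (cases x) (auto simp: vwords_iff words_A words_def)
  then have rV: "r \<in> lists (vwords S v)" using t(1) unfolding r_def by (auto simp: lists_eq_set)
  have "map length r = map length t" using t(1) by (auto simp: r_def words_def)
  then have okr: "ok (cuts r)" using t(2) cuts_map_length by metis
  have "red_fin v u r \<in> lists (vwords S v)"
    using red_fin_lists_kind[OF u V] kind_lists[OF V rV] rV by simp
  moreover have "angle S v y \<subseteq> T" if t1: "prefix t1 (red_fin v u r)" "y \<in> VRW_list S v t1" for t1 y
  proof -
    obtain n where n: "t1 = red_fin v u (take n r)" using t1 by (metis prefix_def append_eq_conv_conj take_red_fin)
    have "take n r \<in> lists (vwords S v)" using rV by (auto simp: lists_eq_set dest: in_set_takeD)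
    then obtain t' where "t' \<in> lists (vwords S v)" "y = red_fin v u t'" "cuts t' \<subseteq> cuts (take n r)"
      using VRW_list_red_fin[OF u] t1(2) n by blast
    then show ?thesis using ang ok[OF okr] cuts_take_subset by (metis order_trans)
  qed
  moreover have "red_fin v u r \<noteq> []" using False by (simp add: r_def)
  moreover have "red_fin v u t \<in> angle S v (red_fin v u r)" unfolding r_def by (rule angle_self[OF t(1)])
  ultimately show ?thesis using T[OF t] ang[OF rV okr] unfolding hered_words_def by blast
qed (simp add: hered_words_def)

lemma admissible_tail:
  assumes "admissible K pr her" "vseq u" "y \<in> K" "pr (block v u 0 x) (block v u 0 y)"
  shows "\<exists>z\<in>K. y = x @ z"
proof -
  have sp: "strict_prefix (block v u 0 x) (block v u 0 y)" using admissible_strict_prefix assms by blast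
  then have "prefix x y"
    using prefix_block_imp_prefix[OF assms(2), of 0 x y] by (simp add: strict_prefix_def)
  then obtain z where z: "y = x @ z" by (auto simp: prefix_def)
  then have "z \<noteq> []" using sp by auto
  then have zA: "z \<in> words A" using kind_words[OF admissible_kind[OF assms(1)] assms(3)] z by (auto simp: words_A)
  from assms(1) consider "K = words S" | "K = vwords S v" "pr = propto_var S v" by (auto simp: admissible_def)
  then have "z \<in> K"
  proof cases
    case 1
    then show ?thesis using assms(3) z zA by (auto simp: words_S)
  next
    case 2
    then have "block v u (length x) z \<in> vwords S v"
      using assms(4) z by (simp add: propto_var_def block_append)
    then show ?thesis using block_kind[OF assms(2) _ zA] 2 by (simp add: kind_def)
  qed
  then show ?thesis using z by blast
qed

lemma admissible_hered_mem:
  assumes "admissible K pr her" "vseq u"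
    and "\<And>t. t \<in> lists K \<Longrightarrow> ok (cuts t) \<Longrightarrow> red_fin v u t \<in> T"
    and "\<And>E E'. ok E \<Longrightarrow> E' \<subseteq> E \<Longrightarrow> ok E'"
    and "t \<in> lists K" "ok (cuts t)"
  shows "red_fin v u t \<in> her T"
  using assms(1) hered_words_mem[of u ok T t] hered_vwords_mem[of u ok T t] assms(2-)
  unfolding admissible_def by metis

text \<open>Exceptional continuations come from patterns shorter than \<open>N\<close> and so have
  bounded length, whereas the lengths along an infinite chain of strict prefixes are
  unbounded.\<close>

lemma cb_deriv_mem:
  assumes "admissible K pr her" "vseq u" "t \<in> lists K" "red_fin v u t \<in> P"
    and P: "\<And>x. x \<in> K \<Longrightarrow> N \<le> length x \<Longrightarrow> red_fin v u (t @ [x]) \<in> P"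
  shows "red_fin v u t \<in> cb_deriv pr (reds K u) {x. [x] \<in> reds K u} P"
proof -
  have False if f: "\<forall>n. f n \<in> cb_A pr {x. [x] \<in> reds K u} P (red_fin v u t) \<and> pr (f n) (f (Suc n))" for f
  proof -
    have "\<exists>z\<in>K. f n = block v u 0 (concat t @ z) \<and> length z < N" for n
    proof -
      have fn: "[f n] \<in> reds K u" "pr (block v u 0 (concat t)) (f n)"
        "red_fin v u t @ [drop (length (block v u 0 (concat t))) (f n)] \<notin> P"
        using f by (auto simp: cb_A_def concat_red_fin)
      then obtain y where y: "y \<in> K" "f n = block v u 0 y" by (auto simp: single_reds)
      then obtain z where z: "z \<in> K" "y = concat t @ z" using admissible_tail[OF assms(1,2) y(1), of "concat t"] fn(2) by auto
      have "red_fin v u t @ [drop (length (block v u 0 (concat t))) (f n)] = red_fin v u (t @ [z])"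
        by (simp add: y z(2) block_append red_fin_snoc)
      then show ?thesis using P[OF z(1)] fn(3) y z by (metis not_less)
    qed
    then have bound: "length (f n) \<le> start u (length (concat t) + N)" for n
      using start_mono[of _ "length (concat t) + N" u] by (metis length_block_0 length_append add_left_mono less_imp_le)
    have "n \<le> length (f n)" for n
    proof (induction n)
      case (Suc n)
      have "strict_prefix (f n) (f (Suc n))" using f admissible_strict_prefix[OF assms(1)] by blast
      then show ?case using Suc prefix_length_less by fastforce
    qed simp
    from this[of "Suc (start u (length (concat t) + N))"] bound show False by (meson not_less_eq_eq order_trans)
  qed
  moreover have "red_fin v u t \<in> reds K u" using assms(3) by (simp add: reds_def)
  ultimately show ?thesis using assms(4) unfolding cb_deriv_def by blast
qed

theorem derivs_lower_bound:
  assumes adm: "admissible K pr her" and w: "vseq w" and uw: "variable_reduction S v u w"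
    and fs: "ladder_system fs"
    and T: "\<And>t n. t \<in> T \<Longrightarrow> take n t \<in> T"
    and hit: "\<And>t. \<forall>i. t i \<in> K \<Longrightarrow> \<exists>n\<ge>1. map (red_inf v u t) [0..<n] \<in> T \<and>
      schreier fs x (dset (map (red_inf v u t) [0..<n]))"
  shows "\<exists>u'. variable_reduction S v u' w \<and> (\<forall>b<x. derivs K pr u' (her T \<inter> reds K w) b \<noteq> {})"
proof -
  have K: "kind K" using adm by (rule admissible_kind)
  have u: "vseq u" using variable_reduction_vseq[OF w uw] .
  let ?Sch = "{s. schreier fs x s}"
  \<comment> \<open>The element that a cut just before the term \<open>u i\<close> contributes to
    \<open>dset\<close>, counted from 1.\<close>
  define p where "p i = start u i + 1" for i
  have p: "strict_mono p"
    using vseq_in(3)[OF u] by (simp add: strict_mono_Suc_iff p_def)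
  define idx where "idx = to_nat_on {..<x}"
  have idx: "inj_on idx {..<x}" unfolding idx_def by (rule inj_on_to_nat_on[OF countable_lessThan_cord])
  from sparse_exists[OF p idx, of ?Sch] obtain g where g: "strict_mono g" "g 0 = 0" and
    sparse_all: "\<forall>j. \<forall>E\<subseteq>{..p (g j)}. \<forall>c<x. idx c \<le> j \<longrightarrow> (\<exists>d>c. large d (quot ?Sch E)) \<longrightarrow>
      large c (quot ?Sch (E \<union> {p (g (Suc j))}))"
    by (elim exE conjE)
  note sparse = sparse_all[rule_format]
  \<comment> \<open>Words made of the variable alone merge consecutive terms of \<open>u\<close>
    without substituting anything; the reduction by \<open>r\<close> merely restricts the possible
    cuts to the positions \<open>p (g j)\<close>.\<close>
  define r where "r j = replicate (g (Suc j) - g j) v" for j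
  have gS: "g j < g (Suc j)" for j using g(1) by (simp add: strict_mono_Suc_iff)
  have "r j \<in> vwords S v" for j using gS[of j] by (auto simp: r_def vwords_iff words_A)
  then have r: "vseq r" by (simp add: vseq_def)
  have start_r: "start r j = g j" for j
    by (induction j) (use gS g(2) in \<open>auto simp: r_def less_imp_le\<close>)
  define u' where "u' = red_inf v u r"
  have u'u: "variable_reduction S v u' u" unfolding u'_def variable_reduction_iff using r by blast
  then have u'w: "variable_reduction S v u' w" using uw variable_reduction_trans by blast
  have u': "vseq u'" using variable_reduction_vseq[OF w u'w] .
  define m where "m j = p (g j)" for j
  have dset_m: "dset (red_fin v u' t) = m ` cuts t" for t
    by (simp add: dset_red_fin u'_def start_red_inf start_r m_def p_def)
  have m: "strict_mono m" using p g(1) by (simp add: m_def strict_mono_def)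
  define ok where "ok E \<longleftrightarrow> E = {} \<or> (\<exists>c. descending x idx E c)" for E
  have ok_sub: "ok E'" if "ok E" "E' \<subseteq> E" for E E'
    using that descending_subset unfolding ok_def by blast
  have avoid: "m ` {i \<in> E. i < j} \<notin> ?Sch" if "descending x idx E c" "j \<in> E" for E c j
    using descending_large[OF m large_schreier[OF fs] _ that(1)] sparse that(2) unfolding m_def by blast
  obtain a where a: "\<And>n. replicate (Suc n) a \<in> K" using kind_replicate[OF K] by blast
  have in_T: "red_fin v u' t \<in> T" if t: "t \<in> lists K" "ok (cuts t)" for t
  proof -
    \<comment> \<open>\<open>hit\<close> needs an infinite sequence, hence the padding. The segment
      it yields either covers \<open>t\<close>, or is a proper initial segment of \<open>t\<close>
      whose cuts are in \<A>_x, which \<open>avoid\<close> excludes.\<close>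
    define f where "f i = (if i < length t then t ! i else [a])" for i
    have fK: "\<forall>i. f i \<in> K" using t(1) a[of 0] by (auto simp: f_def lists_eq_set)
    have "\<forall>i. red_inf v r f i \<in> K"
      using fK block_kind[OF r K kind_words[OF K]] by (simp add: red_inf_def)
    then obtain n where n: "n \<ge> 1" "map (red_inf v u (red_inf v r f)) [0..<n] \<in> T"
      "schreier fs x (dset (map (red_inf v u (red_inf v r f)) [0..<n]))" using hit by blast
    have eq: "map (red_inf v u (red_inf v r f)) [0..<n] = red_fin v u' (map f [0..<n])"
      by (simp only: u'_def red_inf_red_inf[symmetric] red_inf_map_prefix)
    show ?thesis
    proof (cases "length t \<le> n")
      case True
      have "take (length t) (map f [0..<n]) = t"
        by (rule nth_equalityI) (use True in \<open>auto simp: f_def\<close>)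
      then show ?thesis using T[OF n(2), of "length t"] unfolding eq take_red_fin by simp
    next
      case False
      have ft: "map f [0..<n] = take n t"
        by (rule nth_equalityI) (use False in \<open>auto simp: f_def\<close>)
      have ne: "\<forall>x\<in>set t. x \<noteq> []" using t(1) kind_nonempty[OF K] by (auto simp: lists_eq_set)
      let ?j = "length (concat (take n t))"
      have j: "?j \<in> cuts t" "cuts (take n t) = {i \<in> cuts t. i < ?j}"
        using cuts_take[OF ne n(1)] False by simp_all
      then obtain c where "descending x idx (cuts t) c" using t(2) unfolding ok_def by blast
      then have "m ` {i \<in> cuts t. i < ?j} \<notin> ?Sch" using avoid j(1) by blast
      moreover have "schreier fs x (m ` {i \<in> cuts t. i < ?j})"
        using n(3) unfolding eq ft dset_m j(2) .
      ultimately show ?thesis by blast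
    qed
  qed
  let ?H = "her T \<inter> reds K w"
  have in_H: "red_fin v u' t \<in> ?H" if "t \<in> lists K" "ok (cuts t)" for t
  proof
    show "red_fin v u' t \<in> her T"
      by (rule admissible_hered_mem[where ok = ok, OF adm u' in_T ok_sub that])
    show "red_fin v u' t \<in> reds K w" using reds_mono[OF u'w K] that(1) by (auto simp: reds_def)
  qed
  \<comment> \<open>The end of \<open>t\<close> is labelled along with its cuts, because it becomes
    a cut once another word follows; its label bounds the rank at \<open>t\<close> from
    below.\<close>
  have rank: "red_fin v u' t \<in> derivs K pr u' ?H b"
    if "t \<in> lists K" "t \<noteq> []" "descending x idx (insert (length (concat t)) (cuts t)) c" "b \<le> c" for t b c
    using that
  proof (induction b arbitrary: t c rule: less_induct)
    case (less b)
    have snoc: "cuts (t @ [y]) = insert (length (concat t)) (cuts t)" for y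
      using less.prems(2) by (rule cuts_snoc)
    have ok1: "ok (insert (length (concat t)) (cuts t))" using less.prems(3) by (auto simp: ok_def)
    then have ok2: "ok (cuts t)" by (rule ok_sub) auto
    show ?case
    proof (cases b rule: cord_cases)
      case zero
      have "red_fin v u' t \<in> cb_deriv pr (reds K u') {x. [x] \<in> reds K u'} ?H"
      proof (rule cb_deriv_mem[OF adm u' less.prems(1), where N = 0])
        show "red_fin v u' t \<in> ?H" using less.prems(1) ok2 by (rule in_H)
        show "red_fin v u' (t @ [y]) \<in> ?H" if "y \<in> K" for y
          by (rule in_H) (use that less.prems(1) ok1 snoc in simp_all)
      qed
      then show ?thesis using zero by simp
    next
      case (osuc d)
      then have d: "d < b" "d < c" using less.prems(4) by (simp_all add: osuc_le_iff)
      \<comment> \<open>After a next word longer than \<open>idx d\<close> the new end may carry the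
        label \<open>d\<close>; shorter words are covered by the tolerance of
        \<open>cb_deriv_mem\<close>.\<close>
      have "red_fin v u' t \<in> cb_deriv pr (reds K u') {x. [x] \<in> reds K u'} (derivs K pr u' ?H d)"
      proof (rule cb_deriv_mem[OF adm u' less.prems(1), where N = "Suc (idx d)"])
        show "red_fin v u' t \<in> derivs K pr u' ?H d"
          using less.IH[OF d(1) less.prems(1-3)] d(2) by simp
        fix y assume y: "y \<in> K" "Suc (idx d) \<le> length y"
        have "descending x idx (insert (length (concat (t @ [y]))) (cuts (t @ [y]))) d"
          unfolding snoc
        proof (rule descending.insert[OF less.prems(3) d(2)])
          show "idx d < length (concat (t @ [y]))" using y(2) by simp
          show "\<forall>i\<in>insert (length (concat t)) (cuts t). i < length (concat (t @ [y]))"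
            using cuts_le[of _ t] y(2) by fastforce
        qed
        then show "red_fin v u' (t @ [y]) \<in> derivs K pr u' ?H d"
          by (intro less.IH[OF d(1)]) (use less.prems(1) y(1) in auto)
      qed
      then show ?thesis using osuc by simp
    next
      case limit
      have "red_fin v u' t \<in> derivs K pr u' ?H d" if "d < b" for d
        using less.IH[OF that less.prems(1-3)] that less.prems(4) by simp
      then show ?thesis using limit by (simp add: cb_iter_limit)
    qed
  qed
  have "derivs K pr u' ?H b \<noteq> {}" if b: "b < x" for b
  proof -
    \<comment> \<open>The shortest constant word whose end may carry the label
      \<open>b\<close>.\<close>
    let ?t = "[replicate (Suc (idx b)) a]"
    have "descending x idx (insert (length (concat ?t)) (cuts ?t)) b"
      using descending.single[of b x idx "Suc (idx b)"] b by simp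
    then have "red_fin v u' ?t \<in> derivs K pr u' ?H b"
      using rank[of ?t b b] a[of "idx b"] by simp
    then show ?thesis by blast
  qed
  then show ?thesis using u'w by blast
qed

end

section \<open>Pointwise closed families\<close>

definition word_block :: "nat \<Rightarrow> 'a list \<Rightarrow> (nat \<times> 'a) set" where
  "word_block k x = {(k + 1 + j, x ! j) | j. j < length x}"

lemma blocks_Nil [simp]: "blocks [] = {}"
  by (simp add: blocks_def)

lemma blocks_eq: "blocks s = (\<lambda>i. word_block (length (concat (take i s))) (s ! i)) ` {..<length s}"
proof -
  have "blocks s = (\<lambda>i. word_block (start ((!) s) i) (s ! i)) ` {i. i < length s}"
    by (simp only: blocks_def word_block_def setcompr_eq_image)
  also have "\<dots> = (\<lambda>i. word_block (length (concat (take i s))) (s ! i)) ` {..<length s}"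
    by (rule image_cong) (auto simp: start_nth)
  finally show ?thesis .
qed

lemma blocks_snoc: "blocks (s @ [x]) = insert (word_block (length (concat s)) x) (blocks s)"
proof -
  have "blocks (s @ [x]) = (\<lambda>i. word_block (length (concat (take i (s @ [x])))) ((s @ [x]) ! i)) ` insert (length s) {..<length s}"
    by (simp add: blocks_eq lessThan_Suc)
  also have "\<dots> = insert (word_block (length (concat s)) x)
      ((\<lambda>i. word_block (length (concat (take i (s @ [x])))) ((s @ [x]) ! i)) ` {..<length s})"
    by simp
  also have "(\<lambda>i. word_block (length (concat (take i (s @ [x])))) ((s @ [x]) ! i)) ` {..<length s} = blocks s"
    unfolding blocks_eq by (rule image_cong) (simp_all add: nth_append)
  finally show ?thesis .
qed

lemma word_block_inject:
  assumes "word_block k x = word_block l y" "x \<noteq> []" "y \<noteq> []"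
  shows "k = l \<and> x = y"
proof -
  have mem: "(i, a) \<in> word_block k' z \<longleftrightarrow> k' < i \<and> i - k' - 1 < length z \<and> a = z ! (i - k' - 1)" for i a k' and z :: "'a list"
  proof
    assume "k' < i \<and> i - k' - 1 < length z \<and> a = z ! (i - k' - 1)"
    then show "(i, a) \<in> word_block k' z"
      unfolding word_block_def by (intro CollectI exI[of _ "i - k' - 1"]) auto
  qed (auto simp: word_block_def)
  have "(k + 1, x ! 0) \<in> word_block k x" "(l + 1, y ! 0) \<in> word_block l y"
    using assms(2,3) by (simp_all add: mem)
  then have "(k + 1, x ! 0) \<in> word_block l y" "(l + 1, y ! 0) \<in> word_block k x" using assms(1) by simp_all
  then have kl: "k = l" unfolding mem by linarith
  have "j < length x \<longleftrightarrow> j < length y" "j < length x \<Longrightarrow> x ! j = y ! j" for j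
    using assms(1) mem[of "k + 1 + j" _ k x] mem[of "k + 1 + j" _ k y] kl by auto
  then have "x = y" by (intro nth_equalityI) (metis linorder_neqE_nat less_irrefl, blast)
  then show ?thesis using kl by blast
qed

text \<open>Blocks carry absolute positions, so the block that starts where \<open>s\<close> ends
  can occur in \<open>t\<close> only as its next term.\<close>

lemma blocks_subset_imp_prefix:
  assumes "\<forall>x\<in>set s. x \<noteq> []" "\<forall>x\<in>set t. x \<noteq> []" "blocks s \<subseteq> blocks t"
  shows "prefix s t"
  using assms(1,3)
proof (induction s rule: rev_induct)
  case (snoc x s)
  then have "prefix s t" by (simp add: blocks_snoc)
  then obtain r where t: "t = s @ r" by (auto simp: prefix_def)
  have "word_block (length (concat s)) x \<in> blocks t" using snoc.prems by (simp add: blocks_snoc)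
  then obtain i where i: "i < length t" "word_block (length (concat s)) x = word_block (length (concat (take i t))) (t ! i)"
    by (auto simp: blocks_eq)
  then have eq: "length (concat s) = length (concat (take i t))" "x = t ! i"
    using word_block_inject[OF i(2)] snoc.prems(1) assms(2) by simp_all
  have "take (length s) t = s" using t by simp
  then have "i = length s"
    using length_concat_take_less[OF assms(2), of i "length s"]
      length_concat_take_less[OF assms(2), of "length s" i] eq(1) i(1) t
    by (metis length_append le_add1 less_imp_le less_irrefl linorder_neqE_nat)
  then show ?case using eq(2) i(1) t by (cases r) auto
qed simp

lemma blocks_restrict:
  assumes "\<forall>x\<in>set s. x \<noteq> []"
  shows "\<exists>n. blocks (take n s) = {B \<in> blocks s. fst ` B \<subseteq> {..N}}"
  using assms
proof (induction s rule: rev_induct)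
  case (snoc x s)
  have le: "fst ` B \<subseteq> {..length (concat s)}" if B: "B \<in> blocks s" for B
  proof -
    obtain i where i: "i < length s" "B = word_block (length (concat (take i s))) (s ! i)"
      using B by (auto simp: blocks_eq)
    have "length (concat (take i s)) + length (s ! i) \<le> length (concat s)"
    proof -
      have "s = take (Suc i) s @ drop (Suc i) s" by simp
      then have "concat s = concat (take (Suc i) s) @ concat (drop (Suc i) s)" by (metis concat_append)
      from arg_cong[OF this, of length] show ?thesis using i(1) by (simp add: take_Suc_conv_app_nth)
    qed
    then show ?thesis using i(2) by (auto simp: word_block_def)
  qed
  show ?case
  proof (cases "length (concat (s @ [x])) \<le> N")
    case True
    have "fst ` B \<subseteq> {..N}" if "B \<in> blocks (s @ [x])" for B
    proof (cases "B \<in> blocks s")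
      case True
      then have "fst ` B \<subseteq> {..length (concat s)}" by (rule le)
      also have "\<dots> \<subseteq> {..N}" using \<open>length (concat (s @ [x])) \<le> N\<close> by auto
      finally show ?thesis .
    next
      case False
      then show ?thesis using that \<open>length (concat (s @ [x])) \<le> N\<close>
        by (auto simp: blocks_snoc word_block_def)
    qed
    then have "blocks (take (length (s @ [x])) (s @ [x])) = {B \<in> blocks (s @ [x]). fst ` B \<subseteq> {..N}}" by auto
    then show ?thesis ..
  next
    case False
    obtain n where n: "blocks (take n s) = {B \<in> blocks s. fst ` B \<subseteq> {..N}}" using snoc by auto
    have "x \<noteq> []" using snoc.prems by simp
    then have "(length (concat s) + length x, last x) \<in> word_block (length (concat s)) x"
      unfolding word_block_def by (intro CollectI exI[of _ "length x - 1"]) (auto simp: last_conv_nth Suc_le_eq)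
    then have "\<not> fst ` word_block (length (concat s)) x \<subseteq> {..N}" using False by force
    then have "{B \<in> blocks (s @ [x]). fst ` B \<subseteq> {..N}} = {B \<in> blocks s. fst ` B \<subseteq> {..N}}"
      by (auto simp: blocks_snoc)
    also have "\<dots> = blocks (take (min n (length s)) (s @ [x]))"
      using n by (cases "n \<le> length s") simp_all
    finally show ?thesis by metis
  qed
qed simp

lemma blocks_mono: "prefix s t \<Longrightarrow> blocks s \<subseteq> blocks t"
proof -
  have "blocks s \<subseteq> blocks (s @ r)" for r
    by (induction r rule: rev_induct) (auto simp: blocks_snoc simp flip: append_assoc)
  then show "prefix s t \<Longrightarrow> blocks s \<subseteq> blocks t" by (auto simp: prefix_def)
qed

text \<open>Basic open sets of a product of discrete spaces prescribe finitely many
  coordinates.\<close>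

lemma pointwise_closed_iff:
  "pointwise_closed S v H \<longleftrightarrow> (\<forall>h\<in>extensional (Fpow (Dset S v)).
     (\<forall>J\<subseteq>Fpow (Dset S v). finite J \<longrightarrow> (\<exists>s\<in>H. \<forall>B\<in>J. h B \<longleftrightarrow> B \<in> blocks s)) \<longrightarrow> h \<in> char_fun S v ` H)"
    (is "_ \<longleftrightarrow> ?R")
proof -
  let ?I = "Fpow (Dset S v)"
  let ?X = "product_topology (\<lambda>_. discrete_topology (UNIV :: bool set)) ?I"
  have top: "topspace ?X = extensional ?I" by (simp add: PiE_UNIV_domain PiE_def)
  have ext: "char_fun S v s \<in> extensional ?I" for s by (simp add: char_fun_def)
  have cf: "char_fun S v s B \<longleftrightarrow> B \<in> blocks s" if "B \<in> ?I" for s B using that by (simp add: char_fun_def)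
  have "pointwise_closed S v H \<longleftrightarrow> openin ?X (extensional ?I - char_fun S v ` H)"
    unfolding pointwise_closed_def closedin_def top using ext by blast
  also have "\<dots> \<longleftrightarrow> ?R"
  proof
    assume op: "openin ?X (extensional ?I - char_fun S v ` H)"
    show ?R
    proof (intro ballI impI, rule ccontr)
      fix h assume h: "h \<in> extensional ?I" "h \<notin> char_fun S v ` H"
        and agree: "\<forall>J\<subseteq>?I. finite J \<longrightarrow> (\<exists>s\<in>H. \<forall>B\<in>J. h B \<longleftrightarrow> B \<in> blocks s)"
      then have "h \<in> extensional ?I - char_fun S v ` H" by blast
      from op[unfolded openin_product_topology_alt, THEN bspec, OF this]
      obtain U where U: "finite {B \<in> ?I. U B \<noteq> UNIV}" "h \<in> Pi\<^sub>E ?I U"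
        "Pi\<^sub>E ?I U \<subseteq> extensional ?I - char_fun S v ` H"
        unfolding topspace_discrete_topology by (elim exE conjE)
      obtain s where s: "s \<in> H" "\<forall>B\<in>{B \<in> ?I. U B \<noteq> UNIV}. h B \<longleftrightarrow> B \<in> blocks s"
        using agree U(1) by (metis (no_types, lifting) mem_Collect_eq subsetI)
      have "char_fun S v s \<in> Pi\<^sub>E ?I U"
      proof (rule PiE_I)
        fix B assume B: "B \<in> ?I"
        show "char_fun S v s B \<in> U B"
        proof (cases "U B = UNIV")
          case False
          then have "char_fun S v s B = h B" using s(2) B by (simp add: cf)
          then show ?thesis using U(2) B by (auto simp: PiE_def)
        qed simp
      qed (use ext[of s] in \<open>auto simp: extensional_def\<close>)
      then show False using U(3) s(1) by blast
    qed
  next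
    assume R: ?R
    show "openin ?X (extensional ?I - char_fun S v ` H)"
      unfolding openin_product_topology_alt
    proof
      fix h assume h: "h \<in> extensional ?I - char_fun S v ` H"
      then have "\<not> (\<forall>J\<subseteq>?I. finite J \<longrightarrow> (\<exists>s\<in>H. \<forall>B\<in>J. h B \<longleftrightarrow> B \<in> blocks s))"
        using bspec[OF R, of h] by (elim DiffE) (metis (no_types))
      then obtain J where J: "J \<subseteq> ?I" "finite J" "\<not> (\<exists>s\<in>H. \<forall>B\<in>J. h B \<longleftrightarrow> B \<in> blocks s)"
        unfolding not_all not_imp by (elim exE conjE)
      define U where "U B = (if B \<in> J then {h B} else UNIV)" for B
      have "finite {B \<in> ?I. U B \<noteq> topspace (discrete_topology UNIV)}"
        by (rule finite_subset[OF _ J(2)]) (auto simp: U_def)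
      moreover have "h \<in> Pi\<^sub>E ?I U" using h by (auto simp: PiE_def U_def)
      moreover have "Pi\<^sub>E ?I U \<subseteq> extensional ?I - char_fun S v ` H"
      proof
        fix k assume k: "k \<in> Pi\<^sub>E ?I U"
        have "k \<notin> char_fun S v ` H"
        proof
          assume "k \<in> char_fun S v ` H"
          then obtain s where s: "s \<in> H" "k = char_fun S v s" by blast
          have "h B \<longleftrightarrow> B \<in> blocks s" if "B \<in> J" for B
          proof -
            have B: "B \<in> ?I" using J(1) that by blast
            then have "k B \<in> U B" using k by (auto simp: PiE_def)
            then show ?thesis using that cf[OF B, of s] s(2) by (simp add: U_def)
          qed
          then show False using J(3) s(1) by blast
        qed
        then show "k \<in> extensional ?I - char_fun S v ` H" using k by (auto simp: PiE_def)
      qed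
      ultimately show "\<exists>U. finite {B \<in> ?I. U B \<noteq> topspace (discrete_topology UNIV)} \<and>
          (\<forall>i\<in>?I. openin (discrete_topology UNIV) (U i)) \<and> h \<in> Pi\<^sub>E ?I U \<and>
          Pi\<^sub>E ?I U \<subseteq> extensional ?I - char_fun S v ` H"
        by (intro exI[of _ U]) simp
    qed
  qed
  finally show ?thesis .
qed

context alphabet
begin

lemma blocks_Fpow:
  assumes "s \<in> lists (words A)"
  shows "blocks s \<subseteq> Fpow (Dset S v)"
proof
  fix B assume "B \<in> blocks s"
  then obtain i where i: "i < length s" "B = word_block (length (concat (take i s))) (s ! i)"
    by (auto simp: blocks_eq)
  have "s ! i \<in> words A" using assms i(1) by (auto simp: lists_eq_set)
  then have "set (s ! i) \<subseteq> A" by (simp add: words_A)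
  then have "B \<subseteq> Dset S v" unfolding i(2) word_block_def Dset_def using nth_mem by fastforce
  moreover have "finite B" unfolding i(2) word_block_def by simp
  ultimately show "B \<in> Fpow (Dset S v)" by (simp add: Fpow_def)
qed

lemma lists_words_nonempty: "s \<in> lists (words A) \<Longrightarrow> \<forall>x\<in>set s. x \<noteq> []"
  by (auto simp: lists_eq_set words_A)

text \<open>Along a branch the characteristic functions converge to that of the union of all blocks,
  which would force arbitrarily long segments of the branch to be prefixes of one finite
  sequence.\<close>

lemma pointwise_closed_not_branching:
  assumes H: "H \<subseteq> lists (words A)" and closed: "pointwise_closed S v H"
  shows "\<not> branching H"
proof
  assume "branching H"
  then obtain s f where sf: "\<And>n. s @ map f [0..<n] \<in> H" unfolding branching_def by blast
  let ?X = "\<lambda>n. s @ map f [0..<n]"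
  define C where "C = (\<Union>n. blocks (?X n))"
  have mono: "blocks (?X m) \<subseteq> blocks (?X n)" if "m \<le> n" for m n
  proof -
    have "map f [0..<n] = map f [0..<m] @ map f [m..<n]"
      using that by (metis le_Suc_ex map_append upt_add_eq_append zero_le)
    then show ?thesis by (intro blocks_mono) simp
  qed
  let ?h = "restrict (\<lambda>B. B \<in> C) (Fpow (Dset S v))"
  have "\<exists>t\<in>H. \<forall>B\<in>J. ?h B \<longleftrightarrow> B \<in> blocks t" if J: "J \<subseteq> Fpow (Dset S v)" "finite J" for J
  proof -
    have "\<exists>n. J \<inter> C \<subseteq> blocks (?X n)"
    proof -
      have "finite (J \<inter> C)" using J by simp
      then show ?thesis
      proof (rule finite_subset_Union_chain[of _ "range (\<lambda>n. blocks (?X n))"])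
        show "J \<inter> C \<subseteq> \<Union> (range (\<lambda>n. blocks (?X n)))" by (auto simp: C_def)
        show "subset.chain (range (\<lambda>n. blocks (?X n))) (range (\<lambda>n. blocks (?X n)))"
          unfolding subset_chain_def
        proof (intro conjI ballI subset_refl)
          fix Y Z assume "Y \<in> range (\<lambda>n. blocks (?X n))" "Z \<in> range (\<lambda>n. blocks (?X n))"
          then obtain m n where "Y = blocks (?X m)" "Z = blocks (?X n)" by blast
          then show "Y \<subseteq> Z \<or> Z \<subseteq> Y" using mono[of m n] mono[of n m] nat_le_linear[of m n] by blast
        qed
      qed auto
    qed
    then obtain n where n: "J \<inter> C \<subseteq> blocks (?X n)" ..
    have "?h B \<longleftrightarrow> B \<in> blocks (?X n)" if "B \<in> J" for B
      using that J(1) n by (auto simp: C_def)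
    then show ?thesis using sf by blast
  qed
  then have "?h \<in> char_fun S v ` H"
    using closed unfolding pointwise_closed_iff by (metis restrict_extensional)
  then obtain t where t: "t \<in> H" "?h = char_fun S v t" by blast
  have eq: "B \<in> C \<longleftrightarrow> B \<in> blocks t" if "B \<in> Fpow (Dset S v)" for B
    using fun_cong[OF t(2), of B] that by (simp add: char_fun_def)
  let ?n = "Suc (length t)"
  have "blocks (?X ?n) \<subseteq> blocks t"
  proof
    fix B assume B: "B \<in> blocks (?X ?n)"
    then have "B \<in> Fpow (Dset S v)" using blocks_Fpow[of "?X ?n"] H sf by blast
    moreover have "B \<in> C" using B unfolding C_def by blast
    ultimately show "B \<in> blocks t" using eq by simp
  qed
  then have "prefix (?X ?n) t"
    using H sf[of ?n] t(1) by (intro blocks_subset_imp_prefix lists_words_nonempty) auto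
  then show False using prefix_length_le by fastforce
qed

text \<open>For each \<open>N\<close>, a limit point \<open>h\<close> determines a member of
  \<open>H\<close> carrying exactly the blocks of \<open>h\<close> within \<open>{1..N}\<close>.
  These members grow by end extension and, without a branch, become stationary; the final one
  represents \<open>h\<close>.\<close>

lemma not_branching_pointwise_closed:
  assumes H: "H \<subseteq> lists (words A)" and nb: "\<not> branching H"
    and take: "\<And>s n. s \<in> H \<Longrightarrow> take n s \<in> H"
  shows "pointwise_closed S v H"
  unfolding pointwise_closed_iff
proof (intro ballI impI)
  fix h assume h: "h \<in> extensional (Fpow (Dset S v))"
    and agree: "\<forall>J\<subseteq>Fpow (Dset S v). finite J \<longrightarrow> (\<exists>s\<in>H. \<forall>B\<in>J. h B \<longleftrightarrow> B \<in> blocks s)"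
  let ?J = "\<lambda>N. Pow ({1..N} \<times> A)"
  have J: "?J N \<subseteq> Fpow (Dset S v)" "finite (?J N)" for N
    using finite_S by (auto simp: Fpow_def Dset_def intro: finite_subset)
  have "\<exists>X\<in>H. blocks X = {B \<in> ?J N. h B}" for N
  proof -
    obtain s where s: "s \<in> H" "\<forall>B\<in>?J N. h B \<longleftrightarrow> B \<in> blocks s"
      using agree[rule_format, OF J(1)[of N] J(2)[of N]] by blast
    obtain n where n: "blocks (take n s) = {B \<in> blocks s. fst ` B \<subseteq> {..N}}"
      using blocks_restrict[OF lists_words_nonempty[OF subsetD[OF H s(1)]], of N] by (elim exE)
    have inJ: "B \<in> ?J N" if "B \<in> blocks s" "fst ` B \<subseteq> {..N}" for B
    proof -
      have "B \<subseteq> Dset S v" using blocks_Fpow[of s] that(1) s(1) H by (auto simp: Fpow_def)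
      then show ?thesis using that(2) by (force simp: Dset_def image_subset_iff)
    qed
    have "blocks (take n s) = {B \<in> ?J N. h B}"
    proof (intro set_eqI iffI)
      fix B assume "B \<in> blocks (take n s)"
      then have B: "B \<in> blocks s" "fst ` B \<subseteq> {..N}" unfolding n by simp_all
      then show "B \<in> {B \<in> ?J N. h B}" using inJ[OF B] bspec[OF s(2) inJ[OF B]] by simp
    next
      fix B assume "B \<in> {B \<in> ?J N. h B}"
      then have B: "B \<in> ?J N" "h B" by simp_all
      then have "fst ` B \<subseteq> {..N}" by auto
      then show "B \<in> blocks (take n s)" unfolding n using bspec[OF s(2) B(1)] B(2) by simp
    qed
    then show ?thesis using take s(1) by blast
  qed
  then obtain X where X: "\<And>N. X N \<in> H" "\<And>N. blocks (X N) = {B \<in> ?J N. h B}" by metis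
  have pre: "prefix (X M) (X N)" if "M \<le> N" for M N
  proof (rule blocks_subset_imp_prefix)
    show "blocks (X M) \<subseteq> blocks (X N)" unfolding X(2) using that by fastforce
  qed (use X(1) H lists_words_nonempty in blast)+
  have "\<exists>N. \<forall>M. length (X M) \<le> length (X N)"
  proof (rule ccontr)
    assume no: "\<nexists>N. \<forall>M. length (X M) \<le> length (X N)"
    let ?P = "{s. \<exists>N. prefix s (X N)}"
    have "branching ?P"
    proof (rule branchingI)
      show "[] \<in> ?P" by simp
      fix s assume "s \<in> ?P"
      then obtain N where N: "prefix s (X N)" by blast
      obtain M where M: "length (X N) < length (X M)" using no by (metis not_le)
      have "N \<le> M"
      proof (rule ccontr)
        assume "\<not> N \<le> M"
        then have "prefix (X M) (X N)" by (intro pre) simp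
        then show False using M prefix_length_le by fastforce
      qed
      then have "prefix s (X M)" using N pre prefix_order.trans by blast
      moreover have "length s < length (X M)" using N M prefix_length_le by fastforce
      ultimately obtain y r where "X M = s @ y # r"
        by (metis prefix_def append_Nil2 less_irrefl neq_Nil_conv)
      then show "\<exists>x. s @ [x] \<in> ?P" by (intro exI[of _ y]) (auto intro!: exI[of _ M])
    qed
    moreover have "?P \<subseteq> H"
    proof
      fix s assume "s \<in> ?P"
      then obtain N r where "X N = s @ r" by (auto simp: prefix_def)
      then show "s \<in> H" using take[OF X(1)[of N], of "length s"] by simp
    qed
    ultimately show False using nb branching_mono by blast
  qed
  then obtain N where N: "\<And>M. length (X M) \<le> length (X N)" by blast
  have eqX: "X M = X N" if "N \<le> M" for M
    using pre[OF that] N[of M] by (auto simp: prefix_def)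
  have "h = char_fun S v (X N)"
  proof (rule extensionalityI[OF h])
    show "char_fun S v (X N) \<in> extensional (Fpow (Dset S v))" by (simp add: char_fun_def)
    fix B assume B: "B \<in> Fpow (Dset S v)"
    then have fin: "finite B" and sub: "B \<subseteq> {1..} \<times> A" by (auto simp: Fpow_def Dset_def)
    define M where "M = max N (Max (insert 0 (fst ` B)))"
    have "B \<in> ?J M"
    proof -
      have "i \<le> M" if "(i, a) \<in> B" for i a
      proof -
        have "i \<le> Max (insert 0 (fst ` B))" using fin that by (intro Max_ge) force+
        then show ?thesis by (simp add: M_def)
      qed
      then show ?thesis using sub by auto
    qed
    then have "h B \<longleftrightarrow> B \<in> blocks (X M)" unfolding X(2) by blast
    also have "X M = X N" by (rule eqX) (simp add: M_def)
    finally show "h B = char_fun S v (X N) B" using B by (simp add: char_fun_def)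
  qed
  then show "h \<in> char_fun S v ` H" using X(1) by blast
qed

end

section \<open>The dichotomy\<close>

lemma is_tree_take: "is_tree H \<Longrightarrow> s \<in> H \<Longrightarrow> take n s \<in> H"
  unfolding is_tree_def star_def using take_is_prefix by blast

lemma is_tree_Nil: "is_tree H \<Longrightarrow> [] \<in> H"
  unfolding is_tree_def star_def by blast

context alphabet
begin

lemma reds_words_A: "vseq u \<Longrightarrow> kind K \<Longrightarrow> H \<subseteq> reds K u \<Longrightarrow> H \<subseteq> lists (words A)"
  using reds_subset by blast

text \<open>Reductions are injective in the pattern, so the patterns along the branch cohere and
  glue to one infinite pattern.\<close>

lemma branching_reds:
  assumes u: "vseq u" and K: "kind K" and H: "H \<subseteq> reds K u" and br: "branching H"
  shows "\<exists>t. (\<forall>i. t i \<in> K) \<and> (\<exists>N. \<forall>n\<ge>N. map (red_inf v u t) [0..<n] \<in> H)"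
proof -
  obtain s f where sf: "\<And>n. s @ map f [0..<n] \<in> H" using br unfolding branching_def by blast
  have "\<exists>r. r \<in> lists K \<and> red_fin v u r = s @ map f [0..<n]" for n
    using sf[of n] H unfolding reds_def by force
  then obtain r where r: "\<And>n. r n \<in> lists K" "\<And>n. red_fin v u (r n) = s @ map f [0..<n]" by metis
  have len: "length (r n) = length s + n" for n
    using arg_cong[OF r(2)[of n], of length] by simp
  have r_take: "take (length s + m) (r n) = r m" if "m \<le> n" for m n
  proof -
    have "red_fin v u (take (length s + m) (r n)) = red_fin v u (r m)"
      unfolding take_red_fin[symmetric] r(2) using that by (simp add: take_map)
    then show ?thesis by (simp add: red_fin_inject[OF u])
  qed
  have r_nth: "r m ! i = r n ! i" if "m \<le> n" "i < length s + m" for m n i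
    using nth_take[OF that(2), of "r n"] unfolding r_take[OF that(1)] by simp
  define t where "t i = r (Suc i) ! i" for i
  have tr: "map t [0..<length s + n] = r n" for n
  proof (rule nth_equalityI)
    fix i assume "i < length (map t [0..<length s + n])"
    then have i: "i < length s + n" by simp
    let ?M = "max n (Suc i)"
    have "r n ! i = r ?M ! i" using r_nth[of n ?M i] i by simp
    moreover have "r (Suc i) ! i = r ?M ! i" using r_nth[of "Suc i" ?M i] by simp
    ultimately show "map t [0..<length s + n] ! i = r n ! i" using i by (simp add: t_def)
  qed (simp add: len)
  have "t i \<in> K" for i
    using r(1)[of "Suc i"] len[of "Suc i"] nth_mem[of i "r (Suc i)"] by (auto simp: t_def lists_eq_set)
  moreover have "map (red_inf v u t) [0..<n] \<in> H" if "n \<ge> length s" for n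
    using sf[of "n - length s"] tr[of "n - length s"] that
    by (simp only: red_inf_map_prefix r(2)[symmetric] le_add_diff_inverse)
  ultimately show ?thesis by blast
qed

lemma hered_words_subset: "is_tree T \<Longrightarrow> hered_words S v T \<subseteq> T"
  using is_tree_Nil by (auto simp: hered_words_def)

lemma take_hered_vwords:
  assumes "is_tree T" "s \<in> hered_vwords S v T"
  shows "take n s \<in> hered_vwords S v T"
proof (cases "take n s = []")
  case False
  then have "s \<noteq> []" by auto
  then have s: "s \<in> T" "\<forall>t1. t1 \<noteq> [] \<and> prefix t1 s \<longrightarrow> VRW_list S v t1 \<subseteq> T"
    using assms(2) by (auto simp: hered_vwords_def)
  then have "\<forall>t1. t1 \<noteq> [] \<and> prefix t1 (take n s) \<longrightarrow> VRW_list S v t1 \<subseteq> T"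
    using take_is_prefix prefix_order.trans by blast
  then show ?thesis using is_tree_take[OF assms(1) s(1)] False unfolding hered_vwords_def by blast
qed (simp add: hered_vwords_def)

theorem index_dichotomy:
  assumes adm: "admissible K pr her" and w: "vseq w" and fs: "ladder_system fs"
    and T: "T \<subseteq> lists K" "is_tree T" and nb: "\<not> branching (her T \<inter> reds K w)"
  shows "\<exists>\<zeta>. is_sup_of_indices (\<lambda>u. variable_reduction S v u w)
      (\<lambda>u. derivs K pr u (her T \<inter> reds K w)) \<zeta> \<and>
    (\<forall>x>\<zeta>. \<exists>u. variable_reduction S v u w \<and>
      {s \<in> lists K. s \<noteq> [] \<and> schreier fs x (dset s)} \<inter> reds K u \<subseteq> lists K - T)"
proof -
  have K: "kind K" using adm by (rule admissible_kind)
  let ?H = "her T \<inter> reds K w"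
  let ?D = "\<lambda>u. derivs K pr u ?H"
  let ?Y = "{y. \<exists>u. variable_reduction S v u w \<and> is_sO (?D u) y}"
  have "?H \<subseteq> lists (words A)" using reds_words_A[OF w K] by blast
  from derivs_vanish[OF adm nb this] obtain x0 where
    x0: "\<And>u. vseq u \<Longrightarrow> ?D u x0 = {}" by blast
  have sO: "\<exists>y. is_sO (?D u) y" if "variable_reduction S v u w" for u
  proof -
    let ?y = "LEAST y. ?D u y = {}"
    have "?D u ?y = {}" by (rule LeastI[of _ x0]) (rule x0, rule variable_reduction_vseq[OF w that])
    moreover have "?D u y \<noteq> {}" if "y < ?y" for y using that by (rule not_less_Least)
    ultimately show ?thesis unfolding is_sO_def by blast
  qed
  have bdd: "bdd_above ?Y"
  proof (rule bdd_aboveI[of _ x0])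
    fix y assume "y \<in> ?Y"
    then obtain u where u: "variable_reduction S v u w" "is_sO (?D u) y" by blast
    then have "?D u x0 = {}" using x0 variable_reduction_vseq[OF w] by blast
    then show "y \<le> x0" using u(2) unfolding is_sO_def by (metis not_le)
  qed
  have "\<exists>u. variable_reduction S v u w \<and>
      {s \<in> lists K. s \<noteq> [] \<and> schreier fs x (dset s)} \<inter> reds K u \<subseteq> lists K - T"
    if x: "x > Sup ?Y" for x
  proof -
    let ?O = "{s \<in> T. s \<noteq> [] \<and> schreier fs x (dset s)}"
    obtain u where u: "variable_reduction S v u w" "reds K u \<inter> ?O = {} \<or>
        (\<forall>t. (\<forall>i. t i \<in> K) \<longrightarrow> (\<exists>n. map (red_inf v u t) [0..<n] \<in> ?O))"
      using open_ramsey[OF K, of w ?O] by blast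
    show ?thesis
    proof (cases "reds K u \<inter> ?O = {}")
      case True
      then show ?thesis using u(1) by blast
    next
      case False
      have hit: "\<exists>n\<ge>1. map (red_inf v u t) [0..<n] \<in> T \<and> schreier fs x (dset (map (red_inf v u t) [0..<n]))"
        if t: "\<forall>i. t i \<in> K" for t
      proof -
        obtain n where n: "map (red_inf v u t) [0..<n] \<in> ?O" using u(2) False t by blast
        then have "n \<ge> 1" by (cases n) auto
        then show ?thesis using n by blast
      qed
      obtain u' where u': "variable_reduction S v u' w" "\<forall>b<x. ?D u' b \<noteq> {}"
        using derivs_lower_bound[OF adm w u(1) fs is_tree_take[OF T(2)] hit] by blast
      obtain y where y: "is_sO (?D u') y" using sO[OF u'(1)] by blast
      have "y \<le> Sup ?Y" using y u'(1) bdd by (intro cSup_upper) blast+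
      then have "y < x" using x by simp
      then show ?thesis using u'(2) y unfolding is_sO_def by blast
    qed
  qed
  then show ?thesis using sO bdd unfolding is_sup_of_indices_def by (intro exI[of _ "Sup ?Y"]) blast
qed

text \<open>The branch itself is the reduction sought: a finite variable reduction of it consumes
  one of its initial segments completely, so heredity places it in \<open>F\<close>.\<close>

lemma branching_vwords_reduction:
  assumes w: "vseq w" and F: "is_tree F" and br: "branching (hered_vwords S v F \<inter> VRW_fin S v w)"
  shows "\<exists>u. variable_reduction S v u w \<and> VRW_fin S v u \<subseteq> F"
proof -
  have V: "kind (vwords S v)" by (simp add: kind_def)
  obtain t N where t: "\<forall>i. t i \<in> vwords S v"
    "\<And>n. n \<ge> N \<Longrightarrow> map (red_inf v w t) [0..<n] \<in> hered_vwords S v F"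
    using branching_reds[OF w V _ br] unfolding reds_vwords by blast
  let ?u = "red_inf v w t"
  have ut: "variable_reduction S v ?u w" using t(1) unfolding variable_reduction_iff vseq_def by blast
  have u: "vseq ?u" using variable_reduction_vseq[OF w ut] .
  have "red_fin v ?u r \<in> F" if r: "r \<in> lists (vwords S v)" for r
  proof (cases "r = []")
    case True
    then show ?thesis using is_tree_Nil[OF F] by simp
  next
    case False
    let ?M = "length (concat r)"
    have "\<forall>x\<in>set r. x \<noteq> []" using r kind_nonempty[OF V] by (auto simp: lists_eq_set)
    then have M: "?M > 0" using concat_nonempty[OF False] by blast
    \<comment> \<open>\<open>?p\<close> has exactly the terms consumed by \<open>r\<close>;
      \<open>?q\<close> is long enough to lie in the part of the branch known to be
      hereditary.\<close>
    let ?p = "map ?u [0..<?M]" and ?q = "map ?u [0..<max N ?M]"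
    have "?q = ?p @ map ?u [?M..<max N ?M]"
      by (metis le_Suc_ex map_append max.cobounded2 upt_add_eq_append zero_le)
    then have "prefix ?p ?q" by simp
    moreover have "?q \<in> hered_vwords S v F" by (rule t(2)) simp
    moreover have "?p \<noteq> []" "?q \<noteq> []" using M by auto
    ultimately have sub: "VRW_list S v ?p \<subseteq> F" unfolding hered_vwords_def by blast
    have eq: "red_fin v ((!) ?p) r = red_fin v ?u r" by (rule red_fin_cong) simp
    have rA: "r \<in> lists (words A)" using kind_lists[OF V r] .
    have "red_fin v ?u r \<in> lists (vwords S v)" using red_fin_lists_kind[OF u V rA] r by simp
    then have "red_fin v ?u r \<in> VRW_list S v ?p"
      unfolding VRW_list_def using rA eq by (intro CollectI bexI[of _ r]) simp_all
    then show ?thesis using sub by blast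
  qed
  then have "VRW_fin S v ?u \<subseteq> F" by (auto simp: VRW_fin_def)
  then show ?thesis using ut by blast
qed

lemma cb_words_eq: "cb_words S v u = derivs (words S) strict_prefix u"
  by (intro ext) (simp add: cb_words_def reds_words RW_def)

lemma cb_vwords_eq: "cb_vwords S v u = derivs (vwords S v) (propto_var S v) u"
  by (intro ext) (simp add: cb_vwords_def reds_vwords VRW_def)

text \<open>Outside the closed case the Ramsey theorem for the complement of \<open>G\<close> gives
  a reduction \<open>u\<close> inside \<open>G\<close>, or one whose infinite reductions all leave
  \<open>G\<close>. The latter removes the branches over \<open>u\<close>, so the dichotomy applies
  with \<open>u\<close> in place of \<open>w\<close> and returns to \<open>w\<close> by
  transitivity.\<close>

theorem words_dichotomy:
  assumes fs: "ladder_system fs" and G: "G \<subseteq> lists (words S)" "is_tree G" and w: "vseq w"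
  shows "(\<exists>u. variable_reduction S v u w \<and> RW_fin S v u \<subseteq> G) \<or>
      (\<exists>x1. (pointwise_closed S v (hered_words S v G \<inter> RW_fin S v w) \<longrightarrow> is_zeta_words S v G w x1) \<and>
        (\<forall>x>x1. \<exists>u. variable_reduction S v u w \<and>
           Wxi fs S x \<inter> RW_fin S v u \<subseteq> lists (words S) - G))"
proof (rule disjCI)
  assume no: "\<not> (\<exists>x1. (pointwise_closed S v (hered_words S v G \<inter> RW_fin S v w) \<longrightarrow> is_zeta_words S v G w x1) \<and>
        (\<forall>x>x1. \<exists>u. variable_reduction S v u w \<and>
           Wxi fs S x \<inter> RW_fin S v u \<subseteq> lists (words S) - G))"
  have W: "kind (words S)" by (simp add: kind_def)
  have adm: "admissible (words S) strict_prefix (hered_words S v)" by (simp add: admissible_def)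
  note dich = index_dichotomy[OF adm _ fs G, unfolded reds_words]
  have Wxi: "Wxi fs S x = {s \<in> lists (words S). s \<noteq> [] \<and> schreier fs x (dset s)}" for x
    by (simp add: Wxi_def)
  have nclosed: "\<not> pointwise_closed S v (hered_words S v G \<inter> RW_fin S v w)"
  proof
    assume closed: "pointwise_closed S v (hered_words S v G \<inter> RW_fin S v w)"
    have "hered_words S v G \<inter> RW_fin S v w \<subseteq> lists (words A)"
      using reds_words_A[OF w W] unfolding reds_words by blast
    then have "\<not> branching (hered_words S v G \<inter> RW_fin S v w)"
      using pointwise_closed_not_branching closed by blast
    from dich[OF w this] show False
      using no unfolding is_zeta_words_def cb_words_eq Wxi reds_words by blast
  qed
  obtain u where u: "variable_reduction S v u w" "reds (words S) u \<inter> - G = {} \<or>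
      (\<forall>t. (\<forall>i. t i \<in> words S) \<longrightarrow> (\<exists>n. map (red_inf v u t) [0..<n] \<in> - G))"
    using open_ramsey[OF W, of w "- G"] by blast
  show "\<exists>u. variable_reduction S v u w \<and> RW_fin S v u \<subseteq> G"
  proof (cases "reds (words S) u \<inter> - G = {}")
    case True
    then show ?thesis using u(1) unfolding reds_words by blast
  next
    case False
    have vu: "vseq u" using variable_reduction_vseq[OF w u(1)] .
    have "\<not> branching (hered_words S v G \<inter> RW_fin S v u)"
    proof
      assume "branching (hered_words S v G \<inter> RW_fin S v u)"
      then obtain t N where t: "\<forall>i. t i \<in> words S"
        "\<And>n. n \<ge> N \<Longrightarrow> map (red_inf v u t) [0..<n] \<in> hered_words S v G"
        using branching_reds[OF vu W, of "hered_words S v G \<inter> RW_fin S v u"] unfolding reds_words by blast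
      obtain n where n: "map (red_inf v u t) [0..<n] \<notin> G" using u(2) False t(1) by blast
      have "map (red_inf v u t) [0..<max n N] \<in> G" using t(2)[of "max n N"] hered_words_subset[OF G(2)] by auto
      from is_tree_take[OF G(2) this, of n] show False using n by (simp add: take_map)
    qed
    from dich[OF vu this] obtain x1 where x1: "\<And>x. x > x1 \<Longrightarrow> \<exists>u'. variable_reduction S v u' u \<and>
        Wxi fs S x \<inter> RW_fin S v u' \<subseteq> lists (words S) - G" unfolding Wxi reds_words by blast
    then have "\<forall>x>x1. \<exists>u. variable_reduction S v u w \<and> Wxi fs S x \<inter> RW_fin S v u \<subseteq> lists (words S) - G"
      using variable_reduction_trans[OF _ u(1)] by blast
    then show ?thesis using no nclosed by blast
  qed
qed

theorem vwords_dichotomy: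
  assumes fs: "ladder_system fs" and F: "F \<subseteq> lists (vwords S v)" "is_tree F" and w: "vseq w"
  shows "(\<exists>u. variable_reduction S v u w \<and> VRW_fin S v u \<subseteq> F) \<or>
      (\<exists>x2. pointwise_closed S v (hered_vwords S v F \<inter> VRW_fin S v w) \<and> is_zeta_vwords S v F w x2 \<and>
        (\<forall>x>x2. \<exists>u. variable_reduction S v u w \<and>
           VWxi fs S v x \<inter> VRW_fin S v u \<subseteq> lists (vwords S v) - F))"
proof (subst disj_commute, rule disjCI)
  assume no: "\<not> (\<exists>u. variable_reduction S v u w \<and> VRW_fin S v u \<subseteq> F)"
  have V: "kind (vwords S v)" by (simp add: kind_def)
  have adm: "admissible (vwords S v) (propto_var S v) (hered_vwords S v)" by (simp add: admissible_def)
  let ?H = "hered_vwords S v F \<inter> VRW_fin S v w"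
  have nb: "\<not> branching ?H" using branching_vwords_reduction[OF w F(2)] no by blast
  have HA: "?H \<subseteq> lists (words A)" using reds_words_A[OF w V] unfolding reds_vwords by blast
  have "take n s \<in> ?H" if s: "s \<in> ?H" for s n
  proof -
    obtain t where t: "t \<in> lists (vwords S v)" "s = red_fin v w t" using s by (auto simp: VRW_fin_def)
    then have "take n s = red_fin v w (take n t)" by (simp add: take_red_fin)
    moreover have "take n t \<in> lists (vwords S v)" using t(1) by (auto simp: lists_eq_set dest: in_set_takeD)
    ultimately have "take n s \<in> VRW_fin S v w" by (auto simp: VRW_fin_def)
    then show ?thesis using take_hered_vwords[OF F(2)] s by blast
  qed
  then have "pointwise_closed S v ?H" by (rule not_branching_pointwise_closed[OF HA nb])
  moreover note index_dichotomy[OF adm w fs F, unfolded reds_vwords, OF nb]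
  ultimately show "\<exists>x2. pointwise_closed S v ?H \<and> is_zeta_vwords S v F w x2 \<and>
        (\<forall>x>x2. \<exists>u. variable_reduction S v u w \<and>
           VWxi fs S v x \<inter> VRW_fin S v u \<subseteq> lists (vwords S v) - F)"
    unfolding is_zeta_vwords_def cb_vwords_eq reds_vwords VWxi_def by blast
qed

end

theorem theoremB:
  fixes S :: "'a set" and v :: 'a
    and G F :: "'a list list set"
    and w :: "nat \<Rightarrow> 'a list"
    and fs :: "cord \<Rightarrow> nat \<Rightarrow> cord"
  assumes "finite S" and "S \<noteq> {}" and "v \<notin> S"
    and "ladder_system fs"
    and "G \<subseteq> lists (words S)" and "is_tree G"
    and "F \<subseteq> lists (vwords S v)" and "is_tree F"
    and "\<forall>n. w n \<in> vwords S v"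
  shows
    "((\<exists>u. variable_reduction S v u w \<and> RW_fin S v u \<subseteq> G) \<or>
      (\<exists>\<xi>\<^sub>1. (pointwise_closed S v (hered_words S v G \<inter> RW_fin S v w) \<longrightarrow>
                is_zeta_words S v G w \<xi>\<^sub>1) \<and>
        (\<forall>\<xi>>\<xi>\<^sub>1. \<exists>u. variable_reduction S v u w \<and>
           Wxi fs S \<xi> \<inter> RW_fin S v u \<subseteq> lists (words S) - G))) \<and>
     ((\<exists>u. variable_reduction S v u w \<and> VRW_fin S v u \<subseteq> F) \<or>
      (\<exists>\<xi>\<^sub>2. pointwise_closed S v (hered_vwords S v F \<inter> VRW_fin S v w) \<and>
        is_zeta_vwords S v F w \<xi>\<^sub>2 \<and>
        (\<forall>\<xi>>\<xi>\<^sub>2. \<exists>u. variable_reduction S v u w \<and>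
           VWxi fs S v \<xi> \<inter> VRW_fin S v u \<subseteq> lists (vwords S v) - F)))"
proof -
  interpret alphabet S v using assms(1-3) by unfold_locales
  have w: "vseq w" using assms(9) by (simp add: vseq_def)
  show ?thesis
    using words_dichotomy[OF assms(4-6) w] vwords_dichotomy[OF assms(4) assms(7,8) w] by (rule conjI)
qed

end
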